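(* Let $F$ be a non-trivial finite group and define $H_0(k)=\mathbb{Z}^k$, $H_{n+1}(k)=F\wr H_n(k)$ for integers $k\ge1$, $n\ge0$. Let $n\ge1$ be an integer and let $d,k\ge1$ be integers. For $p>0$, there exists a $((\log^{\circ n})^p,\mathrm{L}^0)$-integrable measure equivalence coupling from $H_n(1)$ to $\mathbb{Z}$ if and only if $p<1$.
   Context: $\log^{\circ n}$ is the $n$-fold composition $\log\circ\cdots\circ\log$; $(\log^{\circ n})^{p}$ is used as a non-decreasing function $\mathbb{R}_+\to\mathbb{R}_+$ agreeing with $t\mapsto(\log^{\circ n}t)^{p}$ for large $t$. Wreath product: $F\wr G=\left(\bigoplus_{g\in G}F\right)\rtimes G$, where $\bigoplus_{g\in G}F$ is the group of finitely supported functions $G\to F$ and $G$ acts by $(g\cdot f)(g')=f(g^{-1}g')$. Measure equivalence coupling between countable groups $\Gamma,\Lambda$: a quadruple $(\Omega,X_\Gamma,X_\Lambda,\mu)$ where $(\Omega,\mu)$ is a standard Borel measure space with commuting, free, measure-preserving actions $\gamma\ast x$, $\lambda\ast x$ of $\Gamma$ and $\Lambda$, and $X_\Gamma$ (resp. $X_\Lambda$) is a Borel fundamental domain of finite measure for the $\Gamma$-action (resp. $\Lambda$-action). For $\gamma\in\Gamma$, $x\in X_\Lambda$, $\gamma\cdot x$ is the unique point of $(\Lambda\ast\gamma\ast x)\cap X_\Lambda$ and the cocycle $c_{\Lambda,\Gamma}\colon\Gamma\times X_\Lambda\to\Lambda$ is defined by $c_{\Lambda,\Gamma}(\gamma,x)\ast\gamma\ast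 x=\gamma\cdot x$. For non-decreasing $\varphi\colon\mathbb{R}_+\to\mathbb{R}_+$, $c_{\Lambda,\Gamma}$ is $\varphi$-integrable if for every $\gamma\in\Gamma$ there is $c_\gamma>0$ with $\int_{X_\Lambda}\varphi(|c_{\Lambda,\Gamma}(\gamma,x)|_{S_\Lambda}/c_\gamma)\,d\mu(x)<+\infty$ ($|\cdot|_{S_\Lambda}$ the word length for a finite generating set of $\Lambda$). A $(\varphi,\mathrm{L}^0)$-integrable coupling from $\Gamma$ to $\Lambda$ is one for which $c_{\Lambda,\Gamma}$ is $\varphi$-integrable (no requirement on the other cocycle). *)

theory Defs
  imports "HOL-Analysis.Analysis" "HOL-Algebra.Elementary_Groups" "HOL-Library.FSet"
begin

text \<open>Elements of the groups H_n(k) for all n are represented in one datatype.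
  Zel v represents v in Z^k (a list of length k); Wel S h represents the element (f,h)
  of F wr H_{n-1}(k), where the finitely supported function f is given by its graph
  restricted to its support, i.e. the finite set S of pairs (g, f g) with f g non-trivial.\<close>

datatype 'f wel = Zel "int list" | Wel "('f wel \<times> 'f) fset" "'f wel"

definition lampf :: "('f, 'b) monoid_scheme \<Rightarrow> ('f wel \<times> 'f) fset \<Rightarrow> 'f wel \<Rightarrow> 'f" where
  "lampf F S g = (if \<exists>a. (g, a) |\<in>| S then (THE a. (g, a) |\<in>| S) else \<one>\<^bsub>F\<^esub>)"

definition fs_combine :: "('f, 'b) monoid_scheme \<Rightarrow> ('f wel \<times> 'f) fset \<Rightarrow> ('f wel \<times> 'f) fset
    \<Rightarrow> ('f wel \<times> 'f) fset" where
  "fs_combine F S T = Abs_fset {(g, lampf F S g \<otimes>\<^bsub>F\<^esub> lampf F T g) | g.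
      g \<in> fst ` fset S \<union> fst ` fset T \<and> lampf F S g \<otimes>\<^bsub>F\<^esub> lampf F T g \<noteq> \<one>\<^bsub>F\<^esub>}"

primrec Hcar :: "('f, 'b) monoid_scheme \<Rightarrow> nat \<Rightarrow> nat \<Rightarrow> 'f wel set" where
  "Hcar F k 0 = {Zel v | v. length v = k}"
| "Hcar F k (Suc n) = {Wel S h | S h. h \<in> Hcar F k n \<and> fst ` fset S \<subseteq> Hcar F k n
      \<and> snd ` fset S \<subseteq> carrier F - {\<one>\<^bsub>F\<^esub>}
      \<and> (\<forall>g a b. (g, a) |\<in>| S \<and> (g, b) |\<in>| S \<longrightarrow> a = b)}"

primrec Hone :: "nat \<Rightarrow> nat \<Rightarrow> 'f wel" where
  "Hone k 0 = Zel (replicate k 0)"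
| "Hone k (Suc n) = Wel {||} (Hone k n)"

text \<open>Multiplication in F wr G: (f,h)(f',h') = (f (h.f'), h h') with (h.f')(g) = f'(h^-1 g),
  so the support of h.f' is the left translate by h of the support of f'.\<close>
primrec Hmult :: "('f, 'b) monoid_scheme \<Rightarrow> nat \<Rightarrow> 'f wel \<Rightarrow> 'f wel \<Rightarrow> 'f wel" where
  "Hmult F 0 x y = (case (x, y) of (Zel u, Zel v) \<Rightarrow> Zel (map2 (+) u v) | _ \<Rightarrow> undefined)"
| "Hmult F (Suc n) x y = (case (x, y) of
      (Wel S h, Wel T h') \<Rightarrow>
        Wel (fs_combine F S ((\<lambda>(g, a). (Hmult F n h g, a)) |`| T)) (Hmult F n h h')
    | _ \<Rightarrow> undefined)"

definition Hgrp :: "('f, 'b) monoid_scheme \<Rightarrow> nat \<Rightarrow> nat \<Rightarrow> 'f wel monoid" where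
  "Hgrp F k n = \<lparr>carrier = Hcar F k n, mult = Hmult F n, one = Hone k n\<rparr>"

definition word_length :: "('g, 'a) monoid_scheme \<Rightarrow> 'g set \<Rightarrow> 'g \<Rightarrow> nat" where
  "word_length G S g = (LEAST m. \<exists>ws. length ws = m \<and> set ws \<subseteq> S \<union> (m_inv G ` S)
      \<and> foldr (\<otimes>\<^bsub>G\<^esub>) ws \<one>\<^bsub>G\<^esub> = g)"

definition standard_borel :: "'o measure \<Rightarrow> bool" where
  "standard_borel M \<longleftrightarrow> (\<exists>T. topspace T = space M \<and> completely_metrizable_space T
      \<and> separable_space T \<and> sets M = sigma_sets (space M) {U. openin T U})"

definition mp_free_action :: "('g, 'a) monoid_scheme \<Rightarrow> 'o measure \<Rightarrow> ('g \<Rightarrow> 'o \<Rightarrow> 'o) \<Rightarrow> bool" where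
  "mp_free_action G M \<alpha> \<longleftrightarrow>
     (\<forall>g\<in>carrier G. \<alpha> g \<in> M \<rightarrow>\<^sub>M M
        \<and> (\<forall>A\<in>sets M. emeasure M (\<alpha> g -` A \<inter> space M) = emeasure M A))
   \<and> (\<forall>x\<in>space M. \<alpha> \<one>\<^bsub>G\<^esub> x = x)
   \<and> (\<forall>g\<in>carrier G. \<forall>h\<in>carrier G. \<forall>x\<in>space M. \<alpha> (g \<otimes>\<^bsub>G\<^esub> h) x = \<alpha> g (\<alpha> h x))
   \<and> (\<forall>g\<in>carrier G. \<forall>x\<in>space M. \<alpha> g x = x \<longrightarrow> g = \<one>\<^bsub>G\<^esub>)"

definition fundamental_domain :: "('g, 'a) monoid_scheme \<Rightarrow> 'o measure \<Rightarrow> ('g \<Rightarrow> 'o \<Rightarrow> 'o)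
    \<Rightarrow> 'o set \<Rightarrow> bool" where
  "fundamental_domain G M \<alpha> X \<longleftrightarrow> X \<in> sets M \<and> emeasure M X < \<infinity>
     \<and> (\<forall>x\<in>space M. \<exists>!g. g \<in> carrier G \<and> \<alpha> g x \<in> X)"

definition ME_coupling :: "('g, 'a) monoid_scheme \<Rightarrow> ('l, 'c) monoid_scheme \<Rightarrow> 'o measure
    \<Rightarrow> ('g \<Rightarrow> 'o \<Rightarrow> 'o) \<Rightarrow> ('l \<Rightarrow> 'o \<Rightarrow> 'o) \<Rightarrow> 'o set \<Rightarrow> 'o set \<Rightarrow> bool" where
  "ME_coupling \<Gamma> \<Lambda> M \<alpha> \<beta> X\<Gamma> X\<Lambda> \<longleftrightarrow>
     standard_borel M \<and> emeasure M (space M) \<noteq> 0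
   \<and> mp_free_action \<Gamma> M \<alpha> \<and> mp_free_action \<Lambda> M \<beta>
   \<and> (\<forall>g\<in>carrier \<Gamma>. \<forall>l\<in>carrier \<Lambda>. \<forall>x\<in>space M. \<alpha> g (\<beta> l x) = \<beta> l (\<alpha> g x))
   \<and> fundamental_domain \<Gamma> M \<alpha> X\<Gamma> \<and> fundamental_domain \<Lambda> M \<beta> X\<Lambda>"

text \<open>For y in Omega, the unique lambda with lambda * y in X_Lambda; then
  c_{Lambda,Gamma}(gamma, x) = cocycle (gamma * x).\<close>
definition cocycle_at :: "('l, 'c) monoid_scheme \<Rightarrow> ('l \<Rightarrow> 'o \<Rightarrow> 'o) \<Rightarrow> 'o set \<Rightarrow> 'o \<Rightarrow> 'l" where
  "cocycle_at \<Lambda> \<beta> X\<Lambda> y = (THE l. l \<in> carrier \<Lambda> \<and> \<beta> l y \<in> X\<Lambda>)"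

definition phi_integrable_cocycle :: "(real \<Rightarrow> real) \<Rightarrow> ('g, 'a) monoid_scheme
    \<Rightarrow> ('l, 'c) monoid_scheme \<Rightarrow> 'l set \<Rightarrow> 'o measure \<Rightarrow> ('g \<Rightarrow> 'o \<Rightarrow> 'o)
    \<Rightarrow> ('l \<Rightarrow> 'o \<Rightarrow> 'o) \<Rightarrow> 'o set \<Rightarrow> bool" where
  "phi_integrable_cocycle \<phi> \<Gamma> \<Lambda> S M \<alpha> \<beta> X\<Lambda> \<longleftrightarrow>
     (\<forall>\<gamma>\<in>carrier \<Gamma>. \<exists>c>0.
        (\<integral>\<^sup>+ x\<in>X\<Lambda>. ennreal (\<phi> (real (word_length \<Lambda> S (cocycle_at \<Lambda> \<beta> X\<Lambda> (\<alpha> \<gamma> x))) / c)) \<partial>M)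
          < \<infinity>)"

text \<open>(phi, L^0)-integrable coupling from Gamma to Lambda (S a finite generating set of Lambda)\<close>
definition phi_L0_coupling :: "(real \<Rightarrow> real) \<Rightarrow> ('g, 'a) monoid_scheme
    \<Rightarrow> ('l, 'c) monoid_scheme \<Rightarrow> 'l set \<Rightarrow> 'o measure \<Rightarrow> ('g \<Rightarrow> 'o \<Rightarrow> 'o)
    \<Rightarrow> ('l \<Rightarrow> 'o \<Rightarrow> 'o) \<Rightarrow> 'o set \<Rightarrow> 'o set \<Rightarrow> bool" where
  "phi_L0_coupling \<phi> \<Gamma> \<Lambda> S M \<alpha> \<beta> X\<Gamma> X\<Lambda> \<longleftrightarrow>
     ME_coupling \<Gamma> \<Lambda> M \<alpha> \<beta> X\<Gamma> X\<Lambda> \<and> phi_integrable_cocycle \<phi> \<Gamma> \<Lambda> S M \<alpha> \<beta> X\<Lambda>"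

end

theory Submission
  imports Defs
begin

text \<open>
  Write \<open>\<Gamma> = H_n(1)\<close> and let \<open>L\<close> be the \<open>n\<close>-fold iterated logarithm.

  \<^item> No coupling for \<open>p \<ge> 1\<close>. In a coupling, the union \<open>A\<close> of \<open>N\<close> consecutive \<open>\<int>\<close>-translates of
  \<open>X\<^sub>\<Lambda>\<close> meets most \<open>\<Gamma>\<close>-orbits in at most \<open>O(N)\<close> points, by uniform integrability of ergodic averages,
  and its \<open>\<Gamma>\<close>-boundary is at most the integral of \<open>min |c| N\<close>. Every finite subset of \<open>\<Gamma>\<close> of size
  \<open>v\<close> has relative boundary at least of order \<open>1 / L v\<close>; this goes up from \<open>G\<close> to \<open>F wr G\<close> because a
  set with small boundary contains a family of lamp configurations in which most members can be
  changed at many positions without leaving the family, and such a family is exponentially large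
  (edge-isoperimetry in a Hamming graph). So \<open>L N / N\<close> times the integral of \<open>min |c| N\<close> stays away
  from \<open>0\<close>, whereas integrability of \<open>L |c|\<close> makes it tend to \<open>0\<close> by dominated convergence. Since
  only the integrability of \<open>L |c|\<close> itself enters, this covers the critical case \<open>p = 1\<close>.

  \<^item> Coupling for \<open>p < 1\<close>. Starting from \<open>{0..<2 ^ k}\<close> in \<open>\<int>\<close>, the sets
  \<open>{(f, h). supp f \<subseteq> T k \<and> h \<in> T k}\<close> form a sequence of Foelner tiles in which each tile is partitioned
  by left translates of the previous one. Cutting \<open>[0, 1)\<close> into intervals indexed simultaneously by
  \<open>T k\<close> and by the interval \<open>{- N k<..0}\<close> of \<open>\<int>\<close>, where \<open>N k = card (T k)\<close>, yields an orbit equivalence of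
  \<open>\<Gamma>\<close> with \<open>\<int>\<close>, realised as a coupling on a subset of \<open>\<real>\<close> on which both groups act by piecewise
  translations. The cocycle is bounded by \<open>N k\<close> outside a set of measure \<open>O(2 ^ -k)\<close>, and
  \<open>L (N k) = O(2 ^ k)\<close>.
\<close>

text \<open>The threshold \<open>p = 1\<close> comes from two matching estimates: the tiles of size
  \<open>v\<close> have relative boundary at most of order \<open>1 / L v\<close>, and no set does
  better. In the construction the cocycle can exceed \<open>N k\<close> only on a set of measure
  O(2^-k), where the next level bounds it by \<open>N (Suc k)\<close>; the \<open>p\<close>-th power
  is thus controlled by the sum of 2^(p k) 2^-k.

  Orbits with too many visits have to be discarded without losing most of the mass.

  In the wreath product step, lamps are recorded as seen from the cursor. A move then changes only
  the cursor and a switch only one lamp, so a finite set becomes a family of subsets of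
  \<open>G\<close> indexed by configurations.

  Both one-sided boundaries occur. The set of \<open>g\<close> with \<open>\<alpha> g y\<close> in a
  given set is moved by left multiplication, hence \<open>left_exit\<close> in the lower bound.
  Tiles are nested by left translations, so the action built on them multiplies from the right,
  hence \<open>right_exit\<close>.\<close>

abbreviation left_exit :: "('g, 'c) monoid_scheme \<Rightarrow> 'g \<Rightarrow> 'g set \<Rightarrow> 'g set" where
  "left_exit G s A \<equiv> {x \<in> A. s \<otimes>\<^bsub>G\<^esub> x \<notin> A}"

abbreviation right_exit :: "('g, 'c) monoid_scheme \<Rightarrow> 'g set \<Rightarrow> 'g \<Rightarrow> 'g set" where
  "right_exit G A g \<equiv> {x \<in> A. x \<otimes>\<^bsub>G\<^esub> g \<notin> A}"


section \<open>Wreath products in coordinates\<close>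

text \<open>Formed over an arbitrary group with elements in the recursive datatype, so that the
  result has the same type again and everything proved about it can be iterated through
  \<open>Hgrp_Suc\<close>.\<close>

definition wreath :: "('f, 'b) monoid_scheme \<Rightarrow> ('f wel, 'c) monoid_scheme \<Rightarrow> 'f wel monoid" where
  "wreath F G = \<lparr>carrier = {Wel S h | S h. h \<in> carrier G \<and> fst ` fset S \<subseteq> carrier G
        \<and> snd ` fset S \<subseteq> carrier F - {\<one>\<^bsub>F\<^esub>}
        \<and> (\<forall>g a b. (g, a) |\<in>| S \<and> (g, b) |\<in>| S \<longrightarrow> a = b)},
     mult = (\<lambda>x y. case (x, y) of
        (Wel S h, Wel T h') \<Rightarrow>
          Wel (fs_combine F S ((\<lambda>(g, a). (h \<otimes>\<^bsub>G\<^esub> g, a)) |`| T)) (h \<otimes>\<^bsub>G\<^esub> h')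
      | _ \<Rightarrow> undefined),
     one = Wel {||} \<one>\<^bsub>G\<^esub>\<rparr>"

lemma Hgrp_Suc: "Hgrp F k (Suc n) = wreath F (Hgrp F k n)"
proof -
  have "Hmult F (Suc n) x y = mult (wreath F (Hgrp F k n)) x y" for x y
    by (cases x; cases y) (simp_all add: Hgrp_def wreath_def)
  then have "Hmult F (Suc n) = mult (wreath F (Hgrp F k n))" by blast
  then show ?thesis
    by (simp add: Hgrp_def wreath_def del: Hmult.simps)
qed

text \<open>Total functions, trivial off \<open>carrier G\<close>: equality of configurations is
  then equality of functions, and \<open>fgraph\<close> translates them injectively into the finite
  graphs stored by \<open>Wel\<close>.\<close>

definition lamps :: "('f, 'b) monoid_scheme \<Rightarrow> ('g, 'c) monoid_scheme \<Rightarrow> ('g \<Rightarrow> 'f) set" where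
  "lamps F G = {u. finite {g. u g \<noteq> \<one>\<^bsub>F\<^esub>} \<and> {g. u g \<noteq> \<one>\<^bsub>F\<^esub>} \<subseteq> carrier G \<and> range u \<subseteq> carrier F}"

definition fgraph :: "('f, 'b) monoid_scheme \<Rightarrow> ('f wel \<Rightarrow> 'f) \<Rightarrow> ('f wel \<times> 'f) fset" where
  "fgraph F u = Abs_fset {(g, u g) | g. u g \<noteq> \<one>\<^bsub>F\<^esub>}"

definition wmk :: "('f, 'b) monoid_scheme \<Rightarrow> ('f wel \<Rightarrow> 'f) \<Rightarrow> 'f wel \<Rightarrow> 'f wel" where
  "wmk F u h = Wel (fgraph F u) h"

text \<open>The case distinction keeps translates trivial off \<open>carrier G\<close>, where
  \<open>inv h \<otimes> g\<close> means nothing.\<close>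

definition ltrans :: "('f, 'b) monoid_scheme \<Rightarrow> ('g, 'c) monoid_scheme \<Rightarrow> 'g \<Rightarrow> ('g \<Rightarrow> 'f) \<Rightarrow> 'g \<Rightarrow> 'f" where
  "ltrans F G h v g = (if g \<in> carrier G then v (inv\<^bsub>G\<^esub> h \<otimes>\<^bsub>G\<^esub> g) else \<one>\<^bsub>F\<^esub>)"

lemma fset_fgraph:
  assumes "finite {g. u g \<noteq> \<one>\<^bsub>F\<^esub>}"
  shows "fset (fgraph F u) = {(g, u g) | g. u g \<noteq> \<one>\<^bsub>F\<^esub>}"
proof -
  have "{(g, u g) | g. u g \<noteq> \<one>\<^bsub>F\<^esub>} = (\<lambda>g. (g, u g)) ` {g. u g \<noteq> \<one>\<^bsub>F\<^esub>}" by auto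
  then show ?thesis
    using assms by (simp add: fgraph_def Abs_fset_inverse)
qed

lemma lampf_fgraph:
  assumes "finite {g. u g \<noteq> \<one>\<^bsub>F\<^esub>}"
  shows "lampf F (fgraph F u) = u"
  by (rule ext) (auto simp: lampf_def fset_fgraph[OF assms])

lemma fgraph_lampf:
  assumes fn: "\<forall>g a b. (g, a) |\<in>| S \<and> (g, b) |\<in>| S \<longrightarrow> a = b" and nt: "snd ` fset S \<subseteq> C - {\<one>\<^bsub>F\<^esub>}"
  shows "fgraph F (lampf F S) = S" and "{g. lampf F S g \<noteq> \<one>\<^bsub>F\<^esub>} = fst ` fset S"
    and "range (lampf F S) \<subseteq> insert \<one>\<^bsub>F\<^esub> C"
proof -
  have val: "lampf F S g = a" if "(g, a) |\<in>| S" for g a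
    unfolding lampf_def using that fn by auto
  have out: "lampf F S g = \<one>\<^bsub>F\<^esub>" if "\<And>a. (g, a) |\<notin>| S" for g
    unfolding lampf_def using that by auto
  have nt1: "a \<noteq> \<one>\<^bsub>F\<^esub> \<and> a \<in> C" if "(g, a) |\<in>| S" for g a
    using nt that by force
  have iff: "(g, a) |\<in>| S \<longleftrightarrow> lampf F S g = a \<and> a \<noteq> \<one>\<^bsub>F\<^esub>" for g a
    using val out nt1 by metis
  show supp: "{g. lampf F S g \<noteq> \<one>\<^bsub>F\<^esub>} = fst ` fset S"
    using iff by force
  have fin: "finite {g. lampf F S g \<noteq> \<one>\<^bsub>F\<^esub>}" unfolding supp by simp
  have "fset (fgraph F (lampf F S)) = fset S"
    unfolding fset_fgraph[OF fin] using iff by force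
  then show "fgraph F (lampf F S) = S" by (simp add: fset_inject)
  show "range (lampf F S) \<subseteq> insert \<one>\<^bsub>F\<^esub> C"
    using nt1 val out by (metis image_subsetI insertCI)
qed

locale wreath_groups = F: group F + G: group G
  for F :: "('f, 'b) monoid_scheme" and G :: "('f wel, 'c) monoid_scheme" (structure)
begin

abbreviation "W \<equiv> wreath F G"

lemma lampsD:
  assumes "u \<in> lamps F G"
  shows "finite {g. u g \<noteq> \<one>\<^bsub>F\<^esub>}" "u g \<in> carrier F" "g \<notin> carrier G \<Longrightarrow> u g = \<one>\<^bsub>F\<^esub>"
  using assms by (auto simp: lamps_def)

lemma lampsI:
  assumes "finite {g. u g \<noteq> \<one>\<^bsub>F\<^esub>}" "\<And>g. g \<in> carrier G \<Longrightarrow> u g \<in> carrier F"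
    "\<And>g. g \<notin> carrier G \<Longrightarrow> u g = \<one>\<^bsub>F\<^esub>"
  shows "u \<in> lamps F G"
proof -
  have "u g \<in> carrier F" for g using assms(2,3) by (cases "g \<in> carrier G") auto
  then show ?thesis using assms unfolding lamps_def by auto
qed

lemma wmk_in_carrier:
  assumes "u \<in> lamps F G" "h \<in> carrier G" shows "wmk F u h \<in> carrier W"
proof -
  note f = fset_fgraph[OF lampsD(1)[OF assms(1)]]
  have "fst ` fset (fgraph F u) \<subseteq> carrier G"
  proof
    fix g assume "g \<in> fst ` fset (fgraph F u)"
    then have "u g \<noteq> \<one>\<^bsub>F\<^esub>" unfolding f by auto
    then show "g \<in> carrier G" using lampsD(3)[OF assms(1)] by metis
  qed
  moreover have "snd ` fset (fgraph F u) \<subseteq> carrier F - {\<one>\<^bsub>F\<^esub>}"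
  proof
    fix a assume "a \<in> snd ` fset (fgraph F u)"
    then obtain g where "a = u g" "u g \<noteq> \<one>\<^bsub>F\<^esub>" unfolding f by auto
    then show "a \<in> carrier F - {\<one>\<^bsub>F\<^esub>}" using lampsD(2)[OF assms(1), of g] by simp
  qed
  moreover have "\<forall>g a b. (g, a) |\<in>| fgraph F u \<and> (g, b) |\<in>| fgraph F u \<longrightarrow> a = b"
    unfolding f by auto
  ultimately show ?thesis
    unfolding wreath_def wmk_def using assms(2) by simp
qed

lemma wmk_inject:
  assumes "u \<in> lamps F G" "v \<in> lamps F G"
  shows "wmk F u h = wmk F v k \<longleftrightarrow> u = v \<and> h = k"
  using lampf_fgraph[OF lampsD(1)[OF assms(1)]] lampf_fgraph[OF lampsD(1)[OF assms(2)]]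
  unfolding wmk_def by (metis wel.inject(2))

lemma carrier_cases:
  assumes "x \<in> carrier W"
  obtains u h where "u \<in> lamps F G" "h \<in> carrier G" "x = wmk F u h"
proof -
  obtain S h where S: "x = Wel S h" "h \<in> carrier G" "fst ` fset S \<subseteq> carrier G"
      "snd ` fset S \<subseteq> carrier F - {\<one>\<^bsub>F\<^esub>}"
      "\<forall>g a b. (g, a) |\<in>| S \<and> (g, b) |\<in>| S \<longrightarrow> a = b"
    using assms by (auto simp: wreath_def)
  note L = fgraph_lampf[OF S(5,4)]
  have "lampf F S \<in> lamps F G"
    using L(2,3) S(3) by (auto simp: lamps_def)
  then show ?thesis using that[of "lampf F S" h] L(1) S(1,2) by (simp add: wmk_def)
qed

lemma carrier_W: "carrier W = (\<lambda>(u, h). wmk F u h) ` (lamps F G \<times> carrier G)"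
  proof (intro equalityI subsetI)
  fix x assume "x \<in> carrier W"
  then show "x \<in> (\<lambda>(u, h). wmk F u h) ` (lamps F G \<times> carrier G)"
    by (elim carrier_cases) auto
next
  fix x assume "x \<in> (\<lambda>(u, h). wmk F u h) ` (lamps F G \<times> carrier G)"
  then show "x \<in> carrier W" using wmk_in_carrier by auto
qed

lemma inj_wmk: "inj_on (\<lambda>(u, h). wmk F u h) (lamps F G \<times> carrier G)"
  by (auto simp: inj_on_def wmk_inject)

lemma ltrans_supp:
  assumes "v \<in> lamps F G" "h \<in> carrier G"
  shows "{g. ltrans F G h v g \<noteq> \<one>\<^bsub>F\<^esub>} = (\<lambda>g. h \<otimes> g) ` {g. v g \<noteq> \<one>\<^bsub>F\<^esub>}"
proof (intro equalityI subsetI)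
  fix g assume "g \<in> {g. ltrans F G h v g \<noteq> \<one>\<^bsub>F\<^esub>}"
  then have "g \<in> carrier G" "v (inv h \<otimes> g) \<noteq> \<one>\<^bsub>F\<^esub>"
    by (auto simp: ltrans_def split: if_splits)
  moreover from this have "g = h \<otimes> (inv h \<otimes> g)"
    using assms(2) by (simp add: G.m_assoc[symmetric])
  ultimately show "g \<in> (\<lambda>g. h \<otimes> g) ` {g. v g \<noteq> \<one>\<^bsub>F\<^esub>}" by blast
next
  fix g assume "g \<in> (\<lambda>g. h \<otimes> g) ` {g. v g \<noteq> \<one>\<^bsub>F\<^esub>}"
  then obtain k where k: "g = h \<otimes> k" "v k \<noteq> \<one>\<^bsub>F\<^esub>" by auto
  then have "k \<in> carrier G" using lampsD(3)[OF assms(1)] by blast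
  then have "inv h \<otimes> g = k" "g \<in> carrier G" using k assms(2) by (simp_all add: G.m_assoc[symmetric])
  then show "g \<in> {g. ltrans F G h v g \<noteq> \<one>\<^bsub>F\<^esub>}" using k by (simp add: ltrans_def)
qed

lemma ltrans_lamps:
  assumes "v \<in> lamps F G" "h \<in> carrier G" shows "ltrans F G h v \<in> lamps F G"
  using lampsD[OF assms(1)] assms(2)
  by (intro lampsI) (simp_all add: ltrans_supp[OF assms], simp_all add: ltrans_def)

lemma mult_lamps:
  assumes "u \<in> lamps F G" "v \<in> lamps F G" shows "(\<lambda>g. u g \<otimes>\<^bsub>F\<^esub> v g) \<in> lamps F G"
proof (rule lampsI)
  have "{g. u g \<otimes>\<^bsub>F\<^esub> v g \<noteq> \<one>\<^bsub>F\<^esub>} \<subseteq> {g. u g \<noteq> \<one>\<^bsub>F\<^esub>} \<union> {g. v g \<noteq> \<one>\<^bsub>F\<^esub>}" by auto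
  then show "finite {g. u g \<otimes>\<^bsub>F\<^esub> v g \<noteq> \<one>\<^bsub>F\<^esub>}"
    using assms lampsD(1) finite_subset by blast
qed (use assms in \<open>auto simp: lampsD(2,3)\<close>)

lemma fs_combine_fgraph:
  assumes "u \<in> lamps F G" "v \<in> lamps F G"
  shows "fs_combine F (fgraph F u) (fgraph F v) = fgraph F (\<lambda>g. u g \<otimes>\<^bsub>F\<^esub> v g)"
proof -
  have "{(g, u g \<otimes>\<^bsub>F\<^esub> v g) | g. g \<in> fst ` fset (fgraph F u) \<union> fst ` fset (fgraph F v)
      \<and> u g \<otimes>\<^bsub>F\<^esub> v g \<noteq> \<one>\<^bsub>F\<^esub>} = {(g, u g \<otimes>\<^bsub>F\<^esub> v g) | g. u g \<otimes>\<^bsub>F\<^esub> v g \<noteq> \<one>\<^bsub>F\<^esub>}"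
    using assms[THEN lampsD(1)] by (force simp: fset_fgraph)
  then show ?thesis
    unfolding fs_combine_def lampf_fgraph[OF assms(1)[THEN lampsD(1)]]
      lampf_fgraph[OF assms(2)[THEN lampsD(1)]]
    by (simp add: fgraph_def)
qed

lemma fimage_fgraph:
  assumes "v \<in> lamps F G" "h \<in> carrier G"
  shows "(\<lambda>(g, a). (h \<otimes> g, a)) |`| fgraph F v = fgraph F (ltrans F G h v)"
proof -
  have eq: "ltrans F G h v (h \<otimes> k) = v k" if "v k \<noteq> \<one>\<^bsub>F\<^esub>" for k
  proof -
    have "k \<in> carrier G" using lampsD(3)[OF assms(1)] that by blast
    then show ?thesis using assms(2) by (simp add: ltrans_def G.m_assoc[symmetric])
  qed
  have "{(g, ltrans F G h v g) | g. ltrans F G h v g \<noteq> \<one>\<^bsub>F\<^esub>}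
      = (\<lambda>g. (g, ltrans F G h v g)) ` {g. ltrans F G h v g \<noteq> \<one>\<^bsub>F\<^esub>}" by auto
  also have "\<dots> = (\<lambda>(g, a). (h \<otimes> g, a)) ` {(g, v g) | g. v g \<noteq> \<one>\<^bsub>F\<^esub>}"
    unfolding ltrans_supp[OF assms] image_image using eq by (force simp: image_iff)
  finally have "fset ((\<lambda>(g, a). (h \<otimes> g, a)) |`| fgraph F v) = fset (fgraph F (ltrans F G h v))"
    by (simp add: fset_fgraph lampsD(1)[OF assms(1)] lampsD(1)[OF ltrans_lamps[OF assms]])
  then show ?thesis by (simp only: fset_inject)
qed

lemma wmk_mult:
  assumes "u \<in> lamps F G" "v \<in> lamps F G" "h \<in> carrier G"
  shows "wmk F u h \<otimes>\<^bsub>W\<^esub> wmk F v k = wmk F (\<lambda>g. u g \<otimes>\<^bsub>F\<^esub> ltrans F G h v g) (h \<otimes> k)"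
  using fimage_fgraph[OF assms(2,3)] fs_combine_fgraph[OF assms(1) ltrans_lamps[OF assms(2,3)]]
  by (simp add: wreath_def wmk_def)

lemma one_lamps: "(\<lambda>_. \<one>\<^bsub>F\<^esub>) \<in> lamps F G"
  by (rule lampsI) auto

lemma wmk_one: "wmk F (\<lambda>_. \<one>\<^bsub>F\<^esub>) \<one> = \<one>\<^bsub>W\<^esub>"
  by (simp add: wreath_def wmk_def fgraph_def bot_fset_def)

lemma ltrans_ltrans:
  assumes "h \<in> carrier G" "k \<in> carrier G"
  shows "ltrans F G h (ltrans F G k v) = ltrans F G (h \<otimes> k) v"
  by (rule ext) (simp add: ltrans_def assms G.inv_mult_group G.m_assoc)

lemma ltrans_mult:
  assumes "h \<in> carrier G"
  shows "ltrans F G h (\<lambda>g. u g \<otimes>\<^bsub>F\<^esub> v g) = (\<lambda>g. ltrans F G h u g \<otimes>\<^bsub>F\<^esub> ltrans F G h v g)"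
  by (rule ext) (simp add: ltrans_def)

lemma ltrans_one:
  assumes "v \<in> lamps F G" shows "ltrans F G \<one> v = v"
  by (rule ext) (auto simp: ltrans_def lampsD(3)[OF assms])

lemma group_wreath: "group W"
proof (rule groupI)
  fix x y z assume "x \<in> carrier W" "y \<in> carrier W" "z \<in> carrier W"
  then obtain u h v k w l where
    u: "u \<in> lamps F G" "h \<in> carrier G" "x = wmk F u h" and
    v: "v \<in> lamps F G" "k \<in> carrier G" "y = wmk F v k" and
    w: "w \<in> lamps F G" "l \<in> carrier G" "z = wmk F w l"
    by (elim carrier_cases)
  have uv: "(\<lambda>g. u g \<otimes>\<^bsub>F\<^esub> ltrans F G h v g) \<in> lamps F G"
    and vw: "(\<lambda>g. v g \<otimes>\<^bsub>F\<^esub> ltrans F G k w g) \<in> lamps F G"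
    using u v w by (auto intro: mult_lamps ltrans_lamps)
  show "x \<otimes>\<^bsub>W\<^esub> y \<otimes>\<^bsub>W\<^esub> z = x \<otimes>\<^bsub>W\<^esub> (y \<otimes>\<^bsub>W\<^esub> z)"
    using u v w uv vw lampsD(2)[OF u(1)] lampsD(2)[OF ltrans_lamps[OF v(1) u(2)]]
      lampsD(2)[OF ltrans_lamps[OF w(1) G.m_closed[OF u(2) v(2)]]]
    by (simp add: wmk_mult ltrans_mult ltrans_ltrans F.m_assoc G.m_assoc)
next
  fix x y assume "x \<in> carrier W" "y \<in> carrier W"
  then show "x \<otimes>\<^bsub>W\<^esub> y \<in> carrier W"
    by (elim carrier_cases) (simp add: wmk_mult wmk_in_carrier mult_lamps ltrans_lamps)
next
  show "\<one>\<^bsub>W\<^esub> \<in> carrier W"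
    unfolding wmk_one[symmetric] by (simp add: wmk_in_carrier one_lamps)
next
  fix x assume "x \<in> carrier W"
  then show "\<one>\<^bsub>W\<^esub> \<otimes>\<^bsub>W\<^esub> x = x"
    unfolding wmk_one[symmetric]
    by (elim carrier_cases) (simp add: wmk_mult one_lamps ltrans_one lampsD(2))
next
  fix x assume "x \<in> carrier W"
  then obtain u h where u: "u \<in> lamps F G" "h \<in> carrier G" "x = wmk F u h"
    by (elim carrier_cases)
  have i: "(\<lambda>g. inv\<^bsub>F\<^esub> (u g)) \<in> lamps F G"
  proof (rule lampsI)
    have "{g. inv\<^bsub>F\<^esub> (u g) \<noteq> \<one>\<^bsub>F\<^esub>} \<subseteq> {g. u g \<noteq> \<one>\<^bsub>F\<^esub>}" by auto
    then show "finite {g. inv\<^bsub>F\<^esub> (u g) \<noteq> \<one>\<^bsub>F\<^esub>}" using lampsD(1)[OF u(1)] finite_subset by blast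
  qed (use lampsD[OF u(1)] in auto)
  \<comment> \<open>The inverse of \<open>(u, h)\<close> is the pointwise inverse of
    \<open>u\<close> translated by \<open>inv h\<close>, paired with \<open>inv h\<close>.\<close>
  define v where "v = ltrans F G (inv h) (\<lambda>g. inv\<^bsub>F\<^esub> (u g))"
  have v: "v \<in> lamps F G" unfolding v_def using i u by (simp add: ltrans_lamps)
  have "v g \<otimes>\<^bsub>F\<^esub> ltrans F G (inv h) u g = \<one>\<^bsub>F\<^esub>" for g
    unfolding v_def ltrans_def using lampsD(2)[OF u(1)] by simp
  then have "wmk F v (inv h) \<otimes>\<^bsub>W\<^esub> x = \<one>\<^bsub>W\<^esub>"
    using u v by (simp add: wmk_mult wmk_one)
  then show "\<exists>y\<in>carrier W. y \<otimes>\<^bsub>W\<^esub> x = \<one>\<^bsub>W\<^esub>"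
    using wmk_in_carrier[OF v] u by blast
qed

text \<open>A configuration is determined by the non-trivial part of its graph, a finite subset of
  the countable set \<open>carrier G \<times> carrier F\<close>.\<close>

lemma countable_wreath:
  assumes "finite (carrier F)" "countable (carrier G)"
  shows "countable (carrier W)"
proof -
  have "countable {A. finite A \<and> A \<subseteq> carrier G \<times> carrier F}"
    using assms by (intro countable_Collect_finite_subset countable_SIGMA) (auto intro: countable_finite)
  moreover have "(\<lambda>u. {(g, u g) |g. u g \<noteq> \<one>\<^bsub>F\<^esub>}) ` lamps F G \<subseteq> {A. finite A \<and> A \<subseteq> carrier G \<times> carrier F}"
    by (auto simp: lamps_def setcompr_eq_image)
  moreover have "inj_on (\<lambda>u. {(g, u g) |g. u g \<noteq> \<one>\<^bsub>F\<^esub>}) (lamps F G)"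
  proof (rule inj_onI, rule ext)
    fix u v :: "'f wel \<Rightarrow> 'f" and g
    assume "{(g, u g) |g. u g \<noteq> \<one>\<^bsub>F\<^esub>} = {(g, v g) |g. v g \<noteq> \<one>\<^bsub>F\<^esub>}"
    then have "(g, u g) \<in> {(g, v g) |g. v g \<noteq> \<one>\<^bsub>F\<^esub>} \<or> u g = \<one>\<^bsub>F\<^esub>"
      "(g, v g) \<in> {(g, u g) |g. u g \<noteq> \<one>\<^bsub>F\<^esub>} \<or> v g = \<one>\<^bsub>F\<^esub>" by auto
    then show "u g = v g" by auto
  qed
  ultimately have "countable (lamps F G)"
    by (meson countable_image_inj_on countable_subset)
  then show ?thesis unfolding carrier_W using assms by blast
qed

end

lemma Hgrp_0: "carrier (Hgrp F 1 0) = (\<lambda>i. Zel [i]) ` UNIV" 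
  "\<one>\<^bsub>Hgrp F 1 0\<^esub> = Zel [0]" "Zel [i] \<otimes>\<^bsub>Hgrp F 1 0\<^esub> Zel [j] = Zel [i + j]"
  by (auto simp: Hgrp_def length_Suc_conv)

lemmas Hgrp_0_simps = Hgrp_0[unfolded One_nat_def]

lemma group_Hgrp:
  assumes "group F" shows "group (Hgrp F 1 n)"
proof (induction n)
  case 0
  show ?case
  proof (rule groupI, goal_cases)
    case (5 x)
    then obtain i where "x = Zel [i]" by (auto simp: Hgrp_0_simps)
    then show ?case by (intro bexI[of _ "Zel [-i]"]) (auto simp: Hgrp_0_simps)
  qed (auto simp: Hgrp_0_simps)
next
  case (Suc n)
  then interpret wreath_groups F "Hgrp F 1 n" using assms by (simp add: wreath_groups_def)
  show ?case unfolding Hgrp_Suc by (rule group_wreath)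
qed

lemma countable_Hgrp:
  assumes "group F" "finite (carrier F)" shows "countable (carrier (Hgrp F 1 n))"
proof (induction n)
  case 0
  show ?case unfolding Hgrp_0 by simp
next
  case (Suc n)
  interpret wreath_groups F "Hgrp F 1 n" using assms group_Hgrp by (simp add: wreath_groups_def)
  show ?case unfolding Hgrp_Suc by (rule countable_wreath[OF assms(2) Suc])
qed

section \<open>Iterated logarithms and isoperimetry of wreath products\<close>

text \<open>With \<open>ln (t + exp 1)\<close> in place of \<open>ln t\<close>, the bound \<open>iterlog n (C * t) \<le> C * iterlog n t\<close> holds for
  all \<open>t \<ge> 0\<close>.\<close>

primrec iterlog :: "nat \<Rightarrow> real \<Rightarrow> real" where
  "iterlog 0 t = t"
| "iterlog (Suc n) t = iterlog n (ln (t + exp 1))"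

lemma ln_add_e_ge_1: "t \<ge> 0 \<Longrightarrow> 1 \<le> ln (t + exp 1)" for t :: real
  by (metis add_increasing exp_gt_zero ln_exp ln_le_cancel_iff add_pos_nonneg add.commute order_refl)

lemma iterlog_mono: "0 \<le> s \<Longrightarrow> s \<le> t \<Longrightarrow> iterlog n s \<le> iterlog n t"
proof (induction n arbitrary: s t)
  case (Suc n)
  have "0 < s + exp 1" using Suc.prems by (simp add: add_nonneg_pos)
  then show ?case
    using Suc.prems ln_add_e_ge_1[of s]
    by (simp only: iterlog.simps, intro Suc.IH) (linarith, simp)
qed simp

lemma iterlog_ge_1: "1 \<le> t \<Longrightarrow> 1 \<le> iterlog n t"
  by (induction n arbitrary: t) (simp_all add: ln_add_e_ge_1)

lemma iterlog_nonneg: "0 \<le> t \<Longrightarrow> 0 \<le> iterlog n t"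
proof (cases n)
  case (Suc m)
  assume "0 \<le> t"
  then have "1 \<le> iterlog m (ln (t + exp 1))" by (intro iterlog_ge_1 ln_add_e_ge_1)
  then show ?thesis using Suc by simp
qed simp

text \<open>The factor \<open>C\<close> costs an additive \<open>ln C \<le> C - 1\<close>, and this
  is absorbed by \<open>(C - 1) * ln (t + exp 1)\<close> because the shift by \<open>exp 1\<close>
  keeps the logarithm at least 1.\<close>

lemma ln_mult_add_e:
  fixes C t :: real
  assumes "1 \<le> C" "0 \<le> t" shows "ln (C * t + exp 1) \<le> C * ln (t + exp 1)"
proof -
  have pos: "0 < t + exp 1" using assms by (simp add: add_nonneg_pos)
  have "C * t + exp 1 \<le> C * (t + exp 1)"
    using assms by (simp add: algebra_simps)
  then have "ln (C * t + exp 1) \<le> ln (C * (t + exp 1))"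
    using assms pos by (subst ln_le_cancel_iff) (auto intro: add_nonneg_pos)
  also have "\<dots> = ln C + ln (t + exp 1)" using assms pos by (simp add: ln_mult)
  also have "ln C \<le> C - 1" using assms by (intro ln_le_minus_one) auto
  also have "C - 1 \<le> (C - 1) * ln (t + exp 1)"
    using assms ln_add_e_ge_1[of t] by (metis diff_ge_0_iff_ge mult.right_neutral mult_left_mono)
  finally show ?thesis by (simp add: algebra_simps)
qed

text \<open>Besides moving constants out of \<open>iterlog\<close>, this expresses that
  \<open>iterlog n t / t\<close> is non-increasing for \<open>t > 0\<close>, the form needed for
  dominated convergence.\<close>

lemma iterlog_mult:
  assumes "1 \<le> C" "0 \<le> t" shows "iterlog n (C * t) \<le> C * iterlog n t"
  using assms(2)
proof (induction n arbitrary: t)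
  case (Suc n)
  have "iterlog (Suc n) (C * t) \<le> iterlog n (C * ln (t + exp 1))"
    using ln_mult_add_e[OF assms(1) Suc.prems] ln_add_e_ge_1[of "C * t"] assms Suc.prems
    by (simp, intro iterlog_mono) auto
  also have "\<dots> \<le> C * iterlog n (ln (t + exp 1))"
    using ln_add_e_ge_1[OF Suc.prems] by (intro Suc.IH) simp
  finally show ?case by simp
qed simp

section \<open>Edge-isoperimetry in Hamming graphs and slices of finite sets\<close>

lemma log2_split:
  fixes x y :: nat
  assumes "0 < x" "0 < y"
  shows "x * log 2 x + y * log 2 y + min x y \<le> (x + y) * log 2 (x + y)"
  using assms
proof (induction x y rule: linorder_wlog)
  case (le x y)
  \<comment> \<open>Here \<open>x \<le> y\<close>. The extra summand \<open>x\<close> is what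
    doubling inside the logarithm is worth, and \<open>2 * x \<le> x + y\<close>.\<close>
  have "real x * (1 + log 2 x) = x * log 2 (2 * x)"
    using le by (simp add: log_mult)
  also have "\<dots> \<le> x * log 2 (x + y)"
    using le by (intro mult_left_mono) auto
  finally have "x * log 2 x + x \<le> x * log 2 (x + y)" by (simp add: algebra_simps)
  moreover have "y * log 2 y \<le> y * log 2 (x + y)"
    using le by (intro mult_left_mono) auto
  ultimately have "x * log 2 x + y * log 2 y + x \<le> x * log 2 (x + y) + y * log 2 (x + y)" by linarith
  also have "\<dots> = (x + y) * log 2 (x + y)" by (simp add: algebra_simps)
  finally show ?case using le by simp
next
  case (sym x y)
  then show ?case by (simp add: algebra_simps min.commute)
qed

text \<open>Directed edges inside \<open>B\<close> of a graph with exactly one outgoing edge per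
  vertex and coordinate \<open>p\<close>, namely the replacement of the value at \<open>p\<close> by
  its image under \<open>\<psi>\<close>.\<close>

definition flip_pairs :: "('f \<Rightarrow> 'f) \<Rightarrow> ('p \<Rightarrow> 'f) set \<Rightarrow> (('p \<Rightarrow> 'f) \<times> 'p) set" where
  "flip_pairs \<psi> B = {(u, p). u \<in> B \<and> u(p := \<psi> (u p)) \<in> B}"

lemma flip_eq_iff:
  assumes "inj_on \<psi> C" "range u \<subseteq> C" "range v \<subseteq> C"
  shows "u(p := \<psi> (u p)) = v(p := \<psi> (v p)) \<longleftrightarrow> u = v"
proof
  assume eq: "u(p := \<psi> (u p)) = v(p := \<psi> (v p))"
  show "u = v"
  proof
    fix q
    show "u q = v q"
    proof (cases "q = p")
      case True
      have "\<psi> (u p) = \<psi> (v p)" using fun_cong[OF eq, of p] by simp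
      then show ?thesis using assms True by (metis inj_onD rangeI subsetD)
    next
      case False
      then show ?thesis using fun_cong[OF eq, of q] by simp
    qed
  qed
qed simp

text \<open>The constant 2 is not optimal: it makes it enough to split off one value of one coordinate in the
  induction.\<close>

lemma card_flip_pairs:
  fixes B :: "('p \<Rightarrow> 'f) set"
  assumes "inj_on \<psi> C" "\<And>a. a \<in> C \<Longrightarrow> \<psi> a \<noteq> a"
    and "finite B" "B \<noteq> {}" "\<And>u. u \<in> B \<Longrightarrow> range u \<subseteq> C"
  shows "finite (flip_pairs \<psi> B) \<and> card (flip_pairs \<psi> B) \<le> 2 * card B * log 2 (card B)"
  using assms(3-)
proof (induction "card B" arbitrary: B rule: less_induct)
  case less
  show ?case
  proof (cases "card B = 1")
    case True
    then obtain u where "B = {u}" by (auto simp: card_1_singleton_iff)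
    moreover have "u(p := \<psi> (u p)) \<noteq> u" for p
      using assms(2)[of "u p"] less.prems(3)[of u] \<open>B = {u}\<close>
      by (metis fun_upd_same insertI1 range_subsetD)
    ultimately have "flip_pairs \<psi> B = {}" by (auto simp: flip_pairs_def)
    then show ?thesis using True by simp
  next
    case False
    obtain u0 v0 where uv: "u0 \<in> B" "v0 \<in> B" "u0 \<noteq> v0"
      using less.prems False by (metis card_1_singleton_iff is_singletonI' is_singleton_def One_nat_def)
    then obtain p0 where p0: "u0 p0 \<noteq> v0 p0" by blast
    \<comment> \<open>Split at a coordinate where two members differ. A flip at any other coordinate
      stays inside its part, so only flips at \<open>p0\<close> can cross.\<close>
    define B1 where "B1 = {u \<in> B. u p0 = u0 p0}"
    define B2 where "B2 = {u \<in> B. u p0 \<noteq> u0 p0}"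
    have "u0 \<in> B1" "v0 \<in> B2" using uv p0 by (simp_all add: B1_def B2_def)
    moreover have "B = B1 \<union> B2" "B1 \<inter> B2 = {}" unfolding B1_def B2_def by blast+
    moreover from this less.prems(1) have "finite B1" "finite B2" by simp_all
    ultimately have B: "B = B1 \<union> B2" "B1 \<inter> B2 = {}" "B1 \<noteq> {}" "B2 \<noteq> {}" "finite B1" "finite B2"
      by blast+
    have cB: "card B = card B1 + card B2" using B by (simp add: card_Un_disjoint)
    have c12: "0 < card B1" "0 < card B2" using B by (auto simp: card_gt_0_iff)
    have IH1: "finite (flip_pairs \<psi> B1) \<and> card (flip_pairs \<psi> B1) \<le> 2 * card B1 * log 2 (card B1)"
      using less.prems(3) B c12 cB by (intro less.hyps) auto
    have IH2: "finite (flip_pairs \<psi> B2) \<and> card (flip_pairs \<psi> B2) \<le> 2 * card B2 * log 2 (card B2)"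
      using less.prems(3) B c12 cB by (intro less.hyps) auto
    define f where "f u = u(p0 := \<psi> (u p0))" for u :: "'p \<Rightarrow> 'f"
    have inj: "inj_on f B"
      using flip_eq_iff[OF assms(1) less.prems(3) less.prems(3)] by (auto simp: inj_on_def f_def)
    \<comment> \<open>\<open>X\<close> and \<open>Y\<close> are the sources of the crossing edges in
      the two directions. As \<open>f\<close> is injective, each has at most
      \<open>min (card B1) (card B2)\<close> elements; together they account for the constant
      2.\<close>
    define X where "X = {u \<in> B1. f u \<in> B2}"
    define Y where "Y = {u \<in> B2. f u \<in> B1}"
    have fin: "finite X" "finite Y" using B by (auto simp: X_def Y_def)
    have "card X \<le> card B1" "card Y \<le> card B2"
      using B by (auto simp: X_def Y_def intro!: card_mono)
    moreover have "card X \<le> card B2"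
      using B inj by (intro card_inj_on_le[of f]) (auto simp: X_def inj_on_def)
    moreover have "card Y \<le> card B1"
      using B inj by (intro card_inj_on_le[of f]) (auto simp: Y_def inj_on_def)
    ultimately have XY: "card (X \<union> Y) \<le> 2 * min (card B1) (card B2)"
      using card_Un_le[of X Y] by linarith
    have same: "u \<in> B1 \<longleftrightarrow> u(p := \<psi> (u p)) \<in> B1"
      if "p \<noteq> p0" "u \<in> B" "u(p := \<psi> (u p)) \<in> B" for u p
      using that by (simp add: B1_def)
    have sub: "flip_pairs \<psi> B \<subseteq> flip_pairs \<psi> B1 \<union> flip_pairs \<psi> B2 \<union> (\<lambda>u. (u, p0)) ` (X \<union> Y)"
    proof
      fix z assume "z \<in> flip_pairs \<psi> B"
      then obtain u p where z: "z = (u, p)" "u \<in> B" "u(p := \<psi> (u p)) \<in> B"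
        by (auto simp: flip_pairs_def)
      show "z \<in> flip_pairs \<psi> B1 \<union> flip_pairs \<psi> B2 \<union> (\<lambda>u. (u, p0)) ` (X \<union> Y)"
      proof (cases "p = p0")
        case True
        then show ?thesis using z B(1) by (auto simp: flip_pairs_def X_def Y_def f_def)
      next
        case False
        then show ?thesis using z same[OF False z(2,3)] B(1,2) by (auto simp: flip_pairs_def)
      qed
    qed
    have fin3: "finite (flip_pairs \<psi> B1 \<union> flip_pairs \<psi> B2 \<union> (\<lambda>u. (u, p0)) ` (X \<union> Y))"
      using IH1 IH2 fin by blast
    have "card (flip_pairs \<psi> B) \<le> card (flip_pairs \<psi> B1 \<union> flip_pairs \<psi> B2 \<union> (\<lambda>u. (u, p0)) ` (X \<union> Y))"
      by (rule card_mono[OF fin3 sub])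
    also have "\<dots> \<le> card (flip_pairs \<psi> B1) + card (flip_pairs \<psi> B2) + card ((\<lambda>u. (u, p0)) ` (X \<union> Y))"
      by (meson add_le_mono1 card_Un_le order_trans)
    also have "card ((\<lambda>u. (u, p0)) ` (X \<union> Y)) \<le> card (X \<union> Y)"
      using fin by (intro card_image_le) auto
    finally have "card (flip_pairs \<psi> B) \<le> card (flip_pairs \<psi> B1) + card (flip_pairs \<psi> B2)
        + 2 * min (card B1) (card B2)" using XY by linarith
    then have "real (card (flip_pairs \<psi> B)) \<le> 2 * card B1 * log 2 (card B1)
        + 2 * card B2 * log 2 (card B2) + 2 * min (card B1) (card B2)"
      using IH1 IH2 by linarith
    also have "\<dots> \<le> 2 * card B * log 2 (card B)"
      using log2_split[OF c12] cB by (simp add: algebra_simps)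
    finally show ?thesis using finite_subset[OF sub fin3] by simp
  qed
qed

text \<open>A point \<open>(u, h)\<close> consists of a lamp configuration \<open>u\<close> (as seen from
  the cursor) and a cursor position \<open>h\<close>; \<open>b u\<close> bounds the boundary of the slice over \<open>u\<close>.\<close>

lemma slice_isoperimetry:
  fixes A :: "(('p \<Rightarrow> 'f) \<times> 'h) set" and b :: "('p \<Rightarrow> 'f) \<Rightarrow> real" and r V :: real
  assumes \<psi>: "inj_on \<psi> C" "\<And>a. a \<in> C \<Longrightarrow> \<psi> a \<noteq> a"
    and A: "finite A" "A \<noteq> {}" "\<And>u h. (u, h) \<in> A \<Longrightarrow> range u \<subseteq> C"
    and \<iota>: "inj_on \<iota> (snd ` A)"
    and b: "\<And>u. b u \<ge> 0" "r > 0"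
      "\<And>u. u \<in> fst ` A \<Longrightarrow> card {h. (u, h) \<in> A} < V \<Longrightarrow> card {h. (u, h) \<in> A} \<le> r * b u"
    and sb: "4 * r * (\<Sum>u\<in>fst ` A. b u) \<le> card A"
    and lb: "4 * card {(u, h). (u, h) \<in> A \<and> (u(\<iota> h := \<psi> (u (\<iota> h))), h) \<notin> A} \<le> card A"
  shows "V \<le> 8 * log 2 (card A)"
proof -
  define sl where "sl u = {h. (u, h) \<in> A}" for u
  have fin_sl: "finite (sl u)" for u
  proof -
    have "sl u \<subseteq> snd ` A" by (force simp: sl_def)
    then show ?thesis using A(1) finite_subset by blast
  qed
  have card_slices: "card {(u, h). (u, h) \<in> A \<and> u \<in> U} = (\<Sum>u\<in>U. card (sl u))"
    if "U \<subseteq> fst ` A" for U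
  proof -
    have "{(u, h). (u, h) \<in> A \<and> u \<in> U} = Sigma U sl" by (auto simp: sl_def)
    moreover have "finite U" using that A(1) finite_subset by blast
    ultimately show ?thesis using fin_sl by (simp add: card_SigmaI)
  qed
  \<comment> \<open>Slices are sorted by size. Those below \<open>V\<close> are controlled by their
    own boundary, so that all of them together (\<open>A''\<close>) make up at most a quarter of
    \<open>A\<close>.\<close>
  define B where "B = {u \<in> fst ` A. card (sl u) \<ge> V}"
  define N where "N = {u \<in> fst ` A. card (sl u) < V}"
  define A' where "A' = {(u, h). (u, h) \<in> A \<and> u \<in> B}"
  define A'' where "A'' = {(u, h). (u, h) \<in> A \<and> u \<in> N}"
  have A12: "A = A' \<union> A''" "A' \<inter> A'' = {}" by (force simp: A'_def A''_def B_def N_def)+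
  have finA: "finite A'" "finite A''" using A12 A(1) by auto
  have finB: "finite B" using A(1) by (simp add: B_def)
  have "real (card A'') = (\<Sum>u\<in>N. real (card (sl u)))"
    unfolding A''_def using card_slices[of N] by (simp add: N_def)
  also have "\<dots> \<le> (\<Sum>u\<in>N. r * b u)"
    using b(3) by (intro sum_mono) (simp add: N_def sl_def)
  also have "\<dots> \<le> (\<Sum>u\<in>fst ` A. r * b u)"
    using A(1) b by (intro sum_mono2) (auto simp: N_def)
  finally have small: "4 * real (card A'') \<le> card A"
    using sb by (simp add: sum_distrib_left[symmetric])
  have cA: "card A = card A' + card A''"
    using A12 finA by (simp add: card_Un_disjoint)
  have posA: "card A > 0" using A by (simp add: card_gt_0_iff)
  then have "A' \<noteq> {}" using small cA by auto
  then have Bne: "B \<noteq> {}" by (auto simp: A'_def)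
  have "V * card B = (\<Sum>u\<in>B. V)" by simp
  also have "\<dots> \<le> (\<Sum>u\<in>B. real (card (sl u)))" by (intro sum_mono) (simp add: B_def)
  also have "\<dots> = card A'"
    unfolding A'_def using card_slices[of B] by (simp add: B_def)
  finally have VB: "V * card B \<le> card A'" .
  define fl where "fl z = (case z of (u, h) \<Rightarrow> ((u(\<iota> h := \<psi> (u (\<iota> h))), h)))" for z :: "('p \<Rightarrow> 'f) \<times> 'h"
  have rB: "range u \<subseteq> C" if u: "u \<in> B" for u
  proof -
    obtain h where "(u, h) \<in> A" using u by (auto simp: B_def)
    then show ?thesis by (rule A(3))
  qed
  have injfl: "inj_on fl A"
  proof (rule inj_onI)
    fix z w assume zw: "z \<in> A" "w \<in> A" "fl z = fl w"
    obtain u h v k where uv: "z = (u, h)" "w = (v, k)" by fastforce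
    then have "range u \<subseteq> C" "range v \<subseteq> C" "h = k" using zw A(3) by (auto simp: fl_def)
    moreover have "u(\<iota> h := \<psi> (u (\<iota> h))) = v(\<iota> k := \<psi> (v (\<iota> k)))"
      using zw(3) uv by (auto simp: fl_def)
    ultimately show "z = w" using flip_eq_iff[OF \<psi>(1), of u v "\<iota> h"] uv by simp
  qed
  define Q where "Q = {z \<in> A. fl z \<notin> A}"
  define P where "P = {z \<in> A'. fl z \<in> A'}"
  have Qc: "4 * card Q \<le> card A"
  proof -
    have "{(u, h). (u, h) \<in> A \<and> (u(\<iota> h := \<psi> (u (\<iota> h))), h) \<notin> A} = Q" by (auto simp: Q_def fl_def)
    then show ?thesis using lb by simp
  qed
  \<comment> \<open>A flip of a point of \<open>A'\<close> stays in \<open>A'\<close>, leaves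
    \<open>A\<close>, or lands in \<open>A''\<close>. The last two cases and \<open>A''\<close>
    itself each cost at most a quarter of \<open>A\<close>, the flip being injective, so
    \<open>P\<close> keeps a quarter.\<close>
  have "A' \<subseteq> P \<union> Q \<union> {z \<in> A'. fl z \<in> A''}" using A12 by (auto simp: P_def Q_def)
  then have "card A' \<le> card (P \<union> Q \<union> {z \<in> A'. fl z \<in> A''})"
    using finA A(1) by (intro card_mono) (auto simp: P_def Q_def)
  also have "\<dots> \<le> card P + card Q + card {z \<in> A'. fl z \<in> A''}"
    by (meson add_le_mono1 card_Un_le order_trans)
  also have "card {z \<in> A'. fl z \<in> A''} \<le> card A''"
    using finA injfl A12 by (intro card_inj_on_le[of fl]) (auto simp: inj_on_def)
  finally have "card A' \<le> card P + card Q + card A''" by simp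
  then have P1: "card A \<le> 4 * real (card P)"
    using Qc small cA by linarith
  \<comment> \<open>Distinct cursors flip distinct coordinates, so every point of \<open>P\<close>
    is a separate edge inside the family \<open>B\<close>.\<close>
  have "card P \<le> card (flip_pairs \<psi> B)"
  proof (rule card_inj_on_le[of "\<lambda>(u, h). (u, \<iota> h)"])
    show "inj_on (\<lambda>(u, h). (u, \<iota> h)) P"
      using \<iota> by (force simp: inj_on_def P_def A'_def)
    show "(\<lambda>(u, h). (u, \<iota> h)) ` P \<subseteq> flip_pairs \<psi> B"
      by (auto simp: P_def A'_def fl_def flip_pairs_def)
    show "finite (flip_pairs \<psi> B)"
      using card_flip_pairs[OF \<psi> finB Bne rB] by blast
  qed
  \<comment> \<open>Edge-isoperimetry bounds \<open>card A\<close> from above, the slice sizes give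
    \<open>V * card B \<le> card A\<close> from below; dividing by \<open>card B\<close> bounds
    \<open>V\<close>.\<close>
  then have "card A \<le> 8 * (card B * log 2 (card B))"
    using card_flip_pairs[OF \<psi> finB Bne rB] P1 by linarith
  moreover have "V * card B \<le> card A" using VB cA by simp
  ultimately have "V * card B \<le> (8 * log 2 (card B)) * card B" by (simp add: algebra_simps)
  then have "V \<le> 8 * log 2 (card B)"
    using Bne finB by (simp add: card_gt_0_iff)
  moreover have "card B \<le> card A"
  proof -
    have "card B \<le> card (fst ` A)" using A(1) by (intro card_mono) (auto simp: B_def)
    then show ?thesis using card_image_le[OF A(1), of fst] by linarith
  qed
  moreover have "0 < card B" using Bne finB by (simp add: card_gt_0_iff)
  ultimately show ?thesis
    by (smt (verit) log_le_cancel_iff of_nat_0_less_iff of_nat_mono)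
qed

text \<open>A lower bound of order \<open>1 / iterlog n v\<close> for the relative boundary of sets
  of size \<open>v\<close>, in terms of left multiplication because that is how
  \<open>\<Gamma>\<close> moves the return set of a point to a subset of the coupling space.\<close>

definition isop_log :: "nat \<Rightarrow> ('g, 'c) monoid_scheme \<Rightarrow> bool" where
  "isop_log n G \<longleftrightarrow> (\<exists>S C. finite S \<and> S \<subseteq> carrier G \<and> C > 0 \<and>
     (\<forall>A. finite A \<and> A \<noteq> {} \<and> A \<subseteq> carrier G \<longrightarrow>
        real (card A) \<le> C * iterlog n (card A) * (\<Sum>s\<in>S. real (card (left_exit G s A)))))"

text \<open>As \<open>iterlog 0\<close> is the identity, only one exit point has to be found, and
  the largest integer in \<open>A\<close> is one.\<close>

lemma isop_log_Hgrp_0: "isop_log 0 (Hgrp F 1 0)"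
proof -
  let ?G = "Hgrp F 1 0"
  have "real (card A) \<le> real (card A) * real (card {x \<in> A. Zel [1] \<otimes>\<^bsub>?G\<^esub> x \<notin> A})"
    if A: "finite A" "A \<noteq> {}" "A \<subseteq> carrier ?G" for A
  proof -
    define I where "I = {i. Zel [i] \<in> A}"
    have "A = (\<lambda>i. Zel [i]) ` I" using A(3) by (auto simp: I_def Hgrp_0_simps)
    moreover have "inj_on (\<lambda>i. Zel [i] :: 'a wel) I" by (auto simp: inj_on_def)
    ultimately have I: "finite I" "I \<noteq> {}" using A(1,2) finite_image_iff by fastforce+
    then have "Max I \<in> I" "Max I + 1 \<notin> I" using Max_ge[of I "Max I + 1"] by auto
    then have "Zel [Max I] \<in> {x \<in> A. Zel [1] \<otimes>\<^bsub>?G\<^esub> x \<notin> A}"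
      by (simp add: I_def Hgrp_0_simps add.commute)
    then have "card {x \<in> A. Zel [1] \<otimes>\<^bsub>?G\<^esub> x \<notin> A} > 0"
      using A(1) by (subst card_gt_0_iff) auto
    then have "1 \<le> real (card {x \<in> A. Zel [1] \<otimes>\<^bsub>?G\<^esub> x \<notin> A})" by linarith
    then show ?thesis using mult_left_mono[of 1 _ "real (card A)"] by simp
  qed
  then show ?thesis
    unfolding isop_log_def
    by (intro exI[of _ "{Zel [1]}"] exI[of _ 1]) (auto simp: Hgrp_0_simps)
qed

context wreath_groups
begin

text \<open>Left multiplication by a lamp element acts on the lamp at the identity of
  \<open>G\<close>, which seen from the cursor \<open>h\<close> sits at
  \<open>inv h\<close>.\<close>

abbreviation "switch a h u \<equiv> u(inv h := a \<otimes>\<^bsub>F\<^esub> u (inv h))"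

text \<open>Here \<open>u\<close> is the lamp configuration as seen from the cursor \<open>h\<close>, so that left multiplication by an
  element of \<open>G\<close> changes only \<open>h\<close>.\<close>

definition wpt :: "('f wel \<Rightarrow> 'f) \<Rightarrow> 'f wel \<Rightarrow> 'f wel" where
  "wpt u h = wmk F (ltrans F G h u) h"

definition delta :: "'f \<Rightarrow> 'f wel \<Rightarrow> 'f" where
  "delta a g = (if g = \<one> then a else \<one>\<^bsub>F\<^esub>)"

lemma delta_lamps: "a \<in> carrier F \<Longrightarrow> delta a \<in> lamps F G"
proof (rule lampsI)
  have "{g. delta a g \<noteq> \<one>\<^bsub>F\<^esub>} \<subseteq> {\<one>}" by (auto simp: delta_def)
  then show "finite {g. delta a g \<noteq> \<one>\<^bsub>F\<^esub>}" using finite_subset by blast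
qed (auto simp: delta_def)

lemma ltrans_inverse:
  assumes "u \<in> lamps F G" "h \<in> carrier G"
  shows "ltrans F G h (ltrans F G (inv h) u) = u" "ltrans F G (inv h) (ltrans F G h u) = u"
  using assms by (simp_all add: ltrans_ltrans ltrans_one)

lemma bij_wpt: "bij_betw (\<lambda>(u, h). wpt u h) (lamps F G \<times> carrier G) (carrier W)"
proof (rule bij_betw_imageI)
  show "inj_on (\<lambda>(u, h). wpt u h) (lamps F G \<times> carrier G)"
  proof (rule inj_onI)
    fix x y assume xy: "x \<in> lamps F G \<times> carrier G" "y \<in> lamps F G \<times> carrier G"
      "(case x of (u, h) \<Rightarrow> wpt u h) = (case y of (u, h) \<Rightarrow> wpt u h)"
    obtain u h v k where uv: "x = (u, h)" "y = (v, k)" by fastforce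
    then have "ltrans F G h u = ltrans F G k v \<and> h = k"
      using xy by (auto simp: wpt_def wmk_inject ltrans_lamps)
    then have "ltrans F G (inv h) (ltrans F G h u) = ltrans F G (inv k) (ltrans F G k v)"
      by (metis (no_types))
    moreover have "u \<in> lamps F G" "h \<in> carrier G" "v \<in> lamps F G" "k \<in> carrier G" using xy(1,2) uv by simp_all
    ultimately have "u = v" by (simp only: ltrans_inverse(2))
    then show "x = y" using \<open>ltrans F G h u = ltrans F G k v \<and> h = k\<close> uv by simp
  qed
  show "(\<lambda>(u, h). wpt u h) ` (lamps F G \<times> carrier G) = carrier W"
  proof (intro equalityI subsetI)
    fix x assume "x \<in> carrier W"
    then obtain u h where "u \<in> lamps F G" "h \<in> carrier G" "x = wmk F u h" by (elim carrier_cases)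
    then have "x = wpt (ltrans F G (inv h) u) h" "ltrans F G (inv h) u \<in> lamps F G"
      by (simp_all add: wpt_def ltrans_inverse ltrans_lamps)
    then show "x \<in> (\<lambda>(u, h). wpt u h) ` (lamps F G \<times> carrier G)"
      using \<open>h \<in> carrier G\<close> by blast
  next
    fix x assume "x \<in> (\<lambda>(u, h). wpt u h) ` (lamps F G \<times> carrier G)"
    then show "x \<in> carrier W" by (auto simp: wpt_def wmk_in_carrier ltrans_lamps)
  qed
qed

lemma move_wpt:
  assumes "s \<in> carrier G" "u \<in> lamps F G" "h \<in> carrier G"
  shows "wmk F (\<lambda>_. \<one>\<^bsub>F\<^esub>) s \<otimes>\<^bsub>W\<^esub> wpt u h = wpt u (s \<otimes> h)"
  using assms lampsD(2)[OF ltrans_lamps[OF assms(2) G.m_closed[OF assms(1,3)]]]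
  by (simp add: wpt_def wmk_mult one_lamps ltrans_lamps ltrans_ltrans)

lemma switch_wpt:
  assumes "a \<in> carrier F" "u \<in> lamps F G" "h \<in> carrier G"
  shows "wmk F (delta a) \<one> \<otimes>\<^bsub>W\<^esub> wpt u h
      = wpt (switch a h u) h"
    and "switch a h u \<in> lamps F G"
proof -
  have "delta a g \<otimes>\<^bsub>F\<^esub> ltrans F G h u g
      = ltrans F G h (switch a h u) g" for g
  proof (cases "g \<in> carrier G")
    case True
    then have "inv h \<otimes> g = inv h \<longleftrightarrow> g = \<one>"
      using assms(3) by simp
    then show ?thesis using True assms lampsD(2)[OF assms(2)] by (simp add: delta_def ltrans_def)
  qed (auto simp: delta_def ltrans_def)
  then show "wmk F (delta a) \<one> \<otimes>\<^bsub>W\<^esub> wpt u h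
      = wpt (switch a h u) h"
    using assms by (simp add: wpt_def wmk_mult delta_lamps ltrans_lamps ltrans_one)
  show "switch a h u \<in> lamps F G"
  proof (rule lampsI)
    have "{g. switch a h u g \<noteq> \<one>\<^bsub>F\<^esub>} \<subseteq> insert (inv h) {g. u g \<noteq> \<one>\<^bsub>F\<^esub>}"
      by auto
    then show "finite {g. switch a h u g \<noteq> \<one>\<^bsub>F\<^esub>}"
      using lampsD(1)[OF assms(2)] finite_subset by blast
  qed (use assms lampsD(2,3)[OF assms(2)] in auto)
qed

text \<open>In relative coordinates the elements \<open>m s\<close> act inside the slices, which are
  finite subsets of \<open>G\<close> subject to the bound for \<open>G\<close>, while
  \<open>e\<close> flips a single lamp. If both kinds of boundary were small,
  \<open>slice_isoperimetry\<close> would bound the slice threshold \<open>V\<close> by a multiple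
  of the logarithm of \<open>card A\<close>; one logarithm is gained because only slices of size
  below that threshold need the bound for \<open>G\<close>.\<close>

lemma isop_log_wreath:
  assumes "isop_log n G" and a: "a \<in> carrier F" "a \<noteq> \<one>\<^bsub>F\<^esub>"
  shows "isop_log (Suc n) W"
proof -
  obtain S C where SC: "finite S \<and> S \<subseteq> carrier G \<and> C > 0 \<and>
     (\<forall>A. finite A \<and> A \<noteq> {} \<and> A \<subseteq> carrier G \<longrightarrow>
        real (card A) \<le> C * iterlog n (card A) * (\<Sum>s\<in>S. real (card (left_exit G s A))))"
    using assms(1) unfolding isop_log_def by (elim exE) (rule that)
  then have S: "finite S" "S \<subseteq> carrier G" "C > 0" by simp_all
  have isop: "real (card A) \<le> C * iterlog n (card A) * (\<Sum>s\<in>S. real (card (left_exit G s A)))"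
    if "finite A" "A \<noteq> {}" "A \<subseteq> carrier G" for A using SC that by simp
  define m where "m s = wmk F (\<lambda>_. \<one>\<^bsub>F\<^esub>) s" for s
  define e where "e = wmk F (delta a) \<one>"
  have delta_ne: "delta a \<noteq> (\<lambda>_. \<one>\<^bsub>F\<^esub>)" using a(2) by (metis delta_def)
  have em: "e \<notin> m ` S" "inj_on m S"
    using delta_ne a(1) by (auto simp: e_def m_def wmk_inject one_lamps delta_lamps inj_on_def)
  have main: "real (card A) \<le> 4 * (13 * C + 1) * iterlog (Suc n) (card A)
      * (\<Sum>s\<in>insert e (m ` S). real (card (left_exit W s A)))"
    if A: "finite A" "A \<noteq> {}" "A \<subseteq> carrier W" for A
  proof -
    define P where "P = {(u, h). u \<in> lamps F G \<and> h \<in> carrier G \<and> wpt u h \<in> A}"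
    have bij: "bij_betw (\<lambda>(u, h). wpt u h) P A"
    proof (rule bij_betw_subset[OF bij_wpt])
      show "P \<subseteq> lamps F G \<times> carrier G" by (auto simp: P_def)
      show "(\<lambda>(u, h). wpt u h) ` P = A"
      proof (intro equalityI subsetI)
        fix x assume "x \<in> A"
        then have "x \<in> (\<lambda>(u, h). wpt u h) ` (lamps F G \<times> carrier G)"
          using A(3) bij_betw_imp_surj_on[OF bij_wpt] by blast
        then show "x \<in> (\<lambda>(u, h). wpt u h) ` P" using \<open>x \<in> A\<close> by (auto simp: P_def)
      qed (auto simp: P_def)
    qed
    have cP: "card P = card A" and P: "finite P" "P \<noteq> {}"
      using bij_betw_same_card[OF bij] bij_betw_finite[OF bij] A bij by auto
    \<comment> \<open>Here \<open>f\<close> is left multiplication by \<open>s\<close> read in the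
      coordinates \<open>(u, h)\<close>.\<close>
    have bd: "card {x \<in> P. f x \<notin> P} = card (left_exit W s A)"
      if f: "\<And>u h. (u, h) \<in> P \<Longrightarrow> s \<otimes>\<^bsub>W\<^esub> wpt u h = (\<lambda>(u, h). wpt u h) (f (u, h))
        \<and> f (u, h) \<in> lamps F G \<times> carrier G" for f s
    proof -
      have iff: "f z \<in> P \<longleftrightarrow> s \<otimes>\<^bsub>W\<^esub> (case z of (u, h) \<Rightarrow> wpt u h) \<in> A" if "z \<in> P" for z
        using f that by (cases z; cases "f z") (force simp: P_def)
      have "bij_betw (\<lambda>(u, h). wpt u h) {x \<in> P. f x \<notin> P} (left_exit W s A)"
      proof (rule bij_betw_subset[OF bij])
        show "(\<lambda>(u, h). wpt u h) ` {x \<in> P. f x \<notin> P} = left_exit W s A"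
        proof (intro equalityI subsetI)
          fix x assume x: "x \<in> left_exit W s A"
          then obtain z where "z \<in> P" "x = (case z of (u, h) \<Rightarrow> wpt u h)"
            using bij_betw_imp_surj_on[OF bij] by blast
          then show "x \<in> (\<lambda>(u, h). wpt u h) ` {x \<in> P. f x \<notin> P}" using x iff[of z] by blast
        next
          fix x assume "x \<in> (\<lambda>(u, h). wpt u h) ` {x \<in> P. f x \<notin> P}"
          then obtain z where "z \<in> P" "f z \<notin> P" "x = (case z of (u, h) \<Rightarrow> wpt u h)" by blast
          then show "x \<in> left_exit W s A"
            using iff[of z] bij_betw_imp_surj_on[OF bij] by blast
        qed
      qed auto
      then show ?thesis by (rule bij_betw_same_card)
    qed
    have bd_m: "card (left_exit W (m s) A) = card {(u, h). (u, h) \<in> P \<and> (u, s \<otimes> h) \<notin> P}"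
      if "s \<in> S" for s
    proof -
      have "card {x \<in> P. (case x of (u, h) \<Rightarrow> (u, s \<otimes> h)) \<notin> P} = card (left_exit W (m s) A)"
        using that S(2) by (intro bd) (auto simp: P_def m_def move_wpt)
      moreover have "{x \<in> P. (case x of (u, h) \<Rightarrow> (u, s \<otimes> h)) \<notin> P}
          = {(u, h). (u, h) \<in> P \<and> (u, s \<otimes> h) \<notin> P}" by auto
      ultimately show ?thesis by simp
    qed
    have bd_e: "card (left_exit W e A)
        = card {(u, h). (u, h) \<in> P \<and> (switch a h u, h) \<notin> P}"
    proof -
      have "card {x \<in> P. (case x of (u, h) \<Rightarrow> (switch a h u, h)) \<notin> P}
          = card (left_exit W e A)"
        using a(1) by (intro bd) (auto simp: P_def e_def switch_wpt)
      moreover have "{x \<in> P. (case x of (u, h) \<Rightarrow> (switch a h u, h)) \<notin> P}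
          = {(u, h). (u, h) \<in> P \<and> (switch a h u, h) \<notin> P}" by auto
      ultimately show ?thesis by simp
    qed
    define b where "b u = (\<Sum>s\<in>S. real (card {h. (u, h) \<in> P \<and> (u, s \<otimes> h) \<notin> P}))" for u
    have fin_sl: "finite {h. (u, h) \<in> P}" for u
      by (rule finite_subset[OF _ finite_imageI[OF P(1), of snd]]) force
    have sum_b: "(\<Sum>u\<in>fst ` P. b u) = (\<Sum>s\<in>S. real (card (left_exit W (m s) A)))"
    proof -
      have "(\<Sum>u\<in>fst ` P. b u)
          = (\<Sum>s\<in>S. \<Sum>u\<in>fst ` P. real (card {h. (u, h) \<in> P \<and> (u, s \<otimes> h) \<notin> P}))"
        unfolding b_def by (rule sum.swap)
      also have "\<dots> = (\<Sum>s\<in>S. real (card (left_exit W (m s) A)))"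
      proof (rule sum.cong[OF refl])
        fix s assume "s \<in> S"
        have "{(u, h). (u, h) \<in> P \<and> (u, s \<otimes> h) \<notin> P}
            = Sigma (fst ` P) (\<lambda>u. {h. (u, h) \<in> P \<and> (u, s \<otimes> h) \<notin> P})" by force
        moreover have "finite {h. (u, h) \<in> P \<and> (u, s \<otimes> h) \<notin> P}" for u
          by (rule finite_subset[OF _ fin_sl[of u]]) auto
        ultimately show "(\<Sum>u\<in>fst ` P. real (card {h. (u, h) \<in> P \<and> (u, s \<otimes> h) \<notin> P}))
            = real (card (left_exit W (m s) A))"
          using P(1) bd_m[OF \<open>s \<in> S\<close>] by simp
      qed
      finally show ?thesis .
    qed
    have A1: "1 \<le> real (card A)" using A(1,2) by (simp add: Suc_le_eq card_gt_0_iff)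
    \<comment> \<open>Chosen just above the bound concluded by \<open>slice_isoperimetry\<close>, so
      that its two smallness hypotheses cannot both hold.\<close>
    define V where "V = 8 * log 2 (card A) + 1"
    define r where "r = C * iterlog n V"
    have V1: "V \<ge> 1" using A1 by (simp add: V_def)
    have "log 2 (card A) = ln (card A) / ln 2" by (simp add: log_def)
    also have "\<dots> \<le> ln (card A) / (2 / 3)"
      using A1 ln2_ge_two_thirds by (intro divide_left_mono) auto
    also have "\<dots> \<le> ln (card A + exp 1) * (3 / 2)"
    proof -
      have "ln (card A) \<le> ln (card A + exp 1)"
        using A1 by (subst ln_le_cancel_iff) (linarith, rule add_nonneg_pos, simp_all)
      then show ?thesis by simp
    qed
    \<comment> \<open>From \<open>ln 2 \<ge> 2 / 3\<close> the first term is at most 12 logarithms,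
      and the summand 1 is at most one more.\<close>
    finally have "V \<le> 13 * ln (card A + exp 1)"
      using ln_add_e_ge_1[of "card A"] by (simp add: V_def)
    then have "iterlog n V \<le> iterlog n (13 * ln (card A + exp 1))"
      using V1 by (intro iterlog_mono) auto
    also have "\<dots> \<le> 13 * iterlog n (ln (card A + exp 1))"
      using ln_add_e_ge_1[of "card A"] by (intro iterlog_mult) auto
    finally have r_le: "r \<le> 13 * C * iterlog (Suc n) (card A)"
      using S(3) by (simp add: r_def)
    have L1: "1 \<le> iterlog (Suc n) (card A)" by (rule iterlog_ge_1[OF A1])
    have r_pos: "0 < r" using iterlog_ge_1[OF V1, of n] S(3) by (simp add: r_def)
    let ?sb = "\<Sum>u\<in>fst ` P. b u" and ?lb = "card (left_exit W e A)"
    have b0: "0 \<le> b u" for u by (simp add: b_def sum_nonneg)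
    have "\<not> (4 * r * ?sb \<le> card P \<and> 4 * ?lb \<le> card P)"
    proof
      assume small: "4 * r * ?sb \<le> card P \<and> 4 * ?lb \<le> card P"
      have "V \<le> 8 * log 2 (card P)"
      proof (rule slice_isoperimetry[where \<psi> = "\<lambda>v. a \<otimes>\<^bsub>F\<^esub> v" and C = "carrier F" and b = b and r = r
            and \<iota> = "m_inv G"])
        show "inj_on (\<lambda>v. a \<otimes>\<^bsub>F\<^esub> v) (carrier F)" using a(1) by (rule F.inj_on_cmult)
        show "\<And>v. v \<in> carrier F \<Longrightarrow> a \<otimes>\<^bsub>F\<^esub> v \<noteq> v" using a by simp
        show "\<And>u h. (u, h) \<in> P \<Longrightarrow> range u \<subseteq> carrier F" using lampsD(2) by (auto simp: P_def)
        show "inj_on (m_inv G) (snd ` P)"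
          by (rule inj_on_subset[OF G.inv_inj]) (auto simp: P_def)
        show "4 * card {(u, h). (u, h) \<in> P \<and> (switch a h u, h) \<notin> P} \<le> card P"
          using small bd_e by simp
        fix u assume u: "u \<in> fst ` P" "real (card {h. (u, h) \<in> P}) < V"
        have "real (card {h. (u, h) \<in> P}) \<le> C * iterlog n (card {h. (u, h) \<in> P})
            * (\<Sum>s\<in>S. real (card {x \<in> {h. (u, h) \<in> P}. s \<otimes> x \<notin> {h. (u, h) \<in> P}}))"
          using u(1) by (intro isop fin_sl) (auto simp: P_def)
        also have "(\<Sum>s\<in>S. real (card {x \<in> {h. (u, h) \<in> P}. s \<otimes> x \<notin> {h. (u, h) \<in> P}})) = b u"
          by (simp add: b_def)
        also have "C * iterlog n (card {h. (u, h) \<in> P}) * b u \<le> r * b u"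
          unfolding r_def using u(2) S(3) b0
          by (intro mult_right_mono mult_left_mono iterlog_mono) auto
        finally show "real (card {h. (u, h) \<in> P}) \<le> r * b u" .
      qed (use P b0 r_pos small in auto)
      then show False by (simp add: V_def cP)
    qed
    \<comment> \<open>Whichever boundary is large already bounds \<open>card A\<close>; adding the
      other, non-negative term gives one bound for both cases.\<close>
    then have "card A \<le> 4 * r * ?sb \<or> card A \<le> 4 * ?lb" using cP by linarith
    moreover have "0 \<le> 4 * r * ?sb" using r_pos b0 by (intro mult_nonneg_nonneg sum_nonneg) auto
    ultimately have "card A \<le> 4 * r * ?sb + 4 * ?lb" by linarith
    also have "\<dots> \<le> 4 * (13 * C * iterlog (Suc n) (card A)) * ?sb + 4 * iterlog (Suc n) (card A) * ?lb"
    proof -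
      have "r * ?sb \<le> 13 * C * iterlog (Suc n) (card A) * ?sb"
        using r_le b0 by (intro mult_right_mono sum_nonneg) auto
      moreover have "1 * real ?lb \<le> iterlog (Suc n) (card A) * ?lb"
        using L1 by (intro mult_right_mono) auto
      ultimately show ?thesis by (simp add: algebra_simps)
    qed
    also have "\<dots> \<le> 4 * (13 * C + 1) * iterlog (Suc n) (card A) * (?sb + ?lb)"
    proof -
      have "0 \<le> iterlog (Suc n) (card A) * ?sb" "0 \<le> C * (iterlog (Suc n) (card A) * ?lb)"
        using L1 b0 S(3) by (auto intro!: mult_nonneg_nonneg sum_nonneg)
      then show ?thesis by (simp add: algebra_simps)
    qed
    also have "?sb + ?lb = (\<Sum>s\<in>insert e (m ` S). real (card (left_exit W s A)))"
      using em S(1) by (simp add: sum_b sum.reindex)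
    finally show ?thesis .
  qed
  have "insert e (m ` S) \<subseteq> carrier W"
    using a(1) S(2) by (auto simp: e_def m_def wmk_in_carrier one_lamps delta_lamps)
  then show ?thesis
    unfolding isop_log_def using main S(1,3)
    by (intro exI[of _ "insert e (m ` S)"] exI[of _ "4 * (13 * C + 1)"]) auto
qed

end

lemma isop_log_Hgrp:
  assumes "group F" "card (carrier F) \<noteq> 1"
  shows "isop_log n (Hgrp F 1 n)"
proof (induction n)
  case 0
  show ?case by (rule isop_log_Hgrp_0)
next
  case (Suc n)
  interpret wreath_groups F "Hgrp F 1 n" using assms group_Hgrp by (simp add: wreath_groups_def)
  have "carrier F \<noteq> {\<one>\<^bsub>F\<^esub>}" using assms(2) by auto
  then obtain a where "a \<in> carrier F" "a \<noteq> \<one>\<^bsub>F\<^esub>" using F.one_closed by blast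
  then show ?case unfolding Hgrp_Suc by (rule isop_log_wreath[OF Suc])
qed

section \<open>Measure equivalence couplings with the integers\<close>

lemma action_distr:
  assumes "mp_free_action G M \<alpha>" "g \<in> carrier G"
  shows "\<alpha> g \<in> M \<rightarrow>\<^sub>M M" "distr M M (\<alpha> g) = M"
proof -
  show m: "\<alpha> g \<in> M \<rightarrow>\<^sub>M M" using assms by (simp add: mp_free_action_def)
  show "distr M M (\<alpha> g) = M"
    using assms m by (intro measure_eqI) (auto simp: mp_free_action_def emeasure_distr)
qed

lemma action_nn_integral:
  assumes "mp_free_action G M \<alpha>" "g \<in> carrier G" "f \<in> borel_measurable M"
  shows "(\<integral>\<^sup>+x. f (\<alpha> g x) \<partial>M) = nn_integral M f"
  using nn_integral_distr[OF action_distr(1)[OF assms(1,2)], of f] assms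
  by (simp add: action_distr(2))

lemma action_simps:
  assumes "group G" "mp_free_action G M \<alpha>" "g \<in> carrier G" "x \<in> space M"
  shows "\<alpha> g x \<in> space M" "\<alpha> \<one>\<^bsub>G\<^esub> x = x" "\<alpha> (inv\<^bsub>G\<^esub> g) (\<alpha> g x) = x" "\<alpha> g (\<alpha> (inv\<^bsub>G\<^esub> g) x) = x"
    "h \<in> carrier G \<Longrightarrow> \<alpha> (h \<otimes>\<^bsub>G\<^esub> g) x = \<alpha> h (\<alpha> g x)"
proof -
  interpret G: group G by fact
  show "\<alpha> g x \<in> space M" using measurable_space[OF action_distr(1)[OF assms(2,3)] assms(4)] .
  show one: "\<alpha> \<one>\<^bsub>G\<^esub> x = x" using assms by (simp add: mp_free_action_def)
  show mult: "\<alpha> (h \<otimes>\<^bsub>G\<^esub> g) x = \<alpha> h (\<alpha> g x)" if "h \<in> carrier G" for h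
    using assms that by (simp add: mp_free_action_def)
  show "\<alpha> (inv\<^bsub>G\<^esub> g) (\<alpha> g x) = x" using mult[of "inv\<^bsub>G\<^esub> g"] one assms(3) by simp
  have "\<alpha> (g \<otimes>\<^bsub>G\<^esub> inv\<^bsub>G\<^esub> g) x = \<alpha> g (\<alpha> (inv\<^bsub>G\<^esub> g) x)"
    using assms G.inv_closed unfolding mp_free_action_def by blast
  then show "\<alpha> g (\<alpha> (inv\<^bsub>G\<^esub> g) x) = x" using one assms(3) by simp
qed

lemma nn_integral_count_space_single:
  assumes "a \<in> A" "\<And>g. g \<in> A \<Longrightarrow> g \<noteq> a \<Longrightarrow> f g = 0"
  shows "(\<integral>\<^sup>+g. f g \<partial>count_space A) = (f a :: ennreal)"
proof -
  have "(\<integral>\<^sup>+g. f g \<partial>count_space A) = (\<integral>\<^sup>+g. f a * indicator {a} g \<partial>count_space A)"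
    using assms by (intro nn_integral_cong) (auto simp: indicator_def)
  also have "\<dots> = f a" using assms(1) by (simp add: nn_integral_cmult_indicator)
  finally show ?thesis .
qed

text \<open>Mass transport: insert the sum over \<open>g\<close> of the indicator of
  \<open>X\<close> at \<open>\<alpha> g x\<close>, which is 1, exchange sum and integral, use
  invariance of the measure under each \<open>\<alpha> g\<close>, and reindex by inversion.\<close>

lemma fundamental_domain_unfold:
  assumes G: "group G" "countable (carrier G)" and act: "mp_free_action G M \<alpha>"
    and X: "fundamental_domain G M \<alpha> X" and f: "f \<in> borel_measurable M"
  shows "nn_integral M f = (\<integral>\<^sup>+x\<in>X. (\<integral>\<^sup>+g. f (\<alpha> g x) \<partial>count_space (carrier G)) \<partial>M)"
proof -
  interpret G: group G by fact
  have [measurable]: "X \<in> sets M" using X by (simp add: fundamental_domain_def)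
  have ma: "\<alpha> g \<in> M \<rightarrow>\<^sub>M M" if "g \<in> carrier G" for g using action_distr(1)[OF act that] .
  have m1: "(\<lambda>x. indicator X (\<alpha> g x) * f x) \<in> borel_measurable M"
    and m2: "(\<lambda>x. indicator X x * f (\<alpha> g x)) \<in> borel_measurable M" if "g \<in> carrier G" for g
    using ma[OF that] f by simp_all
  have "nn_integral M f
      = (\<integral>\<^sup>+x. (\<integral>\<^sup>+g. indicator X (\<alpha> g x) * f x \<partial>count_space (carrier G)) \<partial>M)"
  proof (rule nn_integral_cong)
    fix x assume "x \<in> space M"
    then have "\<exists>!g. g \<in> carrier G \<and> \<alpha> g x \<in> X"
      using X by (simp add: fundamental_domain_def)
    then obtain g where g: "g \<in> carrier G" "\<alpha> g x \<in> X"
      "\<And>h. h \<in> carrier G \<Longrightarrow> \<alpha> h x \<in> X \<Longrightarrow> h = g"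
      by blast
    have "\<alpha> h x \<notin> X" if "h \<in> carrier G" "h \<noteq> g" for h using g(3) that by blast
    then have "(\<integral>\<^sup>+g. indicator X (\<alpha> g x) * f x \<partial>count_space (carrier G)) = indicator X (\<alpha> g x) * f x"
      using g(1) by (intro nn_integral_count_space_single) simp_all
    then show "f x = (\<integral>\<^sup>+g. indicator X (\<alpha> g x) * f x \<partial>count_space (carrier G))" using g(1,2) by simp
  qed
  also have "\<dots> = (\<integral>\<^sup>+g. (\<integral>\<^sup>+x. indicator X (\<alpha> g x) * f x \<partial>M) \<partial>count_space (carrier G))"
    using G(2) m1 by (intro nn_integral_count_space_nn_integral) auto
  also have "\<dots> = (\<integral>\<^sup>+g. (\<integral>\<^sup>+x. indicator X x * f (\<alpha> (inv\<^bsub>G\<^esub> g) x) \<partial>M) \<partial>count_space (carrier G))"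
  proof (rule nn_integral_cong)
    fix g assume "g \<in> space (count_space (carrier G))"
    then have g: "g \<in> carrier G" by simp
    have "(\<integral>\<^sup>+x. indicator X (\<alpha> g x) * f x \<partial>M)
        = (\<integral>\<^sup>+x. indicator X (\<alpha> g x) * f (\<alpha> (inv\<^bsub>G\<^esub> g) (\<alpha> g x)) \<partial>M)"
      using action_simps(3)[OF G(1) act g] by (intro nn_integral_cong) simp
    also have "\<dots> = (\<integral>\<^sup>+x. indicator X x * f (\<alpha> (inv\<^bsub>G\<^esub> g) x) \<partial>M)"
      using m2[of "inv\<^bsub>G\<^esub> g"] g by (intro action_nn_integral[OF act g]) simp
    finally show "(\<integral>\<^sup>+x. indicator X (\<alpha> g x) * f x \<partial>M)
        = (\<integral>\<^sup>+x. indicator X x * f (\<alpha> (inv\<^bsub>G\<^esub> g) x) \<partial>M)" .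
  qed
  also have "\<dots> = (\<integral>\<^sup>+g. (\<integral>\<^sup>+x. indicator X x * f (\<alpha> g x) \<partial>M) \<partial>count_space (carrier G))"
  proof (rule nn_integral_bij_count_space[of "m_inv G" _ _ "\<lambda>g. \<integral>\<^sup>+x. indicator X x * f (\<alpha> g x) \<partial>M"])
    show "bij_betw (m_inv G) (carrier G) (carrier G)"
      by (rule bij_betwI[of _ _ _ "m_inv G"]) auto
  qed
  also have "\<dots> = (\<integral>\<^sup>+x. (\<integral>\<^sup>+g. indicator X x * f (\<alpha> g x) \<partial>count_space (carrier G)) \<partial>M)"
    using G(2) m2 by (intro nn_integral_count_space_nn_integral[symmetric]) auto
  also have "\<dots> = (\<integral>\<^sup>+x\<in>X. (\<integral>\<^sup>+g. f (\<alpha> g x) \<partial>count_space (carrier G)) \<partial>M)"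
    by (intro nn_integral_cong) (auto simp: nn_integral_cmult mult.commute)
  finally show ?thesis .
qed

text \<open>Unfold \<open>f\<close> times the indicator of \<open>Y\<close> over \<open>X\<close>:
  each orbit sum has a single non-zero term, equal to \<open>f x\<close> by invariance.\<close>

lemma invariant_nn_integral_fundamental_domain:
  assumes G: "group G" "countable (carrier G)" and act: "mp_free_action G M \<alpha>"
    and X: "fundamental_domain G M \<alpha> X"
    and Y: "Y \<in> sets M" "\<And>x. x \<in> space M \<Longrightarrow> \<exists>!g. g \<in> carrier G \<and> \<alpha> g x \<in> Y"
    and f: "f \<in> borel_measurable M" "\<And>g x. g \<in> carrier G \<Longrightarrow> x \<in> space M \<Longrightarrow> f (\<alpha> g x) = f x"
  shows "(\<integral>\<^sup>+x\<in>Y. f x \<partial>M) = (\<integral>\<^sup>+x\<in>X. f x \<partial>M)"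
proof -
  have "(\<integral>\<^sup>+x\<in>Y. f x \<partial>M)
      = (\<integral>\<^sup>+x\<in>X. (\<integral>\<^sup>+g. f (\<alpha> g x) * indicator Y (\<alpha> g x) \<partial>count_space (carrier G)) \<partial>M)"
    using f(1) Y(1) by (intro fundamental_domain_unfold[OF G act X]) auto
  also have "\<dots> = (\<integral>\<^sup>+x\<in>X. f x \<partial>M)"
  proof (rule nn_integral_cong, rule arg_cong2[where f = "(*)", OF _ refl])
    fix x assume x: "x \<in> space M"
    then obtain g where g: "g \<in> carrier G" "\<alpha> g x \<in> Y"
      "\<And>h. h \<in> carrier G \<Longrightarrow> \<alpha> h x \<in> Y \<Longrightarrow> h = g"
      using Y(2)[OF x] by blast
    have "\<alpha> h x \<notin> Y" if "h \<in> carrier G" "h \<noteq> g" for h using g(3) that by blast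
    then have "(\<integral>\<^sup>+g. f (\<alpha> g x) * indicator Y (\<alpha> g x) \<partial>count_space (carrier G))
        = f (\<alpha> g x) * indicator Y (\<alpha> g x)"
      using g(1) by (intro nn_integral_count_space_single) simp_all
    then show "(\<integral>\<^sup>+g. f (\<alpha> g x) * indicator Y (\<alpha> g x) \<partial>count_space (carrier G)) = f x"
      using g(1,2) f(2) x by simp
  qed
  finally show ?thesis .
qed

section \<open>Slabs in a coupling with the integers\<close>

locale Z_coupling = \<Gamma>: group \<Gamma> for \<Gamma> :: "('g, 'c) monoid_scheme" (structure) +
  fixes M :: "'o measure" and \<alpha> :: "'g \<Rightarrow> 'o \<Rightarrow> 'o" and \<beta> :: "int \<Rightarrow> 'o \<Rightarrow> 'o" and Y X :: "'o set"
  assumes countable_\<Gamma>: "countable (carrier \<Gamma>)"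
    and coupling: "ME_coupling \<Gamma> integer_group M \<alpha> \<beta> Y X"
begin

lemma acts: "mp_free_action \<Gamma> M \<alpha>" "mp_free_action integer_group M \<beta>"
  and domains: "fundamental_domain \<Gamma> M \<alpha> Y" "fundamental_domain integer_group M \<beta> X"
  and commute: "g \<in> carrier \<Gamma> \<Longrightarrow> x \<in> space M \<Longrightarrow> \<alpha> g (\<beta> l x) = \<beta> l (\<alpha> g x)"
  using coupling by (auto simp: ME_coupling_def)

lemma sets_XY [measurable]: "X \<in> sets M" "Y \<in> sets M" and finite_X: "emeasure M X < \<infinity>"
  using domains by (auto simp: fundamental_domain_def)

lemma measurable_\<alpha>: "g \<in> carrier \<Gamma> \<Longrightarrow> \<alpha> g \<in> M \<rightarrow>\<^sub>M M"
  and measurable_\<beta> [measurable]: "\<beta> l \<in> M \<rightarrow>\<^sub>M M"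
  using action_distr(1)[OF acts(1)] action_distr(1)[OF acts(2)] by auto

lemma space_\<alpha>: "g \<in> carrier \<Gamma> \<Longrightarrow> x \<in> space M \<Longrightarrow> \<alpha> g x \<in> space M"
  and space_\<beta>: "x \<in> space M \<Longrightarrow> \<beta> l x \<in> space M"
  using measurable_space[OF measurable_\<alpha>] measurable_space[OF measurable_\<beta>] by auto

lemma \<beta>_simps:
  assumes "x \<in> space M" shows "\<beta> 0 x = x" "\<beta> (k + l) x = \<beta> k (\<beta> l x)"
  using acts(2) assms by (auto simp: mp_free_action_def)

abbreviation "\<kappa> \<equiv> cocycle_at integer_group \<beta> X"
abbreviation "cocycle_length s x \<equiv> \<bar>real_of_int (\<kappa> (\<alpha> s x))\<bar>"

lemma \<kappa>_iff:
  assumes "x \<in> space M" shows "\<kappa> x = l \<longleftrightarrow> \<beta> l x \<in> X"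
proof -
  have ex1: "\<exists>!l. \<beta> l x \<in> X" using domains(2) assms by (auto simp: fundamental_domain_def)
  have "\<beta> (THE l. \<beta> l x \<in> X) x \<in> X" by (rule theI'[OF ex1])
  then have "\<beta> (\<kappa> x) x \<in> X" by (simp add: cocycle_at_def)
  then show ?thesis using ex1 by blast
qed

lemma \<kappa>_\<beta>:
  assumes "x \<in> space M" shows "\<kappa> (\<beta> l x) = \<kappa> x - l"
  using \<kappa>_iff[OF space_\<beta>[OF assms], of l "\<kappa> x - l"] \<kappa>_iff[OF assms, of "\<kappa> x"]
    \<beta>_simps(2)[OF assms, of "\<kappa> x - l" l] by simp

lemma \<kappa>_X: "x \<in> X \<Longrightarrow> \<kappa> x = 0"
  using \<kappa>_iff[of x 0] \<beta>_simps(1)[of x] sets.sets_into_space[OF sets_XY(1)] by auto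

lemma measurable_\<kappa> [measurable]: "\<kappa> \<in> M \<rightarrow>\<^sub>M count_space UNIV"
proof (rule measurable_count_space_eq2_countable[THEN iffD2, rotated])
  have "\<kappa> -` {l} \<inter> space M = \<beta> l -` X \<inter> space M" for l using \<kappa>_iff by auto
  then show "\<kappa> \<in> space M \<rightarrow> UNIV \<and> (\<forall>l\<in>UNIV. \<kappa> -` {l} \<inter> space M \<in> sets M)"
    using measurable_sets[OF measurable_\<beta> sets_XY(1)] by simp
qed

text \<open>Union of the translates \<open>\<beta> (- l) X\<close> for \<open>0 \<le> l < N\<close>,
  since \<open>\<kappa> x = l\<close> means that \<open>\<beta> l\<close> brings \<open>x\<close>
  into \<open>X\<close>. Thus \<open>\<kappa>\<close> serves as a height function.\<close>

definition slab :: "nat \<Rightarrow> 'o set" where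
  "slab N = {x \<in> space M. 0 \<le> \<kappa> x \<and> \<kappa> x < int N}"

lemma sets_slab [measurable]: "slab N \<in> sets M"
  unfolding slab_def by measurable

text \<open>For \<open>x \<in> X\<close> the point \<open>\<beta> l x\<close> has height
  \<open>- l\<close>, so the orbit of \<open>x\<close> meets the slab exactly for the
  \<open>N\<close> values of \<open>l\<close> in \<open>{- int N<..0}\<close>.\<close>

lemma emeasure_slab: "emeasure M (slab N) = N * emeasure M X"
proof -
  have "emeasure M (slab N) = (\<integral>\<^sup>+x. indicator (slab N) x \<partial>M)" by simp
  also have "\<dots> = (\<integral>\<^sup>+x\<in>X. (\<integral>\<^sup>+l. indicator (slab N) (\<beta> l x) \<partial>count_space UNIV) \<partial>M)"
    using fundamental_domain_unfold[OF _ _ acts(2) domains(2), of "indicator (slab N)"] by simp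
  also have "\<dots> = (\<integral>\<^sup>+x\<in>X. of_nat N \<partial>M)"
  proof (rule nn_integral_cong)
    fix x assume x: "x \<in> space M"
    have "(\<integral>\<^sup>+l. indicator (slab N) (\<beta> l x) \<partial>count_space UNIV) = ennreal N" if "x \<in> X"
    proof -
      have "indicator (slab N) (\<beta> l x) = (indicator {- int N <.. 0} l :: ennreal)" for l
        using x \<kappa>_X[OF that] by (auto simp: slab_def indicator_def \<kappa>_\<beta> space_\<beta>)
      then have "(\<integral>\<^sup>+l. indicator (slab N) (\<beta> l x) \<partial>count_space UNIV)
          = emeasure (count_space UNIV) {- int N <.. 0}" by simp
      also have "\<dots> = ennreal N" by (subst emeasure_count_space) (auto simp: ennreal_of_nat_eq_real_of_nat)
      finally show ?thesis .
    qed
    then show "(\<integral>\<^sup>+l. indicator (slab N) (\<beta> l x) \<partial>count_space UNIV) * indicator X x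
        = of_nat N * (indicator X x :: ennreal)"
      by (auto simp: indicator_def ennreal_of_nat_eq_real_of_nat)
  qed
  also have "\<dots> = N * emeasure M X" by (simp add: nn_integral_cmult_indicator)
  finally show ?thesis .
qed

lemma card_window_exit:
  "finite {l. - int N < l \<and> l \<le> 0 \<and> \<not> (0 \<le> k - l \<and> k - l < int N)}"
  "card {l. - int N < l \<and> l \<le> 0 \<and> \<not> (0 \<le> k - l \<and> k - l < int N)} \<le> min (nat \<bar>k\<bar>) N"
proof -
  let ?E = "{l. - int N < l \<and> l \<le> 0 \<and> \<not> (0 \<le> k - l \<and> k - l < int N)}"
  have 1: "?E \<subseteq> {- int N <.. 0}" by auto
  then show "finite ?E" by (rule finite_subset) simp
  have "card ?E \<le> card {- int N <.. 0}" by (rule card_mono[OF _ 1]) simp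
  then have N: "card ?E \<le> N" by simp
  have "?E \<subseteq> (if k \<ge> 0 then {- int N <.. k - int N} else {k <.. 0})" by auto
  then have "card ?E \<le> card (if k \<ge> 0 then {- int N <.. k - int N} else {k <.. 0})"
    by (rule card_mono[rotated]) simp
  also have "\<dots> \<le> nat \<bar>k\<bar>" by simp
  finally show "card ?E \<le> min (nat \<bar>k\<bar>) N" using N by simp
qed

text \<open>Because the actions commute, \<open>\<alpha> s\<close> moves \<open>\<beta> l x\<close>
  from height \<open>- l\<close> to height \<open>\<kappa> (\<alpha> s x) - l\<close>. The whole
  window is shifted by the cocycle, and \<open>card_window_exit\<close> counts what falls
  out.\<close>

lemma emeasure_slab_boundary:
  assumes s: "s \<in> carrier \<Gamma>"
  shows "emeasure M {x \<in> slab N. \<alpha> s x \<notin> slab N}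
    \<le> (\<integral>\<^sup>+x\<in>X. ennreal (min (cocycle_length s x) N) \<partial>M)"
proof -
  have [measurable]: "\<alpha> s \<in> M \<rightarrow>\<^sub>M M" by (rule measurable_\<alpha>[OF s])
  let ?D = "{x \<in> slab N. \<alpha> s x \<notin> slab N}"
  have "?D = {x \<in> space M. x \<in> slab N \<and> \<alpha> s x \<notin> slab N}" by (auto simp: slab_def)
  also have "\<dots> \<in> sets M" by measurable
  finally have D: "?D \<in> sets M" .
  have "emeasure M ?D = (\<integral>\<^sup>+x. indicator ?D x \<partial>M)" using D by simp
  also have "\<dots> = (\<integral>\<^sup>+x\<in>X. (\<integral>\<^sup>+l. indicator ?D (\<beta> l x) \<partial>count_space UNIV) \<partial>M)"
    using fundamental_domain_unfold[OF _ _ acts(2) domains(2), of "indicator ?D"] D by simp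
  also have "\<dots> \<le> (\<integral>\<^sup>+x\<in>X. ennreal (min (cocycle_length s x) N) \<partial>M)"
  proof (rule nn_integral_mono)
    fix x assume x: "x \<in> space M"
    show "(\<integral>\<^sup>+l. indicator ?D (\<beta> l x) \<partial>count_space UNIV) * indicator X x
        \<le> ennreal (min (cocycle_length s x) N) * indicator X x"
    proof (cases "x \<in> X")
      case True
      let ?E = "{l. - int N < l \<and> l \<le> 0 \<and> \<not> (0 \<le> \<kappa> (\<alpha> s x) - l \<and> \<kappa> (\<alpha> s x) - l < int N)}"
      have eq: "indicator ?D (\<beta> l x) = (indicator ?E l :: ennreal)" for l
        using x \<kappa>_X[OF True] s
        by (auto simp: slab_def indicator_def \<kappa>_\<beta> space_\<beta> commute space_\<alpha>)
      have "(\<integral>\<^sup>+l. indicator ?D (\<beta> l x) \<partial>count_space UNIV) = emeasure (count_space UNIV) ?E"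
        unfolding eq by (rule nn_integral_indicator) simp
      also have "\<dots> = ennreal (card ?E)"
        using card_window_exit(1)[of N "\<kappa> (\<alpha> s x)"]
        by (subst emeasure_count_space) (auto simp: ennreal_of_nat_eq_real_of_nat)
      also have "\<dots> \<le> ennreal (min (cocycle_length s x) N)"
        using card_window_exit(2)[of N "\<kappa> (\<alpha> s x)"] by (intro ennreal_leI) linarith
      finally show ?thesis using True by simp
    qed simp
  qed
  finally show ?thesis .
qed

end

text \<open>All remaining iterations are applied to 1 after the factor
  \<open>ln (t + exp 1)\<close>, which is at least 1, has been moved out by
  \<open>iterlog_mult\<close>.\<close>

lemma iterlog_le_ln:
  assumes "0 \<le> t" shows "iterlog (Suc n) t \<le> iterlog n 1 * ln (t + exp 1)"
  using iterlog_mult[of "ln (t + exp 1)" 1 n] ln_add_e_ge_1[OF assms] by (simp add: mult.commute)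

lemma iterlog_ratio_tendsto_0:
  assumes "n \<ge> 1" shows "(\<lambda>N. iterlog n (real N) / real N) \<longlonglongrightarrow> 0"
proof -
  obtain m where m: "n = Suc m" using assms by (cases n) auto
  have "((\<lambda>t::real. ln (t + exp 1) / t) \<longlongrightarrow> 0) at_top" by real_asymp
  then have "(\<lambda>N. ln (real N + exp 1) / real N) \<longlonglongrightarrow> 0"
    by (rule filterlim_compose[OF _ filterlim_real_sequentially])
  then have "(\<lambda>N. iterlog m 1 * (ln (real N + exp 1) / real N)) \<longlonglongrightarrow> iterlog m 1 * 0"
    by (rule tendsto_mult_left)
  then have lim: "(\<lambda>N. iterlog m 1 * ln (real N + exp 1) / real N) \<longlonglongrightarrow> 0" by simp
  have "iterlog n (real N) / real N \<le> iterlog m 1 * ln (real N + exp 1) / real N" for N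
    unfolding m by (intro divide_right_mono iterlog_le_ln) auto
  then show ?thesis
    by (intro tendsto_sandwich[OF _ _ tendsto_const lim]) (simp_all add: iterlog_nonneg)
qed

lemma measurable_iterlog [measurable]: "iterlog n \<in> borel_measurable borel"
proof (induction n)
  case (Suc n)
  have "iterlog (Suc n) = (\<lambda>t. iterlog n (ln (t + exp 1)))" by auto
  then show ?case using Suc by simp
qed (simp add: id_def[symmetric] fun_eq_iff)

section \<open>Visits of orbits to a slab and non-existence of integrable couplings\<close>

context Z_coupling
begin

text \<open>A \<open>\<Gamma>\<close>-invariant function, hence a function on the space of
  \<open>\<Gamma>\<close>-orbits, which \<open>Y\<close> represents and on which the integers still
  act through \<open>\<beta>\<close>. Its integral over \<open>Y\<close> is finite by
  \<open>integral_visits\<close>.\<close>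

definition visits :: "'o \<Rightarrow> ennreal" where
  "visits y = (\<integral>\<^sup>+g. indicator X (\<alpha> g y) \<partial>count_space (carrier \<Gamma>))"

definition slab_visits :: "nat \<Rightarrow> 'o \<Rightarrow> ennreal" where
  "slab_visits N y = (\<integral>\<^sup>+g. indicator (slab N) (\<alpha> g y) \<partial>count_space (carrier \<Gamma>))"

lemma measurable_orbit_integral:
  assumes "f \<in> borel_measurable M"
  shows "(\<lambda>y. \<integral>\<^sup>+g. f (\<alpha> g y) \<partial>count_space (carrier \<Gamma>)) \<in> borel_measurable M"
proof -
  interpret C: sigma_finite_measure "count_space (carrier \<Gamma>)"
    by (rule sigma_finite_measure_count_space_countable[OF countable_\<Gamma>])
  have "(\<lambda>(g, y). f (\<alpha> g y)) \<in> borel_measurable (count_space (carrier \<Gamma>) \<Otimes>\<^sub>M M)"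
    using assms measurable_\<alpha> countable_\<Gamma>
    by (intro measurable_pair_measure_countable1) auto
  from measurable_pair_swap[OF this]
  have "(\<lambda>(y, g). f (\<alpha> g y)) \<in> borel_measurable (M \<Otimes>\<^sub>M count_space (carrier \<Gamma>))" by simp
  then show ?thesis by (rule C.borel_measurable_nn_integral)
qed

lemma measurable_visits [measurable]: "visits \<in> borel_measurable M" "slab_visits N \<in> borel_measurable M"
  unfolding visits_def slab_visits_def by (intro measurable_orbit_integral; simp)+

lemma visits_invariant:
  assumes "g \<in> carrier \<Gamma>" "y \<in> space M" shows "visits (\<alpha> g y) = visits y"
proof -
  have "bij_betw (\<lambda>h. h \<otimes> g) (carrier \<Gamma>) (carrier \<Gamma>)"
    using assms(1) by (intro bij_betwI[of _ _ _ "\<lambda>h. h \<otimes> inv g"]) (auto simp: \<Gamma>.m_assoc)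
  then have "(\<integral>\<^sup>+h. indicator X (\<alpha> (h \<otimes> g) y) \<partial>count_space (carrier \<Gamma>)) = visits y"
    unfolding visits_def by (rule nn_integral_bij_count_space)
  moreover have "(\<integral>\<^sup>+h. indicator X (\<alpha> (h \<otimes> g) y) \<partial>count_space (carrier \<Gamma>)) = visits (\<alpha> g y)"
    unfolding visits_def using assms acts(1)
    by (intro nn_integral_cong) (auto simp: mp_free_action_def)
  ultimately show ?thesis by simp
qed

lemma integral_visits: "(\<integral>\<^sup>+y\<in>Y. visits y \<partial>M) = emeasure M X"
  using fundamental_domain_unfold[OF \<Gamma>.group_axioms countable_\<Gamma> acts(1) domains(1), of "indicator X"]
  by (simp add: visits_def)

lemma integral_slab_visits: "(\<integral>\<^sup>+y\<in>Y. slab_visits N y \<partial>M) = N * emeasure M X"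
  using fundamental_domain_unfold[OF \<Gamma>.group_axioms countable_\<Gamma> acts(1) domains(1), of "indicator (slab N)"]
  by (simp add: slab_visits_def emeasure_slab)

text \<open>The slab is a disjoint union of \<open>N\<close> translates of \<open>X\<close>, and
  \<open>\<beta>\<close> commutes with \<open>\<alpha>\<close>, so the count is a Birkhoff sum of
  \<open>visits\<close> for the action of the integers on \<open>\<Gamma>\<close>-orbits.\<close>

lemma slab_visits_eq:
  assumes y: "y \<in> space M"
  shows "slab_visits N y = (\<Sum>l<N. visits (\<beta> (int l) y))"
proof -
  have ind: "indicator (slab N) z = (\<Sum>l<N. indicator X (\<beta> (int l) z) :: ennreal)" if z: "z \<in> space M" for z
  proof (cases "z \<in> slab N")
    case True
    then have k: "nat (\<kappa> z) < N" "0 \<le> \<kappa> z" by (auto simp: slab_def)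
    have "indicator X (\<beta> (int l) z) = (if l = nat (\<kappa> z) then 1 else 0 :: ennreal)" for l
      using \<kappa>_iff[OF z, of "int l"] k(2) by (auto simp: indicator_def)
    then show ?thesis using True k by (simp add: sum.delta)
  next
    case False
    have "indicator X (\<beta> (int l) z) = (0 :: ennreal)" if "l < N" for l
      using \<kappa>_iff[OF z, of "int l"] False that z by (auto simp: indicator_def slab_def)
    then show ?thesis using False by simp
  qed
  have "slab_visits N y
      = (\<integral>\<^sup>+g. (\<Sum>l<N. indicator X (\<alpha> g (\<beta> (int l) y))) \<partial>count_space (carrier \<Gamma>))"
    unfolding slab_visits_def using y by (intro nn_integral_cong) (simp add: ind space_\<alpha> commute)
  also have "\<dots> = (\<Sum>l<N. visits (\<beta> (int l) y))"
    unfolding visits_def by (rule nn_integral_sum) simp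
  finally show ?thesis .
qed

text \<open>The image of \<open>Y\<close> under \<open>\<beta> l\<close> is another fundamental
  domain for \<open>\<Gamma>\<close>, so the integers preserve the measure on the space of
  \<open>\<Gamma>\<close>-orbits.\<close>

lemma integral_invariant_shift:
  assumes f: "f \<in> borel_measurable M" "\<And>g x. g \<in> carrier \<Gamma> \<Longrightarrow> x \<in> space M \<Longrightarrow> f (\<alpha> g x) = f x"
  shows "(\<integral>\<^sup>+y\<in>Y. f (\<beta> l y) \<partial>M) = (\<integral>\<^sup>+y\<in>Y. f y \<partial>M)"
proof -
  define Y' where "Y' = {y \<in> space M. \<beta> (-l) y \<in> Y}"
  have Y': "Y' \<in> sets M" unfolding Y'_def by measurable
  have "(\<integral>\<^sup>+y\<in>Y. f (\<beta> l y) \<partial>M) = (\<integral>\<^sup>+y. f (\<beta> l y) * indicator Y' (\<beta> l y) \<partial>M)"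
  proof (rule nn_integral_cong)
    fix y assume y: "y \<in> space M"
    then have "\<beta> (-l) (\<beta> l y) = y" using \<beta>_simps[of y] by (metis add.left_inverse)
    then have "\<beta> l y \<in> Y' \<longleftrightarrow> y \<in> Y" using y by (simp add: Y'_def space_\<beta>)
    then show "f (\<beta> l y) * indicator Y y = f (\<beta> l y) * indicator Y' (\<beta> l y)"
      by (simp add: indicator_def)
  qed
  also have "\<dots> = (\<integral>\<^sup>+y\<in>Y'. f y \<partial>M)"
    using f(1) Y' by (intro action_nn_integral[OF acts(2)]) auto
  also have "\<dots> = (\<integral>\<^sup>+y\<in>Y. f y \<partial>M)"
  proof -
    have "\<exists>!g. g \<in> carrier \<Gamma> \<and> \<alpha> g x \<in> Y'" if x: "x \<in> space M" for x
    proof -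
      have "\<exists>!g. g \<in> carrier \<Gamma> \<and> \<alpha> g (\<beta> (-l) x) \<in> Y"
        using domains(1) space_\<beta>[OF x] by (simp add: fundamental_domain_def)
      moreover have "g \<in> carrier \<Gamma> \<and> \<alpha> g (\<beta> (-l) x) \<in> Y \<longleftrightarrow> g \<in> carrier \<Gamma> \<and> \<alpha> g x \<in> Y'" for g
        using x by (auto simp: Y'_def commute space_\<alpha>)
      ultimately show ?thesis by (simp only:)
    qed
    then show ?thesis
      using invariant_nn_integral_fundamental_domain[of \<Gamma> M \<alpha> Y Y' f] \<Gamma>.group_axioms countable_\<Gamma>
        acts(1) domains(1) Y' f by blast
  qed
  finally show ?thesis .
qed

text \<open>The averages of the integrable function \<open>visits\<close> over the windows \<open>{..<N}\<close> are uniformly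
  integrable, so most of the slab lies in \<open>\<Gamma>\<close>-orbits that meet it at most \<open>O(N)\<close> times.\<close>

lemma slab_visits_bounded_part:
  obtains k :: nat where "k \<ge> 1"
    "\<And>N. N * emeasure M X \<le> 2 * (\<integral>\<^sup>+y\<in>Y. slab_visits N y * indicator {y. slab_visits N y \<le> of_nat (4 * k * N)} y \<partial>M)"
proof (cases "emeasure M X = 0")
  case True
  then show ?thesis using that[of 1] by simp
next
  case False
  let ?h = "\<lambda>k y. min (visits y) (of_nat k)"
  have h_mono: "?h i y * indicator Y y \<le> ?h j y * indicator Y y" if "i \<le> j" for i j y
    using that by (intro mult_right_mono min.mono) simp_all
  have "(SUP k. \<integral>\<^sup>+y\<in>Y. ?h k y \<partial>M) = (\<integral>\<^sup>+y. (SUP k. ?h k y * indicator Y y) \<partial>M)"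
    by (rule nn_integral_monotone_convergence_SUP[symmetric])
       (auto simp: incseq_def le_fun_def intro!: h_mono)
  also have "\<dots> = (\<integral>\<^sup>+y\<in>Y. visits y \<partial>M)"
  proof (rule nn_integral_cong)
    fix y
    have "(SUP k. ?h k y) = min (visits y) (SUP k. of_nat k)"
      by (simp add: inf_min[symmetric] inf_SUP)
    also have "\<dots> = visits y" by (simp add: ennreal_SUP_of_nat_eq_top)
    finally have "(SUP k. ?h k y) = visits y" .
    then show "(SUP k. ?h k y * indicator Y y) = visits y * indicator Y y"
      by (simp add: SUP_mult_right_ennreal[symmetric] indicator_def)
  qed
  also have "\<dots> = emeasure M X" by (rule integral_visits)
  finally have sup: "(SUP k. \<integral>\<^sup>+y\<in>Y. ?h k y \<partial>M) = emeasure M X" .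
  define x where "x = measure M X"
  have x: "emeasure M X = ennreal x" using finite_X by (simp add: x_def emeasure_eq_ennreal_measure)
  have xpos: "x > 0" using False x by (simp add: x_def zero_less_measure_iff)
  \<comment> \<open>Truncating \<open>visits\<close> at a suitable \<open>k\<close> keeps three
    quarters of its integral. A quarter is given up in \<open>pw\<close>; the remaining half is the
    factor 2 in the claim.\<close>
  then have "ennreal (3 / 4 * x) < (SUP k. \<integral>\<^sup>+y\<in>Y. ?h k y \<partial>M)"
    unfolding sup x by (subst ennreal_less_iff) auto
  then obtain k0 where k0: "ennreal (3 / 4 * x) < (\<integral>\<^sup>+y\<in>Y. ?h k0 y \<partial>M)"
    by (auto simp: less_SUP_iff)
  define k where "k = max k0 1"
  have "(\<integral>\<^sup>+y\<in>Y. ?h k0 y \<partial>M) \<le> (\<integral>\<^sup>+y\<in>Y. ?h k y \<partial>M)"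
    by (intro nn_integral_mono mult_right_mono min.mono) (auto simp: k_def)
  then have k: "ennreal (3 / 4 * x) \<le> (\<integral>\<^sup>+y\<in>Y. ?h k y \<partial>M)" using k0 by simp
  have k1: "k \<ge> 1" by (simp add: k_def)
  show ?thesis
  proof (rule that[OF k1])
    fix N :: nat
    let ?S = "slab_visits N" and ?T = "of_nat (4 * k * N) :: ennreal"
    let ?I = "\<integral>\<^sup>+y\<in>Y. ?S y * indicator {y. ?S y \<le> ?T} y \<partial>M"
    \<comment> \<open>Where there are more than \<open>4 * k * N\<close> visits, the truncated sum,
      at most \<open>k * N\<close>, is less than a quarter of them. The second summand on the right
      pays for these points.\<close>
    have pw: "(\<Sum>l<N. ?h k (\<beta> (int l) y)) \<le> ?S y * indicator {y. ?S y \<le> ?T} y + ennreal (1/4) * ?S y"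
      if y: "y \<in> space M" for y
    proof (cases "?S y \<le> ?T")
      case True
      have "(\<Sum>l<N. ?h k (\<beta> (int l) y)) \<le> ?S y"
        unfolding slab_visits_eq[OF y] by (intro sum_mono) simp
      then show ?thesis using True by (simp add: add_increasing2)
    next
      case False
      have "(\<Sum>l<N. ?h k (\<beta> (int l) y)) \<le> (\<Sum>l<N. of_nat k)" by (intro sum_mono) simp
      also have "\<dots> = ennreal (1/4) * ?T"
        by (simp add: ennreal_of_nat_eq_real_of_nat ennreal_mult'[symmetric])
      also have "\<dots> \<le> ennreal (1/4) * ?S y" using False by (intro mult_left_mono) auto
      finally show ?thesis by (simp add: add_increasing)
    qed
    have "(\<integral>\<^sup>+y\<in>Y. (\<Sum>l<N. ?h k (\<beta> (int l) y)) \<partial>M) = (\<Sum>l<N. \<integral>\<^sup>+y\<in>Y. ?h k (\<beta> (int l) y) \<partial>M)"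
      unfolding sum_distrib_right by (rule nn_integral_sum) measurable
    also have "\<dots> = (\<Sum>l<N. \<integral>\<^sup>+y\<in>Y. ?h k y \<partial>M)"
      by (intro sum.cong refl integral_invariant_shift) (auto simp: visits_invariant)
    finally have S1: "(\<integral>\<^sup>+y\<in>Y. (\<Sum>l<N. ?h k (\<beta> (int l) y)) \<partial>M) = N * (\<integral>\<^sup>+y\<in>Y. ?h k y \<partial>M)" by simp
    have "ennreal (N * (3 / 4 * x)) = N * ennreal (3 / 4 * x)"
      unfolding ennreal_of_nat_eq_real_of_nat by (rule ennreal_mult) (use xpos in auto)
    also have "\<dots> \<le> N * (\<integral>\<^sup>+y\<in>Y. ?h k y \<partial>M)" by (intro mult_left_mono k) simp
    also have "\<dots> = (\<integral>\<^sup>+y\<in>Y. (\<Sum>l<N. ?h k (\<beta> (int l) y)) \<partial>M)" by (rule S1[symmetric])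
    also have "\<dots> \<le> (\<integral>\<^sup>+y\<in>Y. (?S y * indicator {y. ?S y \<le> ?T} y + ennreal (1/4) * ?S y) \<partial>M)"
      by (intro nn_integral_mono mult_right_mono pw) auto
    also have "\<dots> = (\<integral>\<^sup>+y. (?S y * indicator {y. ?S y \<le> ?T} y * indicator Y y + ennreal (1/4) * (?S y * indicator Y y)) \<partial>M)"
      by (intro nn_integral_cong) (simp add: distrib_right mult.assoc)
    also have "\<dots> = ?I + ennreal (1/4) * (\<integral>\<^sup>+y\<in>Y. ?S y \<partial>M)"
    proof -
      have [measurable]: "Measurable.pred M (\<lambda>y. ?S y \<le> ?T)" by measurable
      have "(\<lambda>y. indicator {y. ?S y \<le> ?T} y :: ennreal) \<in> borel_measurable M" by measurable
      then show ?thesis by (subst nn_integral_add) (simp_all add: nn_integral_cmult)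
    qed
    also have "ennreal (1/4) * (\<integral>\<^sup>+y\<in>Y. ?S y \<partial>M) = ennreal (N * (1 / 4 * x))"
      unfolding integral_slab_visits x ennreal_of_nat_eq_real_of_nat
      using xpos by (simp add: ennreal_mult'[symmetric] mult_ac)
    finally have le: "ennreal (N * (3 / 4 * x)) \<le> ?I + ennreal (N * (1 / 4 * x))" .
    show "N * emeasure M X \<le> 2 * ?I"
    proof (cases ?I)
      case top
      then show ?thesis by simp
    next
      case (real i)
      note i = real(2,1)
      have "ennreal (N * (3 / 4 * x)) \<le> ennreal (i + N * (1 / 4 * x))"
        using le xpos i by (simp add: ennreal_plus)
      then have "N * (3 / 4 * x) \<le> i + N * (1 / 4 * x)"
        using xpos i by (subst (asm) ennreal_le_iff) auto
      then have "N * x \<le> 2 * i" by (simp add: algebra_simps)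
      then have "ennreal (N * x) \<le> ennreal (2 * i)" by (rule ennreal_leI)
      then show ?thesis
        using i xpos by (simp add: x ennreal_mult' ennreal_of_nat_eq_real_of_nat)
    qed
  qed
qed

text \<open>For \<open>y\<close> with at most \<open>T\<close> visits, the return set of
  \<open>y\<close> to the slab is a finite subset of \<open>\<Gamma>\<close> of size at most
  \<open>T\<close>, and its \<open>left_exit\<close> counts the orbit points of \<open>y\<close> in
  \<open>D s\<close>. Integrating over \<open>Y\<close> turns these counts into the measures of the
  sets \<open>D s\<close>.\<close>

lemma slab_isoperimetry:
  fixes L :: "real \<Rightarrow> real"
  assumes S: "finite S" "S \<subseteq> carrier \<Gamma>" and L: "mono_on {0..} L" "\<And>t. t \<ge> 0 \<Longrightarrow> L t \<ge> 0"
    and isop: "\<And>A. finite A \<Longrightarrow> A \<noteq> {} \<Longrightarrow> A \<subseteq> carrier \<Gamma> \<Longrightarrow>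
      real (card A) \<le> L (card A) * (\<Sum>s\<in>S. real (card (left_exit \<Gamma> s A)))"
  shows "(\<integral>\<^sup>+y\<in>Y. slab_visits N y * indicator {y. slab_visits N y \<le> of_nat T} y \<partial>M)
    \<le> ennreal (L T) * (\<Sum>s\<in>S. \<integral>\<^sup>+x\<in>X. ennreal (min (cocycle_length s x) N) \<partial>M)"
proof -
  define D where "D s = {x \<in> slab N. \<alpha> s x \<notin> slab N}" for s
  have D: "D s \<in> sets M" if "s \<in> S" for s
  proof -
    have [measurable]: "\<alpha> s \<in> M \<rightarrow>\<^sub>M M" using that S(2) by (intro measurable_\<alpha>) auto
    have "D s = {x \<in> space M. x \<in> slab N \<and> \<alpha> s x \<notin> slab N}" by (auto simp: D_def slab_def)
    also have "\<dots> \<in> sets M" by measurable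
    finally show ?thesis .
  qed
  define e where "e s y = (\<integral>\<^sup>+g. indicator (D s) (\<alpha> g y) \<partial>count_space (carrier \<Gamma>))" for s y
  have e: "e s \<in> borel_measurable M" if "s \<in> S" for s
    unfolding e_def using D[OF that] by (intro measurable_orbit_integral) simp
  have pw: "slab_visits N y * indicator {y. slab_visits N y \<le> of_nat T} y \<le> ennreal (L T) * (\<Sum>s\<in>S. e s y)"
    if y: "y \<in> space M" for y
  proof (cases "slab_visits N y \<le> of_nat T")
    case True
    define A where "A = {g \<in> carrier \<Gamma>. \<alpha> g y \<in> slab N}"
    have "slab_visits N y = (\<integral>\<^sup>+g. indicator A g \<partial>count_space (carrier \<Gamma>))"
      unfolding slab_visits_def by (intro nn_integral_cong) (auto simp: A_def indicator_def)
    also have "\<dots> = emeasure (count_space (carrier \<Gamma>)) A" by (rule nn_integral_indicator) (auto simp: A_def)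
    finally have sA: "slab_visits N y = emeasure (count_space (carrier \<Gamma>)) A" .
    have finA: "finite A"
      using True unfolding sA by (auto simp: emeasure_count_space A_def top_unique split: if_splits)
    have sA': "slab_visits N y = ennreal (card A)"
      unfolding sA using finA by (subst emeasure_count_space) (auto simp: A_def ennreal_of_nat_eq_real_of_nat)
    have AT: "real (card A) \<le> real T"
      using True unfolding sA' ennreal_of_nat_eq_real_of_nat by (subst (asm) ennreal_le_iff) auto
    have es: "e s y = ennreal (card (left_exit \<Gamma> s A))" if s: "s \<in> S" for s
    proof -
      have sc: "s \<in> carrier \<Gamma>" using s S(2) by auto
      have mult: "\<alpha> (s \<otimes> g) y = \<alpha> s (\<alpha> g y)" if "g \<in> carrier \<Gamma>" for g
        using acts(1) sc that y by (simp add: mp_free_action_def)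
      have "e s y = (\<integral>\<^sup>+g. indicator (left_exit \<Gamma> s A) g \<partial>count_space (carrier \<Gamma>))"
        unfolding e_def using sc mult
        by (intro nn_integral_cong) (auto simp: A_def D_def indicator_def)
      also have "\<dots> = emeasure (count_space (carrier \<Gamma>)) (left_exit \<Gamma> s A)"
        by (rule nn_integral_indicator) (auto simp: A_def)
      also have "\<dots> = ennreal (card (left_exit \<Gamma> s A))"
      proof -
        have "finite (left_exit \<Gamma> s A)" using finA by simp
        moreover have "left_exit \<Gamma> s A \<subseteq> carrier \<Gamma>" by (auto simp: A_def)
        ultimately show ?thesis by (simp add: emeasure_count_space ennreal_of_nat_eq_real_of_nat)
      qed
      finally show ?thesis .
    qed
    have "real (card A) \<le> L T * (\<Sum>s\<in>S. real (card (left_exit \<Gamma> s A)))"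
    proof (cases "A = {}")
      case True
      then show ?thesis using L(2) by (simp add: sum_nonneg)
    next
      case False
      have "real (card A) \<le> L (card A) * (\<Sum>s\<in>S. real (card (left_exit \<Gamma> s A)))"
        by (rule isop[OF finA False]) (auto simp: A_def)
      also have "\<dots> \<le> L T * (\<Sum>s\<in>S. real (card (left_exit \<Gamma> s A)))"
        using AT by (intro mult_right_mono sum_nonneg mono_onD[OF L(1)]) auto
      finally show ?thesis .
    qed
    then have "ennreal (card A) \<le> ennreal (L T * (\<Sum>s\<in>S. real (card (left_exit \<Gamma> s A))))"
      by (rule ennreal_leI)
    also have "\<dots> = ennreal (L T) * (\<Sum>s\<in>S. e s y)"
      using L(2)[of T] by (simp add: ennreal_mult sum_nonneg es sum_ennreal)
    finally show ?thesis using True by (simp add: sA')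
  qed simp
  have "(\<integral>\<^sup>+y\<in>Y. slab_visits N y * indicator {y. slab_visits N y \<le> of_nat T} y \<partial>M)
      \<le> (\<integral>\<^sup>+y. ennreal (L T) * (\<Sum>s\<in>S. e s y * indicator Y y) \<partial>M)"
  proof (rule nn_integral_mono)
    fix y assume "y \<in> space M"
    from mult_right_mono[OF pw[OF this], of "indicator Y y"]
    show "slab_visits N y * indicator {y. slab_visits N y \<le> of_nat T} y * indicator Y y
        \<le> ennreal (L T) * (\<Sum>s\<in>S. e s y * indicator Y y)"
      by (simp add: mult.assoc sum_distrib_right)
  qed
  also have "\<dots> = ennreal (L T) * (\<Sum>s\<in>S. \<integral>\<^sup>+y\<in>Y. e s y \<partial>M)"
    using e by (simp add: nn_integral_cmult nn_integral_sum)
  also have "\<dots> = ennreal (L T) * (\<Sum>s\<in>S. emeasure M (D s))"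
  proof -
    have "(\<integral>\<^sup>+y\<in>Y. e s y \<partial>M) = emeasure M (D s)" if "s \<in> S" for s
      using fundamental_domain_unfold[OF \<Gamma>.group_axioms countable_\<Gamma> acts(1) domains(1), of "indicator (D s)"]
        D[OF that] by (simp add: e_def)
    then show ?thesis by simp
  qed
  also have "\<dots> \<le> ennreal (L T) * (\<Sum>s\<in>S. \<integral>\<^sup>+x\<in>X. ennreal (min (cocycle_length s x) N) \<partial>M)"
    unfolding D_def using S(2) by (intro mult_left_mono sum_mono emeasure_slab_boundary) auto
  finally show ?thesis .
qed

lemma emeasure_X_pos: "emeasure M X \<noteq> 0"
proof
  assume 0: "emeasure M X = 0"
  have "emeasure M (space M) = (\<integral>\<^sup>+x. indicator (space M) x \<partial>M)" by simp
  also have "\<dots> = (\<integral>\<^sup>+x\<in>X. (\<integral>\<^sup>+l. indicator (space M) (\<beta> l x) \<partial>count_space UNIV) \<partial>M)"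
    using fundamental_domain_unfold[OF _ _ acts(2) domains(2), of "indicator (space M)"] by simp
  also have "\<dots> = 0"
  proof -
    have "AE x in M. x \<notin> X" using 0 by (intro AE_not_in) (simp add: null_sets_def)
    then have "(\<integral>\<^sup>+x\<in>X. (\<integral>\<^sup>+l. indicator (space M) (\<beta> l x) \<partial>count_space UNIV) \<partial>M) = (\<integral>\<^sup>+x. 0 \<partial>M)"
      by (intro nn_integral_cong_AE) (auto elim!: eventually_mono)
    then show ?thesis by simp
  qed
  finally show False using coupling by (simp add: ME_coupling_def)
qed

text \<open>The dominating function is \<open>iterlog n\<close> of the cocycle length
  \<open>c\<close>: for \<open>c \<le> N\<close> because \<open>iterlog n t / t\<close> is
  non-increasing, for \<open>c > N\<close> by monotonicity. The pointwise limit is 0 because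
  \<open>n \<ge> 1\<close> makes \<open>iterlog n\<close> sublinear.\<close>

lemma truncated_cocycle_tendsto_0:
  assumes n: "n \<ge> 1" and s: "s \<in> carrier \<Gamma>"
    and int: "(\<integral>\<^sup>+x\<in>X. ennreal (iterlog n (cocycle_length s x)) \<partial>M) < \<infinity>"
  shows "(\<lambda>N. \<integral>\<^sup>+x\<in>X. ennreal (iterlog n (real N) / real N * min (cocycle_length s x) N) \<partial>M)
    \<longlonglongrightarrow> 0"
proof -
  have [measurable]: "\<alpha> s \<in> M \<rightarrow>\<^sub>M M" by (rule measurable_\<alpha>[OF s])
  define c where "c x = cocycle_length s x" for x
  have [measurable]: "c \<in> borel_measurable M" unfolding c_def by measurable
  have c0: "c x \<ge> 0" for x by (simp add: c_def)
  have bound: "iterlog n (real N) / real N * min (c x) N \<le> iterlog n (c x)" for N x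
  proof (cases "N = 0 \<or> c x = 0")
    case True
    then show ?thesis using iterlog_nonneg[OF c0[of x], of n] by auto
  next
    case False
    then have N: "N > 0" and c1: "c x > 0" using c0[of x] by auto
    show ?thesis
    proof (cases "c x \<le> N")
      case True
      have "iterlog n (real N) = iterlog n (N / c x * c x)" using c1 by simp
      also have "\<dots> \<le> N / c x * iterlog n (c x)"
        using c1 True by (intro iterlog_mult) auto
      finally have "iterlog n (real N) * c x \<le> N * iterlog n (c x)"
        using c1 by (simp add: field_simps)
      then show ?thesis using True N by (simp add: field_simps)
    next
      case False
      then have "iterlog n (real N) \<le> iterlog n (c x)" by (intro iterlog_mono) auto
      then show ?thesis using False N by simp
    qed
  qed
  have "(\<lambda>N. \<integral>\<^sup>+x. ennreal (iterlog n (real N) / real N * min (c x) N) * indicator X x \<partial>M) \<longlonglongrightarrow> (\<integral>\<^sup>+x. 0 \<partial>M)"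
  proof (rule nn_integral_dominated_convergence[where w = "\<lambda>x. ennreal (iterlog n (c x)) * indicator X x"])
    show "AE x in M. ennreal (iterlog n (real N) / real N * min (c x) N) * indicator X x
        \<le> ennreal (iterlog n (c x)) * indicator X x" for N
      by (intro AE_I2 mult_right_mono ennreal_leI bound) simp
    show "(\<integral>\<^sup>+x\<in>X. ennreal (iterlog n (c x)) \<partial>M) < \<infinity>" using int by (simp add: c_def)
    show "AE x in M. (\<lambda>N. ennreal (iterlog n (real N) / real N * min (c x) N) * indicator X x) \<longlonglongrightarrow> 0"
    proof (rule AE_I2)
      fix x
      have lim: "(\<lambda>N. iterlog n (real N) / real N * c x) \<longlonglongrightarrow> 0"
        by (rule tendsto_mult_left_zero[OF iterlog_ratio_tendsto_0[OF n]])
      have "(\<lambda>N. iterlog n (real N) / real N * min (c x) N) \<longlonglongrightarrow> 0"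
      proof (rule tendsto_sandwich[OF _ _ tendsto_const lim])
        show "\<forall>\<^sub>F N in sequentially. 0 \<le> iterlog n (real N) / real N * min (c x) N"
          using c0 by (intro always_eventually allI mult_nonneg_nonneg) (auto simp: iterlog_nonneg)
        show "\<forall>\<^sub>F N in sequentially. iterlog n (real N) / real N * min (c x) N \<le> iterlog n (real N) / real N * c x"
          by (intro always_eventually allI mult_left_mono) (auto simp: iterlog_nonneg)
      qed
      then have "(\<lambda>N. ennreal (iterlog n (real N) / real N * min (c x) N)) \<longlonglongrightarrow> 0"
        using tendsto_ennrealI by fastforce
      then show "(\<lambda>N. ennreal (iterlog n (real N) / real N * min (c x) N) * indicator X x) \<longlonglongrightarrow> 0"
        by (cases "x \<in> X") simp_all
    qed
  qed measurable
  then show ?thesis by (simp add: c_def)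
qed

theorem no_iterlog_integrable_coupling:
  assumes n: "n \<ge> 1" and isop: "isop_log n \<Gamma>"
    and int: "\<And>s. s \<in> carrier \<Gamma> \<Longrightarrow> (\<integral>\<^sup>+x\<in>X. ennreal (iterlog n (cocycle_length s x)) \<partial>M) < \<infinity>"
  shows False
proof -
  obtain S C where SC: "finite S \<and> S \<subseteq> carrier \<Gamma> \<and> C > 0 \<and>
     (\<forall>A. finite A \<and> A \<noteq> {} \<and> A \<subseteq> carrier \<Gamma> \<longrightarrow>
        real (card A) \<le> C * iterlog n (card A) * (\<Sum>s\<in>S. real (card (left_exit \<Gamma> s A))))"
    using isop unfolding isop_log_def by (elim exE) (rule that)
  then have S: "finite S" "S \<subseteq> carrier \<Gamma>" and C: "C > 0" by simp_all
  have isop': "real (card A) \<le> C * iterlog n (card A) * (\<Sum>s\<in>S. real (card (left_exit \<Gamma> s A)))"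
    if "finite A" "A \<noteq> {}" "A \<subseteq> carrier \<Gamma>" for A using SC that by simp
  obtain k where k: "k \<ge> 1" and large: "\<And>N. N * emeasure M X
      \<le> 2 * (\<integral>\<^sup>+y\<in>Y. slab_visits N y * indicator {y. slab_visits N y \<le> of_nat (4 * k * N)} y \<partial>M)"
    using slab_visits_bounded_part by blast
  define I where "I s N = (\<integral>\<^sup>+x\<in>X. ennreal (iterlog n (real N) / real N * min (cocycle_length s x) N) \<partial>M)" for s N
  \<comment> \<open>The 8 is the factor 2 of \<open>slab_visits_bounded_part\<close> times the 4 of
    its threshold \<open>4 * k * N\<close>, moved out of \<open>iterlog\<close> together with
    \<open>k\<close>.\<close>
  have le: "emeasure M X \<le> ennreal (8 * k * C) * (\<Sum>s\<in>S. I s N)" if N: "N \<ge> 1" for N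
  proof -
    let ?J = "\<lambda>s. \<integral>\<^sup>+x\<in>X. ennreal (min (cocycle_length s x) N) \<partial>M"
    have "C * iterlog n (4 * k * N) \<le> C * (4 * k * iterlog n N)"
      using C k iterlog_mult[of "4 * k" N n] by (intro mult_left_mono) auto
    then have r: "ennreal (C * iterlog n (4 * k * N)) \<le> ennreal (4 * k * C * iterlog n N)"
      by (intro ennreal_leI) (simp add: mult_ac)
    have "of_nat N * emeasure M X \<le> 2 * (\<integral>\<^sup>+y\<in>Y. slab_visits N y * indicator {y. slab_visits N y \<le> of_nat (4 * k * N)} y \<partial>M)"
      by (rule large)
    also have "\<dots> \<le> 2 * (ennreal (C * iterlog n (4 * k * N)) * (\<Sum>s\<in>S. ?J s))"
      using slab_isoperimetry[OF S, of "\<lambda>t. C * iterlog n t" N "4 * k * N"] isop' C iterlog_nonneg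
      by (intro mult_left_mono) (auto simp: mono_on_def intro!: iterlog_mono)
    also have "\<dots> \<le> 2 * (ennreal (4 * k * C * iterlog n N) * (\<Sum>s\<in>S. ?J s))"
      using r by (intro mult_left_mono mult_right_mono) auto
    also have "\<dots> = of_nat N * (ennreal (8 * k * C) * (\<Sum>s\<in>S. I s N))"
    proof -
      have IJ: "I s N = ennreal (iterlog n N / N) * ?J s" if "s \<in> S" for s
      proof -
        have [measurable]: "\<alpha> s \<in> M \<rightarrow>\<^sub>M M" using S(2) that by (intro measurable_\<alpha>) auto
        have "ennreal (iterlog n N / N * min (cocycle_length s x) N) * indicator X x
            = ennreal (iterlog n N / N) * (ennreal (min (cocycle_length s x) N) * indicator X x)" for x
          by (subst ennreal_mult) (simp_all add: iterlog_nonneg mult.assoc)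
        then show ?thesis unfolding I_def by (simp add: nn_integral_cmult)
      qed
      have "2 * ennreal (4 * k * C * iterlog n N) = ennreal 2 * ennreal (4 * k * C * iterlog n N)" by simp
      also have "\<dots> = ennreal (2 * (4 * k * C * iterlog n N))"
        by (rule ennreal_mult[symmetric]) (use C in \<open>auto simp: iterlog_nonneg\<close>)
      also have "\<dots> = ennreal ((real N * (8 * k * C)) * (iterlog n N / N))"
        using N by simp
      also have "\<dots> = ennreal (real N * (8 * k * C)) * ennreal (iterlog n N / N)"
        by (rule ennreal_mult) (use C in \<open>auto simp: iterlog_nonneg\<close>)
      also have "ennreal (real N * (8 * k * C)) = of_nat N * ennreal (8 * k * C)"
        unfolding ennreal_of_nat_eq_real_of_nat by (rule ennreal_mult) (use C in auto)
      finally have const: "2 * ennreal (4 * k * C * iterlog n N)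
        = of_nat N * ennreal (8 * k * C) * ennreal (iterlog n N / N)" .
      have "2 * (ennreal (4 * k * C * iterlog n N) * (\<Sum>s\<in>S. ?J s))
        = (2 * ennreal (4 * k * C * iterlog n N)) * (\<Sum>s\<in>S. ?J s)" by (simp only: mult.assoc)
      also have "\<dots> = of_nat N * (ennreal (8 * k * C) * (\<Sum>s\<in>S. ennreal (iterlog n N / N) * ?J s))"
        unfolding const sum_distrib_left[symmetric] by (simp only: mult.assoc)
      finally show ?thesis using IJ by simp
    qed
    finally show ?thesis
      using N by (subst (asm) ennreal_mult_le_mult_iff) auto
  qed
  have "(\<lambda>N. ennreal (8 * k * C) * (\<Sum>s\<in>S. I s N)) \<longlonglongrightarrow> ennreal (8 * k * C) * (\<Sum>s\<in>S. 0)"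
    unfolding I_def using S(2) int n
    by (intro ennreal_tendsto_cmult tendsto_sum truncated_cocycle_tendsto_0) auto
  then have "emeasure M X \<le> ennreal (8 * k * C) * (\<Sum>s\<in>S. 0)"
  proof (rule tendsto_lowerbound)
    show "\<forall>\<^sub>F N in sequentially. emeasure M X \<le> ennreal (8 * k * C) * (\<Sum>s\<in>S. I s N)"
      by (rule eventually_sequentiallyI[of 1]) (rule le)
  qed simp
  then show False using emeasure_X_pos by simp
qed

end

section \<open>Comparison of \<open>iterlog\<close> with iterated logarithms, and the exponents
  excluded by it\<close>

lemma filterlim_iterated_ln: "filterlim ((ln :: real \<Rightarrow> real) ^^ n) at_top at_top"
proof (induction n)
  case (Suc n)
  then show ?case using filterlim_compose[OF ln_at_top Suc] by (simp add: comp_def)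
qed (simp add: filterlim_ident id_def)

lemma iterlog_ge_ln: "\<forall>\<^sub>F t in at_top. (ln ^^ n) t \<le> iterlog n t"
proof (induction n)
  case (Suc n)
  have "\<forall>\<^sub>F t in at_top. (ln ^^ n) (ln t) \<le> iterlog n (ln t)"
    using Suc ln_at_top by (rule eventually_compose_filterlim)
  then show ?case using eventually_ge_at_top[of 1]
  proof eventually_elim
    case (elim t)
    have "ln t \<le> ln (t + exp 1)" using elim(2) by (subst ln_le_cancel_iff) (auto intro: add_nonneg_pos)
    then have "iterlog n (ln t) \<le> iterlog n (ln (t + exp 1))" using elim by (intro iterlog_mono) auto
    then show ?case using elim by (simp add: funpow_swap1)
  qed
qed simp

text \<open>For \<open>t \<ge> 3\<close> the shifted argument satisfies
  \<open>t + exp 1 \<le> t * t\<close>, so removing one shift costs a factor 2 inside the remaining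
  iterations, and \<open>iterlog_mult\<close> moves it out.\<close>

lemma iterlog_le_iterated_ln:
  obtains D where "D > 0" "\<forall>\<^sub>F t in at_top. iterlog n t \<le> D * (ln ^^ n) t"
proof -
  have "\<forall>\<^sub>F t in at_top. iterlog n t \<le> 2 ^ n * (ln ^^ n) t"
  proof (induction n)
    case (Suc n)
    have "\<forall>\<^sub>F t in at_top. iterlog n (ln t) \<le> 2 ^ n * (ln ^^ n) (ln t)"
      using Suc ln_at_top by (rule eventually_compose_filterlim)
    then show ?case using eventually_ge_at_top[of 3]
    proof eventually_elim
      case (elim t)
      have "t + exp 1 \<le> t * t"
        using elim(2) exp_le mult_right_mono[of 3 t t] by linarith
      then have "ln (t + exp 1) \<le> ln (t * t)"
        using elim(2) by (subst ln_le_cancel_iff) (auto intro: add_nonneg_pos)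
      also have "\<dots> = 2 * ln t" using elim(2) by (simp add: ln_mult)
      finally have "iterlog n (ln (t + exp 1)) \<le> iterlog n (2 * ln t)"
        using ln_add_e_ge_1[of t] elim(2) by (intro iterlog_mono) auto
      also have "\<dots> \<le> 2 * iterlog n (ln t)" using elim(2) by (intro iterlog_mult) auto
      also have "\<dots> \<le> 2 * (2 ^ n * (ln ^^ n) (ln t))" using elim(1) by simp
      finally show ?case by (simp add: funpow_swap1)
    qed
  qed simp
  then show ?thesis using that[of "2 ^ n"] by simp
qed

lemma nat_abs_le_word_length:
  assumes "set ws \<subseteq> {1} \<union> m_inv integer_group ` {1}"
  shows "\<bar>foldr (\<otimes>\<^bsub>integer_group\<^esub>) ws \<one>\<^bsub>integer_group\<^esub>\<bar> \<le> int (length ws)"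
  using assms
proof (induction ws)
  case (Cons w ws)
  then have "\<bar>w\<bar> = 1" by (auto simp: inv_integer_group)
  then show ?case using Cons by simp
qed simp

lemma word_length_integer_group: "word_length integer_group {1} l = nat \<bar>l\<bar>"
  unfolding word_length_def
proof (rule Least_equality)
  define w where "w = replicate (nat \<bar>l\<bar>) (sgn l)"
  have "foldr (\<otimes>\<^bsub>integer_group\<^esub>) (replicate m x) \<one>\<^bsub>integer_group\<^esub> = int m * x" for m x
    by (induction m) (auto simp: algebra_simps)
  then have "foldr (\<otimes>\<^bsub>integer_group\<^esub>) w \<one>\<^bsub>integer_group\<^esub> = l"
    by (simp add: w_def abs_mult_sgn)
  moreover have "set w \<subseteq> {1} \<union> m_inv integer_group ` {1}"
    by (auto simp: w_def sgn_if inv_integer_group)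
  ultimately show "\<exists>ws. length ws = nat \<bar>l\<bar> \<and> set ws \<subseteq> {1} \<union> m_inv integer_group ` {1} \<and>
      foldr (\<otimes>\<^bsub>integer_group\<^esub>) ws \<one>\<^bsub>integer_group\<^esub> = l"
    by (intro exI[of _ w]) (simp add: w_def)
next
  fix m assume "\<exists>ws. length ws = m \<and> set ws \<subseteq> {1} \<union> m_inv integer_group ` {1} \<and>
      foldr (\<otimes>\<^bsub>integer_group\<^esub>) ws \<one>\<^bsub>integer_group\<^esub> = l"
  then show "nat \<bar>l\<bar> \<le> m" using nat_abs_le_word_length by fastforce
qed

text \<open>If \<open>p \<ge> 1\<close>, then \<open>iterlog n\<close> is at most a constant plus a
  multiple of \<open>\<phi>\<close>. The constant is integrable since \<open>X\<close> has finite
  measure, so the cocycle would be \<open>iterlog n\<close>-integrable.\<close>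

theorem coupling_exponent_less_1:
  fixes F :: "('f, 'b) monoid_scheme" and \<phi> :: "real \<Rightarrow> real" and M :: "'o measure"
  assumes F: "group F" "finite (carrier F)" "card (carrier F) \<noteq> 1" and n: "n \<ge> 1"
    and \<phi>: "\<forall>t\<ge>0. \<phi> t \<ge> 0" "\<exists>T. \<forall>t\<ge>T. \<phi> t = ((ln ^^ n) t) powr p"
    and cpl: "phi_L0_coupling \<phi> (Hgrp F 1 n) integer_group {1} M \<alpha> \<beta> Y X"
  shows "p < 1"
proof (rule ccontr)
  assume "\<not> p < 1"
  let ?\<Gamma> = "Hgrp F 1 n"
  interpret \<Gamma>: group ?\<Gamma> by (rule group_Hgrp[OF F(1)])
  interpret Z_coupling ?\<Gamma> M \<alpha> \<beta> Y X
    using cpl countable_Hgrp[OF F(1,2)] by unfold_locales (auto simp: phi_L0_coupling_def)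
  obtain D where D: "D > 0" "\<forall>\<^sub>F t in at_top. iterlog n t \<le> D * (ln ^^ n) t"
    by (rule iterlog_le_iterated_ln)
  have "\<forall>\<^sub>F t in at_top. (ln ^^ n) t \<ge> (1 :: real)"
    using filterlim_iterated_ln[of n] by (simp add: filterlim_at_top)
  moreover have "\<forall>\<^sub>F t in at_top. \<phi> t = ((ln ^^ n) t) powr p"
    using \<phi>(2) by (auto simp: eventually_at_top_linorder)
  ultimately have "\<forall>\<^sub>F t in at_top. iterlog n t \<le> D * \<phi> t"
    using D(2)
  proof eventually_elim
    case (elim t)
    have "(ln ^^ n) t \<le> ((ln ^^ n) t) powr p"
      using elim(1) \<open>\<not> p < 1\<close> powr_mono[of 1 p "(ln ^^ n) t"] by simp
    then have "D * (ln ^^ n) t \<le> D * \<phi> t" using elim(2) D(1) by simp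
    then show ?case using elim(3) by simp
  qed
  then obtain T where T: "\<And>t. t \<ge> T \<Longrightarrow> iterlog n t \<le> D * \<phi> t"
    by (auto simp: eventually_at_top_linorder)
  define T1 where "T1 = max T 0"
  have le: "iterlog n t \<le> iterlog n T1 + D * \<phi> t" if "t \<ge> 0" for t
  proof (cases "t \<ge> T1")
    case True
    then show ?thesis using T[of t] iterlog_nonneg[of T1 n] by (simp add: T1_def)
  next
    case False
    then have "iterlog n t \<le> iterlog n T1" using that by (intro iterlog_mono) auto
    then show ?thesis using \<phi>(1) that D(1) by (simp add: add_increasing2)
  qed
  show False
  proof (rule no_iterlog_integrable_coupling[OF n isop_log_Hgrp[OF F(1,3)]])
    fix s assume s: "s \<in> carrier ?\<Gamma>"
    obtain c where c: "c > 0" and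
      fin: "(\<integral>\<^sup>+x\<in>X. ennreal (\<phi> (real (word_length integer_group {1} (\<kappa> (\<alpha> s x))) / c)) \<partial>M) < \<infinity>"
      using cpl s unfolding phi_L0_coupling_def phi_integrable_cocycle_def by blast
    \<comment> \<open>\<open>iterlog_mult\<close> requires a factor at least 1; it undoes the
      rescaling by \<open>c\<close> in the definition of integrability.\<close>
    define c1 where "c1 = max c 1"
    have pw: "iterlog n \<bar>real_of_int l\<bar> \<le> c1 * iterlog n T1
        + c1 * D * \<phi> (real (word_length integer_group {1} l) / c)" for l
    proof -
      let ?t = "real (word_length integer_group {1} l) / c"
      have t: "\<bar>real_of_int l\<bar> = c * ?t" "?t \<ge> 0" using c by (simp_all add: word_length_integer_group)
      have "iterlog n \<bar>real_of_int l\<bar> \<le> iterlog n (c1 * ?t)"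
      proof (rule iterlog_mono)
        show "\<bar>real_of_int l\<bar> \<le> c1 * ?t"
          unfolding t(1) by (rule mult_right_mono) (use t(2) in \<open>auto simp: c1_def\<close>)
      qed simp
      also have "\<dots> \<le> c1 * iterlog n ?t" using t(2) by (intro iterlog_mult) (auto simp: c1_def)
      also have "\<dots> \<le> c1 * (iterlog n T1 + D * \<phi> ?t)"
        using le[OF t(2)] by (intro mult_left_mono) (auto simp: c1_def)
      finally show ?thesis by (simp add: algebra_simps)
    qed
    show "(\<integral>\<^sup>+x\<in>X. ennreal (iterlog n (cocycle_length s x)) \<partial>M) < \<infinity>"
    proof -
      let ?\<psi> = "\<lambda>l. ennreal (\<phi> (real (word_length integer_group {1} l) / c))"
      have m: "(\<lambda>x. ?\<psi> (\<kappa> (\<alpha> s x)) * indicator X x) \<in> borel_measurable M"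
        using measurable_compose[OF measurable_compose[OF measurable_\<alpha>[OF s] measurable_\<kappa>], of ?\<psi> borel]
        by simp
      have c1: "c1 \<ge> 0" and L1: "iterlog n T1 \<ge> 0" by (auto simp: c1_def T1_def iterlog_nonneg)
      have "(\<integral>\<^sup>+x\<in>X. ennreal (iterlog n (cocycle_length s x)) \<partial>M)
          \<le> (\<integral>\<^sup>+x. ennreal (c1 * iterlog n T1) * indicator X x
            + ennreal (c1 * D) * (?\<psi> (\<kappa> (\<alpha> s x)) * indicator X x) \<partial>M)"
      proof (rule nn_integral_mono)
        fix x
        have "ennreal (iterlog n (cocycle_length s x))
            \<le> ennreal (c1 * iterlog n T1 + c1 * D * \<phi> (real (word_length integer_group {1} (\<kappa> (\<alpha> s x))) / c))"
          by (rule ennreal_leI[OF pw])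
        also have "\<dots> = ennreal (c1 * iterlog n T1) + ennreal (c1 * D) * ?\<psi> (\<kappa> (\<alpha> s x))"
          using c1 L1 D(1) c \<phi>(1) by (subst ennreal_plus) (auto simp: ennreal_mult)
        finally show "ennreal (iterlog n (cocycle_length s x)) * indicator X x
          \<le> ennreal (c1 * iterlog n T1) * indicator X x
            + ennreal (c1 * D) * (?\<psi> (\<kappa> (\<alpha> s x)) * indicator X x)"
          by (cases "x \<in> X") simp_all
      qed
      also have "\<dots> = ennreal (c1 * iterlog n T1) * emeasure M X
          + ennreal (c1 * D) * (\<integral>\<^sup>+x\<in>X. ?\<psi> (\<kappa> (\<alpha> s x)) \<partial>M)"
        using m by (subst nn_integral_add) (simp_all add: nn_integral_cmult nn_integral_cmult_indicator)
      also have "\<dots> < \<infinity>"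
        using fin finite_X by (simp add: ennreal_mult_less_top)
      finally show ?thesis .
    qed
  qed
qed

section \<open>Couplings from compatible tilings\<close>

definition set_enum :: "'a set \<Rightarrow> int \<Rightarrow> 'a" where
  "set_enum A = (SOME h. bij_betw h {0..<int (card A)} A)"

lemma bij_set_enum: "finite A \<Longrightarrow> bij_betw (set_enum A) {0..<int (card A)} A"
  using someI_ex[of "\<lambda>h. bij_betw h {0..<int (card A)} A"]
    finite_same_card_bij[of "{0..<int (card A)}" A] by (auto simp: set_enum_def)

lemma int_div_less:
  assumes "0 < (q :: int)" "x < q * n" shows "x div q < n"
proof -
  have "q * (x div q) \<le> x" using pos_mod_sign[of q x] mult_div_mod_eq[of q x] assms(1) by linarith
  then have "q * (x div q) < q * n" using assms(2) by simp
  then show ?thesis using assms(1) by (simp add: mult_less_cancel_left_pos)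
qed

lemma bij_divmod:
  assumes "(q :: int) > 0"
  shows "bij_betw (\<lambda>i. (i mod q, i div q)) {0..<q * n} ({0..<q} \<times> {0..<n})"
proof (rule bij_betwI[of _ _ _ "\<lambda>(a, b). q * b + a"])
  show "(\<lambda>i. (i mod q, i div q)) \<in> {0..<q * n} \<rightarrow> {0..<q} \<times> {0..<n}"
    using assms by (auto simp: pos_imp_zdiv_nonneg_iff int_div_less)
  show "(\<lambda>(a, b). q * b + a) \<in> {0..<q} \<times> {0..<n} \<rightarrow> {0..<q * n}"
  proof
    fix x assume "x \<in> {0..<q} \<times> {0..<n}"
    then obtain a b where x: "x = (a, b)" "0 \<le> a" "a < q" "0 \<le> b" "b < n" by auto
    have "q * b + a < q * (b + 1)" using x by (simp add: algebra_simps)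
    also have "\<dots> \<le> q * n" using x assms by (intro mult_left_mono) auto
    finally show "(case x of (a, b) \<Rightarrow> q * b + a) \<in> {0..<q * n}" using x assms by simp
  qed
qed (use assms in auto)

text \<open>The window of length \<open>q * n\<close> is cut into \<open>q\<close> copies of the
  window of length \<open>n\<close>, the copy with digit \<open>a\<close> being moved down by
  \<open>a * n\<close>.\<close>

lemma bij_digit:
  assumes "(n :: int) > 0"
  shows "bij_betw (\<lambda>(a, z). z - a * n) ({0..<q} \<times> {- n<..0}) {- (q * n)<..0}"
proof (rule bij_betwI[of _ _ _ "\<lambda>w. ((- w) div n, - ((- w) mod n))"])
  show "(\<lambda>(a, z). z - a * n) \<in> {0..<q} \<times> {- n<..0} \<rightarrow> {- (q * n)<..0}"
  proof
    fix x assume "x \<in> {0..<q} \<times> {- n<..0}"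
    then obtain a z where x: "x = (a, z)" "0 \<le> a" "a < q" "- n < z" "z \<le> 0" by auto
    have "a * n - z < (a + 1) * n" using x by (simp add: algebra_simps)
    also have "\<dots> \<le> q * n" using x assms by (intro mult_right_mono) auto
    finally have "- (q * n) < z - a * n" by simp
    moreover have "z \<le> a * n" using x assms mult_nonneg_nonneg[of a n] by linarith
    ultimately show "(case x of (a, z) \<Rightarrow> z - a * n) \<in> {- (q * n)<..0}" using x by simp
  qed
  show "(\<lambda>w. ((- w) div n, - ((- w) mod n))) \<in> {- (q * n)<..0} \<rightarrow> {0..<q} \<times> {- n<..0}"
    using assms by (auto simp: pos_imp_zdiv_nonneg_iff mult.commute intro!: int_div_less)
  fix x assume "x \<in> {0..<q} \<times> {- n<..0}"
  then obtain a z where x: "x = (a, z)" "- n < z" "z \<le> 0" by auto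
  have "(a * n - z) div n = a"
    by (rule int_div_pos_eq[where r = "- z"]) (use x in \<open>auto simp: mult.commute\<close>)
  moreover have "(a * n - z) mod n = - z"
    by (rule int_mod_pos_eq[where q = a]) (use x in \<open>auto simp: mult.commute\<close>)
  ultimately  show "(\<lambda>w. ((- w) div n, - ((- w) mod n))) ((\<lambda>(a, z). z - a * n) x) = x"
    using x by simp
next
  fix w
  show "(\<lambda>(a, z). z - a * n) ((- w) div n, - ((- w) mod n)) = w"
    using div_mult_mod_eq[of "- w" n] by (simp only: prod.case)
qed

text \<open>\<open>T (Suc k)\<close> is the disjoint union of the left translates of
  \<open>T k\<close> by \<open>D k\<close>. Right multiplication inside \<open>T k\<close> is
  therefore compatible with passing to the next level, and \<open>folner\<close> makes its failure
  rare.\<close>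

locale tiling = G: group G for G :: "('g, 'c) monoid_scheme" (structure) +
  fixes T D :: "nat \<Rightarrow> 'g set"
  assumes countable_G: "countable (carrier G)"
    and T: "\<And>k. finite (T k)" "\<And>k. T k \<subseteq> carrier G" "\<And>k. T k \<noteq> {}"
    and D: "\<And>k. finite (D k)" "\<And>k. D k \<subseteq> carrier G" "\<And>k. card (D k) \<ge> 2"
    and tile: "\<And>k. bij_betw (\<lambda>(d, t). d \<otimes> t) (D k \<times> T k) (T (Suc k))"
    and folner: "\<And>g. g \<in> carrier G \<Longrightarrow> (\<lambda>k. card (right_exit G (T k) g) / card (T k)) \<longlonglongrightarrow> 0"
begin

abbreviation N :: "nat \<Rightarrow> int" where "N k \<equiv> int (card (T k))"
abbreviation q :: "nat \<Rightarrow> int" where "q k \<equiv> int (card (D k))"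

lemma N_pos: "N k > 0" using T by (simp add: card_gt_0_iff)
lemma q_ge: "q k \<ge> 2" and q_pos: "q k > 0" using D(3)[of k] by simp_all

lemma card_Suc: "card (T (Suc k)) = card (D k) * card (T k)"
  using bij_betw_same_card[OF tile[of k]] by (simp add: card_cartesian_product)

lemma N_Suc: "N (Suc k) = q k * N k"
  by (simp add: card_Suc)

lemma N_ge: "N k \<ge> 2 ^ k"
proof (induction k)
  case 0
  then show ?case using N_pos[of 0] by simp
next
  case (Suc k)
  have "2 * 2 ^ k \<le> q k * N k" using q_ge Suc by (intro mult_mono) auto
  then show ?case by (simp add: N_Suc)
qed

lemma N_dvd: "k \<le> l \<Longrightarrow> N k dvd N l"
  by (induction l rule: dec_induct) (auto simp: N_Suc)

text \<open>\<open>E k\<close> identifies the intervals of length \<open>1 / N k\<close> with endpoints in \<open>\<int> / N k\<close> with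
  \<open>T k \<times> \<int>\<close>. Passing to the next level, the tile \<open>T k\<close> is placed at one of its \<open>q k\<close> positions in
  \<open>T (Suc k)\<close>, and correspondingly the window \<open>{-N k<..0}\<close> in \<open>{-N (Suc k)<..0}\<close>.\<close>

primrec E :: "nat \<Rightarrow> int \<Rightarrow> 'g \<times> int" where
  "E 0 i = (set_enum (T 0) (i mod N 0), i div N 0 - i mod N 0)"
| "E (Suc k) i = (set_enum (D k) (i mod q k) \<otimes> fst (E k (i div q k)),
      snd (E k (i div q k)) - (i mod q k) * N k)"

text \<open>The digit \<open>i mod q k\<close> selects a translate of \<open>T k\<close> in
  \<open>T (Suc k)\<close>, and \<open>i div q k\<close> a point in it.\<close>

lemma bij_fst_E: "bij_betw (\<lambda>i. fst (E k i)) {0..<N k} (T k)"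
proof (induction k)
  case 0
  show ?case using bij_set_enum[OF T(1)[of 0]] by (rule bij_betw_cong[THEN iffD1, rotated]) simp
next
  case (Suc k)
  have "bij_betw (map_prod (set_enum (D k)) (\<lambda>i. fst (E k i))) ({0..<q k} \<times> {0..<N k}) (D k \<times> T k)"
    by (rule bij_betw_map_prod[OF bij_set_enum[OF D(1)] Suc])
  from bij_betw_trans[OF bij_betw_trans[OF bij_divmod[OF q_pos[of k], of "N k"] this] tile[of k]]
  show ?case by (simp add: N_Suc comp_def)
qed

text \<open>The same digit selects a copy of the smaller window. On the \<open>N k\<close> cells of
  the unit interval each coordinate alone is thus a bijection, which is why \<open>{0..<1}\<close>
  can be a fundamental domain for both groups.\<close>

lemma bij_snd_E: "bij_betw (\<lambda>i. snd (E k i)) {0..<N k} {- N k<..0}"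
proof (induction k)
  case 0
  have "bij_betw (\<lambda>i. - i) {0..<N 0} {- N 0<..0}" by (rule bij_betwI[of _ _ _ uminus]) auto
  then show ?case by (rule bij_betw_cong[THEN iffD1, rotated]) simp
next
  case (Suc k)
  have "bij_betw (map_prod id (\<lambda>i. snd (E k i))) ({0..<q k} \<times> {0..<N k}) ({0..<q k} \<times> {- N k<..0})"
    by (rule bij_betw_map_prod[OF bij_betw_id Suc])
  from bij_betw_trans[OF bij_betw_trans[OF bij_divmod[OF q_pos[of k], of "N k"] this] bij_digit[OF N_pos[of k]]]
  show ?case by (simp add: N_Suc comp_def)
qed

text \<open>Translating the real line by the integer \<open>m\<close> moves cell indices by
  \<open>N k * m\<close>; only the integer coordinate notices.\<close>

lemma E_shift: "E k (i + N k * m) = (fst (E k i), snd (E k i) + m)"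
proof (induction k arbitrary: i)
  case 0
  show ?case using N_pos[of 0] by simp
next
  case (Suc k)
  have "(i + N (Suc k) * m) mod q k = i mod q k" "(i + N (Suc k) * m) div q k = i div q k + N k * m"
    using q_pos[of k] by (simp_all add: N_Suc mult.assoc)
  then show ?case by (simp add: Suc)
qed

lemma fst_E: "fst (E k i) \<in> T k"
proof -
  have "fst (E k i) = fst (E k (i mod N k))"
    using E_shift[of k "i mod N k" "i div N k"] by (simp add: add.commute)
  then show ?thesis using bij_betwE[OF bij_fst_E[of k]] N_pos[of k] by simp
qed

lemma E_surj:
  assumes "t \<in> T k" obtains i where "E k i = (t, z)"
proof -
  have "t \<in> (\<lambda>i. fst (E k i)) ` {0..<N k}"
    using bij_betw_imp_surj_on[OF bij_fst_E[of k]] assms by simp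
  then obtain i where i: "fst (E k i) = t" by auto
  have "E k (i + N k * (z - snd (E k i))) = (t, z)" using i by (simp add: E_shift)
  then show ?thesis by (rule that)
qed

lemma E_inj:
  assumes "E k i = E k j" shows "i = j"
proof -
  have E: "E k i = (fst (E k (i mod N k)), snd (E k (i mod N k)) + i div N k)" for i
    using E_shift[of k "i mod N k" "i div N k"] by (simp add: add.commute)
  have "i mod N k = j mod N k"
    using assms E[of i] E[of j] bij_betw_imp_inj_on[OF bij_fst_E[of k]] N_pos[of k]
    by (auto dest!: inj_onD)
  moreover from this have "i div N k = j div N k" using assms E[of i] E[of j] by simp
  ultimately show ?thesis by (metis div_mult_mod_eq)
qed

section \<open>Cells of the real line and the action of the tiled group\<close>

definition fl :: "nat \<Rightarrow> real \<Rightarrow> int" where "fl k y = \<lfloor>real (card (T k)) * y\<rfloor>"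
abbreviation tt :: "nat \<Rightarrow> real \<Rightarrow> 'g" where "tt k y \<equiv> fst (E k (fl k y))"
abbreviation zz :: "nat \<Rightarrow> real \<Rightarrow> int" where "zz k y \<equiv> snd (E k (fl k y))"

lemma fl_Suc_div: "fl (Suc k) y div q k = fl k y"
proof -
  have "real (card (T k)) * y = real (card (T (Suc k))) * y / real_of_int (q k)"
    using q_pos[of k] by (simp add: card_Suc)
  then show ?thesis
    unfolding fl_def by (simp only: floor_divide_real_eq_div[of "q k"] of_nat_0_le_iff)
qed

lemma fl_shift: "fl k (y + of_int m) = fl k y + N k * m"
proof -
  have "real (card (T k)) * (y + of_int m) = real (card (T k)) * y + of_int (N k * m)"
    by (simp add: algebra_simps)
  then show ?thesis unfolding fl_def by (simp only: floor_add_int)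
qed

lemma fl_unit: "y \<in> {0..<1} \<Longrightarrow> fl k y \<in> {0..<N k}"
proof -
  assume y: "y \<in> {0..<1}"
  then have "real (card (T k)) * y < real (card (T k)) * 1"
    using N_pos[of k] by (intro mult_strict_left_mono) auto
  then have "\<lfloor>real (card (T k)) * y\<rfloor> < N k" by (simp add: floor_less_iff)
  then show ?thesis using y by (simp add: fl_def)
qed

text \<open>The translation taking \<open>y\<close> to \<open>y'\<close> realises the action of \<open>g\<close> at level \<open>k\<close>: it keeps the \<open>\<int>\<close>-coordinate and
  multiplies the tile coordinate by the inverse of \<open>g\<close> from the right.\<close>

definition R :: "nat \<Rightarrow> 'g \<Rightarrow> real \<Rightarrow> real \<Rightarrow> bool" where
  "R k g y y' \<longleftrightarrow> real (card (T k)) * (y' - y) = of_int (fl k y' - fl k y)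
     \<and> tt k y' = tt k y \<otimes> inv g \<and> zz k y' = zz k y"

lemma tt_carrier: "tt k y \<in> carrier G" using fst_E T(2) by blast

lemma set_enum_D_carrier: "set_enum (D k) (i mod q k) \<in> carrier G"
  using bij_betwE[OF bij_set_enum[OF D(1)[of k]]] q_pos[of k] D(2)[of k] by auto

lemma tt_Suc: "tt (Suc k) y = set_enum (D k) (fl (Suc k) y mod q k) \<otimes> tt k y"
  and zz_Suc: "zz (Suc k) y = zz k y - (fl (Suc k) y mod q k) * N k"
  by (simp_all add: fl_Suc_div)

lemma fl_translate:
  assumes "real (card (T k)) * (y' - y) = of_int m" shows "fl k y' = fl k y + m"
proof -
  have "real (card (T k)) * y' = real (card (T k)) * y + of_int m" using assms by (simp add: algebra_simps)
  then show ?thesis unfolding fl_def by (simp only: floor_add_int)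
qed

text \<open>Displacements by whole cells of level \<open>k\<close> do not change the next digit
  \<open>fl (Suc k) y mod q k\<close>. So \<open>y\<close> and \<open>y'\<close> receive the same
  left factor from \<open>D k\<close> and the same window shift, and a left factor commutes with
  right multiplication by \<open>inv g\<close>.\<close>

lemma R_Suc:
  assumes "R k g y y'" "g \<in> carrier G" shows "R (Suc k) g y y'"
proof -
  have "real (card (T (Suc k))) * (y' - y) = of_int (q k) * (real (card (T k)) * (y' - y))"
    by (simp add: card_Suc)
  also have "\<dots> = of_int (q k * (fl k y' - fl k y))" using assms(1) by (simp add: R_def)
  finally have 1: "real (card (T (Suc k))) * (y' - y) = of_int (q k * (fl k y' - fl k y))" .
  from fl_translate[OF this] have fl: "fl (Suc k) y' = fl (Suc k) y + q k * (fl k y' - fl k y)" .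
  then have "fl (Suc k) y' mod q k = fl (Suc k) y mod q k" by simp
  then show ?thesis
    using assms 1 fl set_enum_D_carrier tt_carrier
    unfolding R_def tt_Suc zz_Suc by (simp add: G.m_assoc)
qed

lemma R_mono:
  assumes "k \<le> l" "R k g y y'" "g \<in> carrier G" shows "R l g y y'"
  using assms(1)
proof (induction l rule: dec_induct)
  case (step l)
  show ?case by (rule R_Suc[OF step.IH assms(3)])
qed (rule assms(2))

lemma R_unique:
  assumes "R k g y y1" "R l g y y2" "g \<in> carrier G" shows "y1 = y2"
proof -
  let ?m = "max k l"
  have R: "R ?m g y y1" "R ?m g y y2"
    using R_mono[OF _ assms(1,3), of ?m] R_mono[OF _ assms(2,3), of ?m] by simp_all
  then have "fl ?m y1 = fl ?m y2" by (intro E_inj[of ?m], intro prod_eqI) (simp_all add: R_def)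
  then have "real (card (T ?m)) * (y1 - y) = real (card (T ?m)) * (y2 - y)" using R by (simp add: R_def)
  then show ?thesis using N_pos[of ?m] by simp
qed

lemma R_exists:
  assumes "tt k y \<otimes> inv g \<in> T k" obtains m where "R k g y (y + of_int m / card (T k))"
proof -
  obtain j where j: "E k j = (tt k y \<otimes> inv g, zz k y)" using E_surj[OF assms] .
  let ?y = "y + of_int (j - fl k y) / card (T k)"
  have 1: "real (card (T k)) * (?y - y) = of_int (j - fl k y)" using N_pos[of k] by simp
  from fl_translate[OF this] have "fl k ?y = j" by simp
  then show ?thesis using that[of "j - fl k y"] j 1 by (simp add: R_def)
qed

text \<open>Multiplying from the right by inverses composes in the order of a left action.\<close>

lemma R_comp:
  assumes "R k g y y'" "R k h y' y''" "g \<in> carrier G" "h \<in> carrier G"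
  shows "R k (h \<otimes> g) y y''"
proof -
  have "real (card (T k)) * (y'' - y) = real (card (T k)) * (y' - y) + real (card (T k)) * (y'' - y')"
    by (simp add: algebra_simps)
  then show ?thesis using assms tt_carrier by (simp add: R_def G.m_assoc G.inv_mult_group)
qed

lemma R_shift: "R k g y y' \<Longrightarrow> R k g (y + of_int m) (y' + of_int m)"
  by (simp add: R_def fl_shift E_shift)

lemma R_one: "R k \<one> y y"
  using tt_carrier by (simp add: R_def)

text \<open>The second condition makes \<open>\<alpha> g y\<close> defined for every
  \<open>g\<close>; the third, at \<open>l = 0\<close>, lets \<open>\<Gamma>\<close> bring
  \<open>y\<close> into the unit interval, and all \<open>l\<close> are included for invariance
  under integer translations. Leaving out cell endpoints makes the conditions open, so that
  \<open>\<Omega>\<close> is a G-delta set.\<close>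

definition \<Omega> :: "real set" where
  "\<Omega> = {y. (\<forall>k. real (card (T k)) * y \<notin> \<int>) \<and> (\<forall>g\<in>carrier G. \<exists>k. tt k y \<otimes> inv g \<in> T k)
     \<and> (\<forall>l. \<exists>k. zz k y + l \<in> {- N k<..0})}"

lemma \<Omega>_window: "y \<in> \<Omega> \<Longrightarrow> \<exists>k. zz k y + l \<in> {- N k<..0}"
  unfolding \<Omega>_def by simp

lemma \<Omega>_tile: "y \<in> \<Omega> \<Longrightarrow> g \<in> carrier G \<Longrightarrow> \<exists>k. tt k y \<otimes> inv g \<in> T k"
  unfolding \<Omega>_def by simp

lemma in_T_Suc:
  assumes "tt k y \<otimes> inv g \<in> T k" "g \<in> carrier G"
  shows "tt (Suc k) y \<otimes> inv g \<in> T (Suc k)"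
proof -
  let ?d = "set_enum (D k) (fl (Suc k) y mod q k)"
  have "?d \<in> D k" using bij_betwE[OF bij_set_enum[OF D(1)[of k]]] q_pos[of k] by simp
  then have "?d \<otimes> (tt k y \<otimes> inv g) \<in> T (Suc k)"
    using bij_betwE[OF tile[of k]] assms(1) by auto
  then show ?thesis using assms(2) tt_carrier set_enum_D_carrier unfolding tt_Suc by (simp add: G.m_assoc)
qed

lemma in_T_mono:
  assumes "k \<le> l" "tt k y \<otimes> inv g \<in> T k" "g \<in> carrier G"
  shows "tt l y \<otimes> inv g \<in> T l"
  using assms(1) 
proof (induction l rule: dec_induct)
  case (step l)
  show ?case by (rule in_T_Suc[OF step.IH assms(3)])
qed (rule assms(2))

lemma window_mono:
  assumes "k \<le> l" "zz k y + m \<in> {- N k<..0}" shows "zz l y + m \<in> {- N l<..0}"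
  using assms(1)
proof (induction l rule: dec_induct)
  case (step l)
  let ?a = "fl (Suc l) y mod q l"
  have a: "?a \<in> {0..<q l}" using q_pos[of l] by simp
  have "zz (Suc l) y + m = (\<lambda>(a, z). z - a * N l) (?a, zz l y + m)"
    by (simp only: zz_Suc prod.case)
  also have "\<dots> \<in> {- (q l * N l)<..0}"
    using bij_betwE[OF bij_digit[OF N_pos[of l], of "q l"]] a step.IH by blast
  finally show ?case by (simp only: N_Suc)
qed (use assms in simp)

text \<open>At a level where \<open>R\<close> holds, the displacement preserves cell endpoints, the
  tile condition for \<open>y'\<close> and \<open>h\<close> is the one for \<open>y\<close> and
  \<open>h \<otimes> g\<close>, and the integer coordinate is unchanged.\<close>

lemma R_\<Omega>:
  assumes y: "y \<in> \<Omega>" and R: "R k g y y'" and g: "g \<in> carrier G" shows "y' \<in> \<Omega>"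
proof -
  have "real (card (T l)) * y' \<notin> \<int>" for l
  proof
    assume int: "real (card (T l)) * y' \<in> \<int>"
    define m where "m = max k l"
    obtain c where "N m = N l * c" using N_dvd[of l m] by (auto simp: m_def dvd_def)
    then have "real (card (T m)) = real (card (T l)) * of_int c"
      by (metis of_int_mult of_int_of_nat_eq)
    then have "real (card (T m)) * y' = of_int c * (real (card (T l)) * y')" by simp
    then have 1: "real (card (T m)) * y' \<in> \<int>" using Ints_mult[OF Ints_of_int int] by metis
    have "R m g y y'" using R_mono[OF _ R g, of m] by (simp add: m_def)
    then have "real (card (T m)) * y = real (card (T m)) * y' - of_int (fl m y' - fl m y)"
      by (simp add: R_def algebra_simps)
    then have "real (card (T m)) * y \<in> \<int>" using 1 by simp
    then show False using y by (auto simp: \<Omega>_def)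
  qed
  moreover have "\<exists>l. tt l y' \<otimes> inv h \<in> T l" if h: "h \<in> carrier G" for h
  proof -
    obtain l where l: "tt l y \<otimes> inv (h \<otimes> g) \<in> T l" using \<Omega>_tile[OF y, of "h \<otimes> g"] g h by auto
    define m where "m = max k l"
    have "tt m y \<otimes> inv (h \<otimes> g) \<in> T m" using l g h by (intro in_T_mono[of l m]) (auto simp: m_def)
    moreover have "R m g y y'" using R_mono[OF _ R g, of m] by (simp add: m_def)
    ultimately have "tt m y' \<otimes> inv h \<in> T m"
      using g h tt_carrier by (simp add: R_def G.m_assoc G.inv_mult_group)
    then show ?thesis by blast
  qed
  moreover have "\<exists>l. zz l y' + m \<in> {- N l<..0}" for m
  proof -
    obtain l where l: "zz l y + m \<in> {- N l<..0}" using \<Omega>_window[OF y] by metis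
    have "zz (max k l) y + m \<in> {- N (max k l)<..0}" by (rule window_mono[OF _ l]) simp
    moreover have "R (max k l) g y y'" using R_mono[OF _ R g, of "max k l"] by simp
    ultimately have "zz (max k l) y' + m \<in> {- N (max k l)<..0}" by (simp only: R_def)
    then show ?thesis by blast
  qed
  ultimately show ?thesis by (simp add: \<Omega>_def)
qed

lemma \<Omega>_shift:
  assumes "y \<in> \<Omega>" shows "y + of_int m \<in> \<Omega>"
proof -
  have "real (card (T k)) * (y + of_int m) \<notin> \<int>" for k
  proof
    assume "real (card (T k)) * (y + of_int m) \<in> \<int>"
    then have "real (card (T k)) * (y + of_int m) - of_int (N k * m) \<in> \<int>" by (intro Ints_diff) auto
    then show False using assms by (auto simp: \<Omega>_def algebra_simps)
  qed
  moreover have "\<exists>k. zz k (y + of_int m) + l \<in> {- N k<..0}" for l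
  proof -
    obtain k where "zz k y + (m + l) \<in> {- N k<..0}" using \<Omega>_window[OF assms] by metis
    then show ?thesis by (intro exI[of _ k]) (simp add: fl_shift E_shift add.assoc)
  qed
  ultimately show ?thesis using assms by (simp add: \<Omega>_def fl_shift E_shift)
qed

definition \<alpha> :: "'g \<Rightarrow> real \<Rightarrow> real" where "\<alpha> g y = (THE y'. \<exists>k. R k g y y')"

lemma \<alpha>_eq: "R k g y y' \<Longrightarrow> g \<in> carrier G \<Longrightarrow> \<alpha> g y = y'"
  unfolding \<alpha>_def by (rule the_equality) (auto intro: R_unique)

lemma \<alpha>_R:
  assumes "y \<in> \<Omega>" "g \<in> carrier G" obtains k where "R k g y (\<alpha> g y)"
proof -
  obtain k where "tt k y \<otimes> inv g \<in> T k" using \<Omega>_tile[OF assms] by metis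
  then obtain m where "R k g y (y + of_int m / card (T k))" by (rule R_exists)
  then show ?thesis using that \<alpha>_eq[OF _ assms(2)] by metis
qed

lemma \<alpha>_\<Omega>: "y \<in> \<Omega> \<Longrightarrow> g \<in> carrier G \<Longrightarrow> \<alpha> g y \<in> \<Omega>"
  by (metis \<alpha>_R R_\<Omega>)

lemma \<alpha>_one: "\<alpha> \<one> y = y"
  using \<alpha>_eq[OF R_one] by simp

lemma \<alpha>_mult:
  assumes "y \<in> \<Omega>" "g \<in> carrier G" "h \<in> carrier G"
  shows "\<alpha> (h \<otimes> g) y = \<alpha> h (\<alpha> g y)"
proof -
  obtain k where k: "R k g y (\<alpha> g y)" using \<alpha>_R assms by blast
  obtain l where l: "R l h (\<alpha> g y) (\<alpha> h (\<alpha> g y))" using \<alpha>_R \<alpha>_\<Omega> assms by metis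
  have "R (max k l) (h \<otimes> g) y (\<alpha> h (\<alpha> g y))"
    by (rule R_comp[OF R_mono[OF _ k] R_mono[OF _ l]]) (simp_all add: assms)
  then show ?thesis using assms by (intro \<alpha>_eq) auto
qed

lemma \<alpha>_free:
  assumes "y \<in> \<Omega>" "g \<in> carrier G" "\<alpha> g y = y" shows "g = \<one>"
proof -
  obtain k where "R k g y y" using \<alpha>_R[OF assms(1,2)] assms(3) by metis
  then have "tt k y \<otimes> inv g = tt k y" by (simp add: R_def)
  then show ?thesis using assms(2) tt_carrier by (metis G.inv_closed G.inv_eq_1_iff G.l_cancel_one)
qed

lemma \<alpha>_shift:
  assumes "y \<in> \<Omega>" "g \<in> carrier G" shows "\<alpha> g (y + of_int m) = \<alpha> g y + of_int m"
proof -
  obtain k where "R k g y (\<alpha> g y)" using \<alpha>_R assms by blast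
  from R_shift[OF this] show ?thesis using assms(2) by (intro \<alpha>_eq)
qed

lemma zz_unit: "y \<in> {0..<1} \<Longrightarrow> zz k y \<in> {- N k<..0}"
  using bij_betwE[OF bij_snd_E[of k]] fl_unit by blast

text \<open>At a level whose window contains \<open>zz k y\<close>, exactly one cell of the unit
  interval has this integer coordinate, and some \<open>g\<close> takes the tile coordinate of
  \<open>y\<close> to that of the cell. Two such elements agree, by \<open>bij_snd_E\<close> at a
  common level.\<close>

lemma \<alpha>_fundamental:
  assumes y: "y \<in> \<Omega>" shows "\<exists>!g. g \<in> carrier G \<and> \<alpha> g y \<in> \<Omega> \<inter> {0..<1}"
proof -
  obtain k where k: "zz k y \<in> {- N k<..0}" using \<Omega>_window[OF y, of 0] by auto
  then obtain i where i: "i \<in> {0..<N k}" "snd (E k i) = zz k y"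
    using bij_betw_imp_surj_on[OF bij_snd_E[of k]] by (metis imageE)
  define t where "t = fst (E k i)"
  have t: "t \<in> T k" "t \<in> carrier G" using fst_E T(2) by (auto simp: t_def)
  \<comment> \<open>The solution of \<open>tt k y \<otimes> inv g = t\<close>.\<close>
  define g where "g = inv t \<otimes> tt k y"
  have g: "g \<in> carrier G" "tt k y \<otimes> inv g = t"
    using t tt_carrier by (simp_all add: g_def G.inv_mult_group G.m_assoc[symmetric])
  then obtain m where m: "R k g y (y + of_int m / card (T k))" using R_exists[of k y g] t by metis
  then have \<alpha>: "\<alpha> g y = y + of_int m / card (T k)" by (rule \<alpha>_eq[OF _ g(1)])
  then have "E k (fl k (\<alpha> g y)) = E k i"
    using m g(2) i by (intro prod_eqI) (simp_all add: R_def t_def)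
  then have fl: "fl k (\<alpha> g y) = i" by (rule E_inj)
  have "\<alpha> g y \<in> {0..<1}"
  proof -
    have "of_int i \<le> real (card (T k)) * \<alpha> g y" "real (card (T k)) * \<alpha> g y < of_int i + 1"
      using fl unfolding fl_def by linarith+
    moreover have "of_int i + 1 \<le> real (card (T k))" using i(1) by auto
    moreover have "0 \<le> real_of_int i" using i(1) by simp
    ultimately have "0 \<le> real (card (T k)) * \<alpha> g y" "real (card (T k)) * \<alpha> g y < real (card (T k)) * 1"
      by linarith+
    note bounds = this
    have c: "real (card (T k)) > 0" using N_pos[of k] by simp
    have "0 \<le> \<alpha> g y" using bounds(1) c by (simp add: zero_le_mult_iff)
    moreover have "\<alpha> g y < 1"
      using bounds(2) mult_less_cancel_left_pos[OF c, of "\<alpha> g y" 1] by blast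
    ultimately show ?thesis by simp
  qed
  moreover have "h = g" if h: "h \<in> carrier G" "\<alpha> h y \<in> {0..<1}" for h
  proof -
    obtain l where l: "R l h y (\<alpha> h y)" using \<alpha>_R y h by blast
    define n where "n = max k l"
    have R: "R n g y (\<alpha> g y)" "R n h y (\<alpha> h y)"
      using R_mono[OF _ m g(1)] R_mono[OF _ l h(1)] by (auto simp: n_def \<alpha>)
    have "fl n (\<alpha> g y) = fl n (\<alpha> h y)"
    proof (rule inj_onD[OF bij_betw_imp_inj_on[OF bij_snd_E[of n]]])
      show "zz n (\<alpha> g y) = zz n (\<alpha> h y)" using R by (simp add: R_def)
    qed (rule fl_unit[OF \<open>\<alpha> g y \<in> {0..<1}\<close>], rule fl_unit[OF h(2)])
    then have "tt n y \<otimes> inv g = tt n y \<otimes> inv h" using R by (simp add: R_def)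
    then have "inv g = inv h" using h(1) g(1) tt_carrier by simp
    then show ?thesis using h(1) g(1) inj_onD[OF G.inv_inj, of h g] by simp
  qed
  ultimately show ?thesis
  proof (intro ex1I[of _ g])
    show "g \<in> carrier G \<and> \<alpha> g y \<in> \<Omega> \<inter> {0..<1}"
      using g(1) \<alpha>_\<Omega>[OF y g(1)] \<open>\<alpha> g y \<in> {0..<1}\<close> by blast
  qed blast
qed

text \<open>The coordinate \<open>zz k y'\<close> equals \<open>zz k y\<close>, which lies in the
  window of length \<open>N k\<close>, as does that of the fractional part of \<open>y'\<close>.
  These two differ by the floor of \<open>y'\<close>.\<close>

lemma floor_\<alpha>_less:
  assumes "y \<in> {0..<1}" "R k g y y'" shows "\<bar>\<lfloor>y'\<rfloor>\<bar> < N k"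
proof -
  define m where "m = \<lfloor>y'\<rfloor>"
  have "y' - of_int m \<in> {0..<1}" by (auto simp: m_def) linarith+
  from zz_unit[OF this, of k] have "zz k (y' - of_int m) \<in> {- N k<..0}" .
  moreover have "zz k y' = zz k (y' - of_int m) + m"
    using E_shift[of k "fl k (y' - of_int m)" m] fl_shift[of k "y' - of_int m" m] by simp
  moreover have "zz k y' \<in> {- N k<..0}" using zz_unit[OF assms(1), of k] assms(2) by (simp add: R_def)
  ultimately show ?thesis unfolding m_def[symmetric] by auto
qed

end

section \<open>Piecewise translations and standard Borel subsets of the real line\<close>

lemma emeasure_lborel_translate:
  fixes B :: "real set"
  assumes "B \<in> sets borel"
  shows "emeasure lborel ((+) c ` B) = emeasure lborel B" "(+) c ` B \<in> sets borel"
proof -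
  have eq: "(+) c ` B = (+) (- c) -` B"
    by (force simp: image_iff)
  have "(+) (- c) \<in> borel_measurable borel" by measurable
  from measurable_sets[OF this assms]
  show "(+) c ` B \<in> sets borel"
    unfolding eq space_borel Int_UNIV_right .
  have "emeasure lborel B = emeasure (distr lborel borel ((+) (- c))) B"
    by (simp only: lborel_distr_plus)
  also have "\<dots> = emeasure lborel ((+) (- c) -` B \<inter> space lborel)"
    using assms by (intro emeasure_distr) auto
  also have "\<dots> = emeasure lborel ((+) c ` B)"
    by (simp only: eq space_lborel space_borel Int_UNIV_right)
  finally show "emeasure lborel ((+) c ` B) = emeasure lborel B" ..
qed

text \<open>Cut the domain by the value of the displacement \<open>f y - y\<close>, which ranges
  over a countable set. On each piece \<open>f\<close> is a translation, and by bijectivity the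
  images of the pieces partition \<open>A\<close>.\<close>

lemma piecewise_translation_emeasure:
  fixes f :: "real \<Rightarrow> real"
  assumes \<Omega>: "\<Omega> \<in> sets borel" and f: "bij_betw f \<Omega> \<Omega>" "f \<in> borel_measurable (restrict_space borel \<Omega>)"
    and C: "countable C" "\<And>y. y \<in> \<Omega> \<Longrightarrow> f y - y \<in> C"
    and A: "A \<in> sets borel" "A \<subseteq> \<Omega>"
  shows "emeasure lborel (f -` A \<inter> \<Omega>) = emeasure lborel A"
proof -
  define P where "P c = {y \<in> \<Omega>. f y - y = c \<and> f y \<in> A}" for c
  have fid: "(\<lambda>y. f y - y) \<in> borel_measurable (restrict_space borel \<Omega>)"
    using f(2) by (intro borel_measurable_diff) (auto intro: measurable_restrict_space1)
  have P: "P c \<in> sets borel" for c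
  proof -
    have "P c = ((\<lambda>y. f y - y) -` {c} \<inter> space (restrict_space borel \<Omega>))
        \<inter> (f -` A \<inter> space (restrict_space borel \<Omega>))"
      by (auto simp: P_def space_restrict_space)
    also have "\<dots> \<in> sets (restrict_space borel \<Omega>)"
      by (intro sets.Int measurable_sets[OF fid] measurable_sets[OF f(2) A(1)]) simp
    finally show ?thesis using \<Omega> by (simp add: sets_restrict_space_iff)
  qed
  have "f -` A \<inter> \<Omega> = (\<Union>c\<in>C. P c)" using C(2) by (auto simp: P_def)
  moreover have "disjoint_family_on P C" by (auto simp: disjoint_family_on_def P_def)
  ultimately have 1: "emeasure lborel (f -` A \<inter> \<Omega>) = (\<integral>\<^sup>+c. emeasure lborel (P c) \<partial>count_space C)"
    using P C(1) by (simp add: emeasure_UN_countable)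
  have fP: "(+) c ` P c = f ` P c" for c
    by (rule image_cong) (auto simp: P_def)
  have "A = (\<Union>c\<in>C. f ` P c)"
  proof (intro equalityI subsetI)
    fix a assume a: "a \<in> A"
    then obtain y where "y \<in> \<Omega>" "a = f y" using bij_betw_imp_surj_on[OF f(1)] A(2) by blast
    then have "a \<in> f ` P (f y - y)" "f y - y \<in> C" using a C(2) by (auto simp: P_def)
    then show "a \<in> (\<Union>c\<in>C. f ` P c)" by blast
  qed (auto simp: P_def)
  moreover have "disjoint_family_on (\<lambda>c. f ` P c) C"
    unfolding disjoint_family_on_def
  proof (intro ballI impI)
    fix c d :: real assume "c \<noteq> d"
    then have "P c \<inter> P d = {}" by (auto simp: P_def)
    moreover have "P c \<subseteq> \<Omega>" "P d \<subseteq> \<Omega>" by (auto simp: P_def)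
    ultimately show "f ` P c \<inter> f ` P d = {}"
      using inj_on_image_Int[OF bij_betw_imp_inj_on[OF f(1)], of "P c" "P d"] by simp
  qed
  ultimately have "emeasure lborel A = (\<integral>\<^sup>+c. emeasure lborel (f ` P c) \<partial>count_space C)"
    using emeasure_lborel_translate(2)[OF P] C(1) by (simp add: emeasure_UN_countable flip: fP)
  also have "\<dots> = (\<integral>\<^sup>+c. emeasure lborel (P c) \<partial>count_space C)"
    unfolding fP[symmetric] by (simp add: emeasure_lborel_translate(1)[OF P])
  finally show ?thesis using 1 by simp
qed

lemma second_countable_euclidean: "second_countable (euclidean :: 'a :: second_countable_topology topology)"
proof -
  obtain B :: "'a set set" where B: "countable B" "topological_basis B"
    using ex_countable_basis by blast
  have "\<exists>V\<in>B. x \<in> V \<and> V \<subseteq> U" if "open U" "x \<in> U" for U x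
    using topological_basisE[OF B(2) that] by metis
  moreover have "open V" if "V \<in> B" for V using topological_basis_open[OF B(2) that] .
  ultimately show ?thesis
    unfolding second_countable_def using B(1) by (intro exI[of _ B]) (simp add: open_openin[symmetric])
qed

lemma borel_gdelta:
  assumes "gdelta_in euclidean \<Omega>" shows "\<Omega> \<in> sets borel"
proof -
  obtain C :: "nat \<Rightarrow> 'a set" where C: "\<And>n. open (C n)" "\<Inter>(range C) = \<Omega>"
    using assms unfolding gdelta_in_descending by auto
  have "(\<Inter>n. C n) \<in> sets borel" using C(1) by (intro sets.countable_INT) auto
  then show ?thesis using C(2) by simp
qed

text \<open>A G-delta subset of a completely metrizable space is completely metrizable, and the
  trace of the Borel sets is generated by the relatively open sets.\<close>

lemma standard_borel_gdelta:
  fixes \<Omega> :: "real set"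
  assumes "gdelta_in euclidean \<Omega>"
  shows "standard_borel (restrict_space lborel \<Omega>)"
proof -
  let ?T = "subtopology euclidean \<Omega>"
  have "completely_metrizable_space ?T"
    using assms by (simp add: completely_metrizable_space_gdelta_in completely_metrizable_space_euclidean)
  moreover have "separable_space ?T"
    by (intro second_countable_imp_separable_space second_countable_subtopology second_countable_euclidean)
  moreover have "sets (restrict_space lborel \<Omega>) = sigma_sets \<Omega> {U. openin ?T U}"
  proof -
    have sb: "sets (borel :: real measure) = sigma_sets UNIV (Collect open)"
      by (simp add: borel_def)
    have "sets (restrict_space borel \<Omega>) = (\<inter>) \<Omega> ` sigma_sets UNIV (Collect open)"
      by (simp add: sets_restrict_space sb)
    also have "\<dots> = sigma_sets \<Omega> ((\<inter>) \<Omega> ` Collect open)"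
      using borel_gdelta[OF assms] by (intro sigma_sets_Int) (simp_all add: sb)
    also have "(\<inter>) \<Omega> ` Collect open = {U. openin ?T U}"
      by (auto simp: openin_subtopology)
    finally show ?thesis by (simp add: sets_restrict_space)
  qed
  ultimately show ?thesis
    unfolding standard_borel_def by (intro exI[of _ ?T]) (simp add: space_restrict_space)
qed

section \<open>The coupling attached to a tiling sequence\<close>

context tiling
begin

lemma measurable_fl [measurable]: "fl k \<in> borel \<rightarrow>\<^sub>M count_space UNIV"
  unfolding fl_def by measurable

lemma sets_fl [measurable]: "{y. P (fl k y)} \<in> sets borel"
proof -
  have "{y. P (fl k y)} = fl k -` {i. P i} \<inter> space borel" by auto
  then show ?thesis using measurable_sets[OF measurable_fl[of k], of "{i. P i}"] by simp
qed

text \<open>Without their left endpoints the half-open cells are open intervals.\<close>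

lemma open_cells: "open {y. real (card (T k)) * y \<notin> \<int> \<and> P (fl k y)}"
proof -
  have "{y. real (card (T k)) * y \<notin> \<int> \<and> P (fl k y)}
      = (\<Union>i\<in>{i. P i}. {y. of_int i < real (card (T k)) * y \<and> real (card (T k)) * y < of_int i + 1})"
  proof (intro equalityI subsetI)
    fix y assume "y \<in> {y. real (card (T k)) * y \<notin> \<int> \<and> P (fl k y)}"
    then have "real (card (T k)) * y \<noteq> of_int (fl k y)" "P (fl k y)" by auto
    moreover have "of_int (fl k y) \<le> real (card (T k)) * y" "real (card (T k)) * y < of_int (fl k y) + 1"
      unfolding fl_def by linarith+
    ultimately show "y \<in> (\<Union>i\<in>{i. P i}. {y. of_int i < real (card (T k)) * y \<and> real (card (T k)) * y < of_int i + 1})"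
      by force
  next
    fix y assume "y \<in> (\<Union>i\<in>{i. P i}. {y. of_int i < real (card (T k)) * y \<and> real (card (T k)) * y < of_int i + 1})"
    then obtain i where i: "P i" "of_int i < real (card (T k)) * y" "real (card (T k)) * y < of_int i + 1"
      by auto
    then have "fl k y = i" unfolding fl_def by linarith
    moreover have "real (card (T k)) * y \<notin> \<int>"
    proof
      assume "real (card (T k)) * y \<in> \<int>"
      then obtain j where "real (card (T k)) * y = of_int j" by (auto elim: Ints_cases)
      then show False using i(2,3) by simp
    qed
    ultimately show "y \<in> {y. real (card (T k)) * y \<notin> \<int> \<and> P (fl k y)}" using i(1) by simp
  qed
  moreover have "open {y. of_int i < real (card (T k)) * y \<and> real (card (T k)) * y < of_int i + 1}" for i
    by (intro open_Collect_conj open_Collect_less continuous_intros)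
  ultimately show ?thesis by auto
qed

lemma gdelta_\<Omega>: "gdelta_in euclidean \<Omega>"
proof -
  define A where "A k = {y. real (card (T k)) * y \<notin> \<int> \<and> True}" for k
  define B where "B g = (\<Union>k. {y. real (card (T k)) * y \<notin> \<int> \<and> tt k y \<otimes> inv g \<in> T k})" for g
  define W where "W l = (\<Union>k. {y. real (card (T k)) * y \<notin> \<int> \<and> zz k y + l \<in> {- N k<..0}})" for l
  have op: "open (A k)" "open (B g)" "open (W l)" for k g l
    unfolding A_def B_def W_def
    using open_cells[of k "\<lambda>_. True"] open_cells[of _ "\<lambda>i. fst (E _ i) \<otimes> inv g \<in> T _"]
      open_cells[of _ "\<lambda>i. snd (E _ i) + l \<in> {- N _<..0}"]
    by (blast intro: open_UN)+
  have "y \<in> \<Omega> \<longleftrightarrow> (\<forall>k. y \<in> A k) \<and> (\<forall>g\<in>carrier G. y \<in> B g) \<and> (\<forall>l. y \<in> W l)" for y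
    unfolding \<Omega>_def A_def B_def W_def by auto
  then have "\<Omega> = \<Inter>(range A \<union> B ` carrier G \<union> range W)" by auto
  moreover have "gdelta_in euclidean (\<Inter>(range A \<union> B ` carrier G \<union> range W))"
  proof (rule gdelta_in_Inter)
    show "countable (range A \<union> B ` carrier G \<union> range W)" using countable_G by simp
    fix S assume "S \<in> range A \<union> B ` carrier G \<union> range W"
    then have "open S" using op by auto
    then show "gdelta_in euclidean S" by (simp add: open_imp_gdelta_in)
  qed auto
  ultimately show ?thesis by simp
qed

lemma borel_\<Omega> [measurable]: "\<Omega> \<in> sets borel"
  by (rule borel_gdelta[OF gdelta_\<Omega>])

lemma emeasure_cells:
  "emeasure lborel {y \<in> {0..<1}. P (fl k y)} \<le> ennreal (card {i \<in> {0..<N k}. P i} / card (T k))"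
proof -
  let ?I = "{i \<in> {0..<N k}. P i}" and ?n = "real (card (T k))"
  have n: "?n > 0" using N_pos[of k] by simp
  have "{y \<in> {0..<1}. P (fl k y)} \<subseteq> (\<Union>i\<in>?I. {of_int i / ?n ..< (of_int i + 1) / ?n})"
  proof
    fix y assume y: "y \<in> {y \<in> {0..<1}. P (fl k y)}"
    have "of_int (fl k y) \<le> ?n * y" "?n * y < of_int (fl k y) + 1" unfolding fl_def by linarith+
    then have "y \<in> {of_int (fl k y) / ?n ..< (of_int (fl k y) + 1) / ?n}"
      using n by (simp add: field_simps)
    moreover have "fl k y \<in> ?I" using y fl_unit[of y k] by simp
    ultimately show "y \<in> (\<Union>i\<in>?I. {of_int i / ?n ..< (of_int i + 1) / ?n})" by blast
  qed
  then have "emeasure lborel {y \<in> {0..<1}. P (fl k y)}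
      \<le> emeasure lborel (\<Union>i\<in>?I. {of_int i / ?n ..< (of_int i + 1) / ?n})"
    by (rule emeasure_mono) auto
  also have "\<dots> \<le> (\<Sum>i\<in>?I. emeasure lborel {of_int i / ?n ..< (of_int i + 1) / ?n})"
    by (rule emeasure_subadditive_finite, rule finite_subset[of _ "{0..<N k}"]) auto
  also have "\<dots> = (\<Sum>i\<in>?I. ennreal (1 / ?n))"
  proof (rule sum.cong[OF refl])
    fix i
    have "of_int i / ?n \<le> (of_int i + 1) / ?n" "(of_int i + 1) / ?n - of_int i / ?n = 1 / ?n"
      using n by (simp_all add: field_simps)
    then show "emeasure lborel {of_int i / ?n ..< (of_int i + 1) / ?n} = ennreal (1 / ?n)"
      by (simp only: emeasure_lborel_Ico)
  qed
  also have "\<dots> = ennreal (card ?I / card (T k))"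
    by (simp add: ennreal_of_nat_eq_real_of_nat ennreal_mult'[symmetric])
  finally show ?thesis .
qed

text \<open>Points failing at all levels fail at level \<open>k\<close> for each \<open>k\<close>,
  and by \<open>emeasure_cells\<close> the latter set has measure at most the proportion of bad
  indices.\<close>

lemma AE_exists_cell:
  assumes "(\<lambda>k. card {i \<in> {0..<N k}. \<not> P k i} / card (T k)) \<longlonglongrightarrow> 0"
  shows "AE y in lborel. y \<in> {0..<1} \<longrightarrow> (\<exists>k. P k (fl k y))"
proof -
  let ?B = "{y \<in> {0..<1}. \<forall>k. \<not> P k (fl k y)}"
  have "?B = {0..<1} \<inter> (\<Inter>k. {y. \<not> P k (fl k y)})" by auto
  also have "\<dots> \<in> sets borel" by measurable
  finally have B: "?B \<in> sets borel" .
  have "emeasure lborel ?B \<le> ennreal (card {i \<in> {0..<N k}. \<not> P k i} / card (T k))" for k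
  proof -
    have "{y \<in> {0..<1}. \<not> P k (fl k y)} = {0..<1} \<inter> {y. \<not> P k (fl k y)}" by auto
    also have "\<dots> \<in> sets borel" by measurable
    finally have "emeasure lborel ?B \<le> emeasure lborel {y \<in> {0..<1}. \<not> P k (fl k y)}"
      by (intro emeasure_mono) auto
    then show ?thesis using emeasure_cells[of "\<lambda>i. \<not> P k i" k] by (rule order_trans)
  qed
  moreover have "(\<lambda>k. ennreal (card {i \<in> {0..<N k}. \<not> P k i} / card (T k))) \<longlonglongrightarrow> ennreal 0"
    by (rule tendsto_ennrealI[OF assms])
  ultimately have "emeasure lborel ?B \<le> ennreal 0"
    by (intro tendsto_lowerbound[of _ _ sequentially]) auto
  then have "?B \<in> null_sets lborel" using B by (simp add: null_sets_def)
  then have "AE y in lborel. y \<notin> ?B" by (rule AE_not_in)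
  then show ?thesis by eventually_elim blast
qed

lemma card_fst_E: "card {i \<in> {0..<N k}. P (fst (E k i))} = card {t \<in> T k. P t}"
proof (rule bij_betw_same_card, rule bij_betw_subset[OF bij_fst_E[of k]])
  show "(\<lambda>i. fst (E k i)) ` {i \<in> {0..<N k}. P (fst (E k i))} = {t \<in> T k. P t}"
  proof -
    have "(\<lambda>i. fst (E k i)) ` {i \<in> {0..<N k}. P (fst (E k i))} = {t \<in> (\<lambda>i. fst (E k i)) ` {0..<N k}. P t}"
      by blast
    then show ?thesis by (simp only: bij_betw_imp_surj_on[OF bij_fst_E])
  qed
qed auto

lemma card_snd_E: "card {i \<in> {0..<N k}. snd (E k i) + l \<notin> {- N k<..0}} \<le> nat \<bar>l\<bar>"
proof -
  have "card {i \<in> {0..<N k}. snd (E k i) + l \<notin> {- N k<..0}} = card {z \<in> {- N k<..0}. z + l \<notin> {- N k<..0}}"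
  proof (rule bij_betw_same_card, rule bij_betw_subset[OF bij_snd_E[of k]])
    show "(\<lambda>i. snd (E k i)) ` {i \<in> {0..<N k}. snd (E k i) + l \<notin> {- N k<..0}}
        = {z \<in> {- N k<..0}. z + l \<notin> {- N k<..0}}"
    proof -
      have "(\<lambda>i. snd (E k i)) ` {i \<in> {0..<N k}. snd (E k i) + l \<notin> {- N k<..0}}
          = {z \<in> (\<lambda>i. snd (E k i)) ` {0..<N k}. z + l \<notin> {- N k<..0}}" by blast
      then show ?thesis by (simp only: bij_betw_imp_surj_on[OF bij_snd_E])
    qed
  qed auto
  also have "\<dots> \<le> card (if l \<ge> 0 then {- l<..0} else {- N k<..- N k - l})"
    by (rule card_mono) auto
  also have "\<dots> = nat \<bar>l\<bar>" by simp
  finally show ?thesis .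
qed

text \<open>Cell endpoints are countable; the tile condition for \<open>g\<close> fails on a
  proportion tending to 0 by \<open>folner\<close>; the window condition for \<open>l\<close> fails
  for at most \<open>nat \<bar>l\<bar>\<close> of at least 2^k indices.\<close>

lemma AE_\<Omega>: "AE y in lborel. y \<in> {0..<1} \<longrightarrow> y \<in> \<Omega>"
proof -
  have 1: "AE y in lborel. \<forall>k. real (card (T k)) * y \<notin> \<int>"
  proof (subst AE_all_countable, rule allI)
    fix k
    have "{y. real (card (T k)) * y \<in> \<int>} \<subseteq> (\<lambda>i. of_int i / real (card (T k))) ` UNIV"
    proof
      fix y assume "y \<in> {y. real (card (T k)) * y \<in> \<int>}"
      then obtain i where "real (card (T k)) * y = of_int i" by (auto elim: Ints_cases)
      then have "y = of_int i / real (card (T k))" using N_pos[of k] by (simp add: field_simps)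
      then show "y \<in> (\<lambda>i. of_int i / real (card (T k))) ` UNIV" by blast
    qed
    then have "countable {y. real (card (T k)) * y \<in> \<int>}"
      by (rule countable_subset) auto
    then have "AE y in lborel. y \<notin> {y. real (card (T k)) * y \<in> \<int>}"
      by (intro AE_not_in countable_imp_null_set_lborel)
    then show "AE y in lborel. real (card (T k)) * y \<notin> \<int>" by simp
  qed
  have 2: "AE y in lborel. \<forall>g\<in>carrier G. y \<in> {0..<1} \<longrightarrow> (\<exists>k. tt k y \<otimes> inv g \<in> T k)"
  proof (rule AE_ball_countable'[OF _ countable_G])
    fix g assume g: "g \<in> carrier G"
    have eq: "card {i \<in> {0..<N k}. \<not> fst (E k i) \<otimes> inv g \<in> T k}
        = card (right_exit G (T k) (inv g))" for k
      by (rule card_fst_E)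
    have "(\<lambda>k. card {i \<in> {0..<N k}. \<not> fst (E k i) \<otimes> inv g \<in> T k} / card (T k)) \<longlonglongrightarrow> 0"
      unfolding eq using folner[of "inv g"] g by simp
    then show "AE y in lborel. y \<in> {0..<1} \<longrightarrow> (\<exists>k. tt k y \<otimes> inv g \<in> T k)"
      by (rule AE_exists_cell[of "\<lambda>k i. fst (E k i) \<otimes> inv g \<in> T k"])
  qed
  have 3: "AE y in lborel. \<forall>l. y \<in> {0..<1} \<longrightarrow> (\<exists>k. zz k y + l \<in> {- N k<..0})"
  proof (subst AE_all_countable, rule allI)
    fix l
    have "(\<lambda>k. card {i \<in> {0..<N k}. snd (E k i) + l \<notin> {- N k<..0}} / card (T k)) \<longlonglongrightarrow> 0"
    proof (rule tendsto_sandwich[OF _ _ tendsto_const])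
      have "card {i \<in> {0..<N k}. snd (E k i) + l \<notin> {- N k<..0}} / card (T k) \<le> nat \<bar>l\<bar> / 2 ^ k" for k
      proof -
        have "real_of_int (2 ^ k) \<le> real_of_int (N k)" using N_ge[of k] by (rule of_int_le_iff[THEN iffD2])
        then have "2 ^ k \<le> real (card (T k))" by simp
        then show ?thesis using card_snd_E[of k l] by (intro frac_le) auto
      qed
      then show "\<forall>\<^sub>F k in sequentially. card {i \<in> {0..<N k}. snd (E k i) + l \<notin> {- N k<..0}} / card (T k)
          \<le> nat \<bar>l\<bar> / 2 ^ k" by simp
      show "(\<lambda>k. real (nat \<bar>l\<bar>) / 2 ^ k) \<longlonglongrightarrow> 0"
        by (intro LIMSEQ_divide_realpow_zero) simp
    qed simp
    then show "AE y in lborel. y \<in> {0..<1} \<longrightarrow> (\<exists>k. zz k y + l \<in> {- N k<..0})"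
      by (intro AE_exists_cell[of "\<lambda>k i. snd (E k i) + l \<in> {- N k<..0}"])
  qed
  from 1 2 3 show ?thesis
    by eventually_elim (simp add: \<Omega>_def)
qed

definition M :: "real measure" where "M = restrict_space lborel \<Omega>"

lemma space_M: "space M = \<Omega>" by (simp add: M_def space_restrict_space)

lemma emeasure_M: "A \<subseteq> \<Omega> \<Longrightarrow> emeasure M A = emeasure lborel A"
  unfolding M_def by (rule emeasure_restrict_space) auto

lemma sets_M: "A \<in> sets M \<longleftrightarrow> A \<in> sets borel \<and> A \<subseteq> \<Omega>"
  unfolding M_def by (subst sets_restrict_space_iff) auto

text \<open>On \<open>\<Omega>\<close> the map is a countable union, over the level \<open>k\<close>
  and the displacement \<open>m\<close>, of translations restricted to unions of cells.\<close>

lemma measurable_\<alpha>: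
  assumes g: "g \<in> carrier G"
  shows "\<alpha> g \<in> borel_measurable (restrict_space borel \<Omega>)"
proof (rule measurableI)
  fix A :: "real set" assume A: "A \<in> sets borel"
  let ?P = "\<lambda>k m i. fst (E k (i + m)) = fst (E k i) \<otimes> inv g \<and> snd (E k (i + m)) = snd (E k i)"
  have R: "R k g y (y + of_int m / card (T k)) \<longleftrightarrow> ?P k m (fl k y)" for k m y
  proof -
    have "real (card (T k)) * (y + of_int m / card (T k) - y) = of_int m" using N_pos[of k] by simp
    from fl_translate[OF this] this show ?thesis by (simp add: R_def)
  qed
  have "\<alpha> g -` A \<inter> \<Omega> = \<Omega> \<inter> (\<Union>k. \<Union>m. {y. ?P k m (fl k y)} \<inter> (\<lambda>y. y + of_int m / card (T k)) -` A)"
  proof (intro equalityI subsetI)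
    fix y assume y: "y \<in> \<alpha> g -` A \<inter> \<Omega>"
    then obtain k where "tt k y \<otimes> inv g \<in> T k" using \<Omega>_tile g by blast
    then obtain m where m: "R k g y (y + of_int m / card (T k))" by (rule R_exists)
    then have "\<alpha> g y = y + of_int m / card (T k)" by (rule \<alpha>_eq[OF _ g])
    then have "y \<in> {y. ?P k m (fl k y)} \<inter> (\<lambda>y. y + of_int m / card (T k)) -` A" using m y R by simp
    then show "y \<in> \<Omega> \<inter> (\<Union>k. \<Union>m. {y. ?P k m (fl k y)} \<inter> (\<lambda>y. y + of_int m / card (T k)) -` A)"
      using y by blast
  next
    fix y assume "y \<in> \<Omega> \<inter> (\<Union>k. \<Union>m. {y. ?P k m (fl k y)} \<inter> (\<lambda>y. y + of_int m / card (T k)) -` A)"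
    then obtain k m where y: "y \<in> \<Omega>" "?P k m (fl k y)" "y + of_int m / card (T k) \<in> A" by blast
    then have "\<alpha> g y = y + of_int m / card (T k)" using R[of k y m] by (intro \<alpha>_eq[OF _ g, of k]) simp
    then show "y \<in> \<alpha> g -` A \<inter> \<Omega>" using y by simp
  qed
  moreover have "\<Omega> \<inter> (\<Union>k. \<Union>m. {y. ?P k m (fl k y)} \<inter> (\<lambda>y. y + of_int m / card (T k)) -` A) \<in> sets borel"
  proof -
    have "(\<lambda>y. y + of_int m / card (T k)) -` A \<in> sets borel" for k and m :: int
      using measurable_sets[of "\<lambda>y. y + of_int m / card (T k)" borel borel A] A by simp
    then show ?thesis
      by (intro sets.Int[OF borel_\<Omega>] sets.countable_UN') (auto intro!: sets.Int sets_fl)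
  qed
  ultimately show "\<alpha> g -` A \<inter> space (restrict_space borel \<Omega>) \<in> sets (restrict_space borel \<Omega>)"
    by (simp add: sets_restrict_space_iff space_restrict_space)
qed auto

lemma bij_\<alpha>:
  assumes g: "g \<in> carrier G" shows "bij_betw (\<alpha> g) \<Omega> \<Omega>"
proof (rule bij_betwI[of _ _ _ "\<alpha> (inv g)"])
  show "\<alpha> g \<in> \<Omega> \<rightarrow> \<Omega>" "\<alpha> (inv g) \<in> \<Omega> \<rightarrow> \<Omega>" using g \<alpha>_\<Omega> by auto
  show "\<alpha> (inv g) (\<alpha> g y) = y" if "y \<in> \<Omega>" for y
    using \<alpha>_mult[OF that g, of "inv g"] g by (simp add: \<alpha>_one)
  show "\<alpha> g (\<alpha> (inv g) y) = y" if "y \<in> \<Omega>" for y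
    using \<alpha>_mult[OF that, of "inv g" g] g by (simp add: \<alpha>_one)
qed

lemma translation_action_M:
  assumes f: "bij_betw f \<Omega> \<Omega>" "f \<in> borel_measurable (restrict_space borel \<Omega>)"
    and C: "countable C" "\<And>y. y \<in> \<Omega> \<Longrightarrow> f y - y \<in> C"
  shows "f \<in> M \<rightarrow>\<^sub>M M \<and> (\<forall>A\<in>sets M. emeasure M (f -` A \<inter> space M) = emeasure M A)"
proof (intro conjI ballI)
  show "f \<in> M \<rightarrow>\<^sub>M M"
  proof (rule measurableI)
    fix A assume "A \<in> sets M"
    then show "f -` A \<inter> space M \<in> sets M"
      using measurable_sets[OF f(2), of A]
      by (auto simp: sets_M space_M sets_restrict_space_iff space_restrict_space)
  qed (use bij_betwE[OF f(1)] in \<open>auto simp: space_M\<close>)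
  fix A assume "A \<in> sets M"
  then show "emeasure M (f -` A \<inter> space M) = emeasure M A"
    using piecewise_translation_emeasure[OF borel_\<Omega> f C, of A]
    by (simp add: sets_M space_M emeasure_M)
qed

lemma ME_coupling_M:
  "ME_coupling G integer_group M \<alpha> (\<lambda>l y. y + of_int l) (\<Omega> \<inter> {0..<1}) (\<Omega> \<inter> {0..<1})"
proof -
  have fin: "emeasure M (\<Omega> \<inter> {0..<1}) = 1"
  proof -
    have "emeasure lborel (\<Omega> \<inter> {0..<1}) = emeasure lborel {0..<1::real}"
      using AE_\<Omega> by (intro emeasure_eq_AE) auto
    then show ?thesis by (simp add: emeasure_M)
  qed
  have "emeasure M (\<Omega> \<inter> {0..<1}) \<le> emeasure M (space M)" by (rule emeasure_space)
  then have ne: "emeasure M (space M) \<noteq> 0" using fin by auto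
  have X: "\<Omega> \<inter> {0..<1} \<in> sets M" by (simp add: sets_M)
  \<comment> \<open>Displacements are multiples of \<open>1 / card (T k)\<close>, so the countable
    set of rationals serves for all levels in \<open>translation_action_M\<close>.\<close>
  have rat: "\<alpha> g y - y \<in> \<rat>" if gy: "g \<in> carrier G" "y \<in> \<Omega>" for g y
  proof -
    obtain k where "R k g y (\<alpha> g y)" using \<alpha>_R[OF gy(2,1)] .
    then have "\<alpha> g y - y = of_int (fl k (\<alpha> g y) - fl k y) / real (card (T k))"
      using N_pos[of k] by (simp add: R_def field_simps)
    then show ?thesis by (simp only:) (intro Rats_divide Rats_of_int Rats_of_nat)
  qed
  have act1: "mp_free_action G M \<alpha>"
    unfolding mp_free_action_def
    using translation_action_M[OF bij_\<alpha> measurable_\<alpha> countable_rat rat]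
    by (simp add: space_M \<alpha>_one \<alpha>_mult \<alpha>_free)
  have act2: "mp_free_action integer_group M (\<lambda>l y. y + of_int l)"
  proof -
    have "bij_betw (\<lambda>y. y + of_int l) \<Omega> \<Omega>" for l
      using \<Omega>_shift[of _ l] \<Omega>_shift[of _ "- l"] by (intro bij_betwI[of _ _ _ "\<lambda>y. y - of_int l"]) auto
    moreover have "(\<lambda>y. y + real_of_int l) \<in> borel_measurable (restrict_space borel \<Omega>)" for l
      by (intro borel_measurable_add measurable_restrict_space1) auto
    ultimately have "(\<lambda>y. y + of_int l) \<in> M \<rightarrow>\<^sub>M M
        \<and> (\<forall>A\<in>sets M. emeasure M ((\<lambda>y. y + of_int l) -` A \<inter> space M) = emeasure M A)" for l
      by (rule translation_action_M[of _ "{of_int l}"]) auto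
    then show ?thesis by (simp add: mp_free_action_def)
  qed
  have dom2: "\<exists>!l. y + real_of_int l \<in> \<Omega> \<inter> {0..<1}" if "y \<in> \<Omega>" for y
  proof (rule ex1I[of _ "- \<lfloor>y\<rfloor>"])
    show "y + of_int (- \<lfloor>y\<rfloor>) \<in> \<Omega> \<inter> {0..<1}"
      using \<Omega>_shift[OF that, of "- \<lfloor>y\<rfloor>"] by simp linarith
    fix l assume "y + of_int l \<in> \<Omega> \<inter> {0..<1}"
    then have "0 \<le> y + of_int l" "y + of_int l < 1" by auto
    then show "l = - \<lfloor>y\<rfloor>" by linarith
  qed
  show ?thesis
    unfolding ME_coupling_def fundamental_domain_def
    using standard_borel_gdelta[OF gdelta_\<Omega>] ne act1 act2 X fin \<alpha>_fundamental dom2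
    by (simp add: M_def[symmetric] space_M \<alpha>_shift)
qed

lemma cocycle_floor:
  assumes "y \<in> \<Omega>"
  shows "cocycle_at integer_group (\<lambda>l y. y + of_int l) (\<Omega> \<inter> {0..<1}) y = - \<lfloor>y\<rfloor>"
  unfolding cocycle_at_def
proof (rule the_equality)
  show "- \<lfloor>y\<rfloor> \<in> carrier integer_group \<and> y + of_int (- \<lfloor>y\<rfloor>) \<in> \<Omega> \<inter> {0..<1}"
    using \<Omega>_shift[OF assms, of "- \<lfloor>y\<rfloor>"] by simp linarith
  fix l assume "l \<in> carrier integer_group \<and> y + of_int l \<in> \<Omega> \<inter> {0..<1}"
  then have "0 \<le> y + of_int l" "y + of_int l < 1" by auto
  then show "l = - \<lfloor>y\<rfloor>" by linarith
qed

end

context tiling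
begin

text \<open>Let \<open>K\<close> be the first level at which \<open>g\<close> keeps \<open>y\<close>
  inside its tile. Then the cocycle is bounded by \<open>N K\<close>, and \<open>K = Suc j\<close>
  only on \<open>B j\<close>, whose measure is at most the relative boundary of \<open>T j\<close>.
  The integral is dominated by the sum over these layers.\<close>

lemma coupling_integrable:
  assumes \<phi>: "mono_on {0..} \<phi>" "\<And>t. t \<ge> 0 \<Longrightarrow> \<phi> t \<ge> 0"
    and sum: "\<And>g. g \<in> carrier G \<Longrightarrow>
      summable (\<lambda>k. \<phi> (card (T (Suc k))) * (card (right_exit G (T k) g) / card (T k)))"
  shows "phi_integrable_cocycle \<phi> G integer_group {1} M \<alpha> (\<lambda>l y. y + of_int l) (\<Omega> \<inter> {0..<1})"
  unfolding phi_integrable_cocycle_def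
proof (intro ballI exI[of _ 1] conjI)
  fix g assume g: "g \<in> carrier G"
  let ?X = "\<Omega> \<inter> {0..<1}"
  let ?f = "\<lambda>y. \<phi> (real (word_length integer_group {1}
    (cocycle_at integer_group (\<lambda>l y. y + of_int l) ?X (\<alpha> g y))) / 1)"
  define b where "b k = card (right_exit G (T k) (inv g)) / card (T k)" for k
  define B where "B k = ?X \<inter> {y. tt k y \<otimes> inv g \<notin> T k}" for k
  have X: "?X \<in> sets M" by (simp add: sets_M)
  have B: "B k \<in> sets M" for k
    unfolding B_def sets_M by (intro conjI sets.Int sets_fl borel_\<Omega>) auto
  have eB: "emeasure M (B k) \<le> ennreal (b k)" for k
  proof -
    have "emeasure M (B k) = emeasure lborel (B k)" by (rule emeasure_M) (auto simp: B_def)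
    also have "\<dots> \<le> emeasure lborel {y \<in> {0..<1}. tt k y \<otimes> inv g \<notin> T k}"
    proof (rule emeasure_mono)
      have "{y \<in> {0..<1}. tt k y \<otimes> inv g \<notin> T k} = {0..<1} \<inter> {y. tt k y \<otimes> inv g \<notin> T k}" by auto
      also have "\<dots> \<in> sets lborel" unfolding sets_lborel by (intro sets.Int sets_fl) auto
      finally show "{y \<in> {0..<1}. tt k y \<otimes> inv g \<notin> T k} \<in> sets lborel" .
    qed (auto simp: B_def)
    also have "\<dots> \<le> ennreal (card {i \<in> {0..<N k}. fst (E k i) \<otimes> inv g \<notin> T k} / card (T k))"
      by (rule emeasure_cells)
    also have "\<dots> = ennreal (b k)"
      unfolding b_def by (simp only: card_fst_E[of k "\<lambda>t. t \<otimes> inv g \<notin> T k"])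
    finally show ?thesis .
  qed
  have eX: "emeasure M ?X \<le> 1"
  proof -
    have "emeasure M ?X = emeasure lborel ?X" by (rule emeasure_M) auto
    also have "\<dots> \<le> emeasure lborel {0..<1::real}" by (rule emeasure_mono) auto
    finally show ?thesis by simp
  qed
  have bound: "ennreal (?f y) \<le> ennreal (\<phi> (card (T 0))) + (\<Sum>k. ennreal (\<phi> (card (T (Suc k)))) * indicator (B k) y)"
    if y: "y \<in> ?X" for y
  proof -
    have ex: "\<exists>k. tt k y \<otimes> inv g \<in> T k" using \<Omega>_tile g y by blast
    define K where "K = (LEAST k. tt k y \<otimes> inv g \<in> T k)"
    have K: "tt K y \<otimes> inv g \<in> T K" unfolding K_def using ex by (rule LeastI_ex)
    then obtain m where m: "R K g y (y + of_int m / card (T K))" by (rule R_exists)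
    then have "\<alpha> g y = y + of_int m / card (T K)" by (rule \<alpha>_eq[OF _ g])
    then have "\<bar>\<lfloor>\<alpha> g y\<rfloor>\<bar> < N K" using floor_\<alpha>_less[of y K g "\<alpha> g y"] m y by simp
    moreover have "word_length integer_group {1} (cocycle_at integer_group (\<lambda>l y. y + of_int l) ?X (\<alpha> g y))
        = nat \<bar>\<lfloor>\<alpha> g y\<rfloor>\<bar>"
      using cocycle_floor[OF \<alpha>_\<Omega>[of y g]] g y by (simp add: word_length_integer_group)
    ultimately have f_le: "?f y \<le> \<phi> (card (T K))"
      by (intro mono_onD[OF \<phi>(1)]) auto
    show ?thesis
    proof (cases K)
      case 0
      then show ?thesis using f_le by (intro add_increasing2) (auto intro!: ennreal_leI)
    next
      case (Suc j)
      then have "tt j y \<otimes> inv g \<notin> T j"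
        using not_less_Least[of j "\<lambda>k. tt k y \<otimes> inv g \<in> T k"] by (simp add: K_def)
      then have "ennreal (?f y) \<le> ennreal (\<phi> (card (T (Suc j)))) * indicator (B j) y"
        using f_le y Suc by (simp add: B_def ennreal_leI)
      also have "\<dots> \<le> (\<Sum>k. ennreal (\<phi> (card (T (Suc k)))) * indicator (B k) y)"
      proof -
        define h where "h k = ennreal (\<phi> (card (T (Suc k)))) * indicator (B k) y" for k
        have "h j \<le> suminf h" using sum_le_suminf[of h "{j}"] by simp
        then show ?thesis unfolding h_def[abs_def] .
      qed
      finally show ?thesis by (rule add_increasing[rotated]) simp
    qed
  qed
  have "(\<integral>\<^sup>+y\<in>?X. ennreal (?f y) \<partial>M)
      \<le> (\<integral>\<^sup>+y. ennreal (\<phi> (card (T 0))) * indicator ?X y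
          + (\<Sum>k. ennreal (\<phi> (card (T (Suc k)))) * indicator (B k) y) \<partial>M)"
    by (rule nn_integral_mono) (use bound in \<open>auto simp: indicator_def\<close>)
  also have "\<dots> = ennreal (\<phi> (card (T 0))) * emeasure M ?X
      + (\<Sum>k. ennreal (\<phi> (card (T (Suc k)))) * emeasure M (B k))"
    using B X by (subst nn_integral_add) (simp_all add: nn_integral_suminf nn_integral_cmult_indicator)
  also have "\<dots> \<le> ennreal (\<phi> (card (T 0))) * 1 + (\<Sum>k. ennreal (\<phi> (card (T (Suc k)))) * ennreal (b k))"
    by (intro add_mono mult_left_mono eX suminf_le eB) auto
  also have "(\<Sum>k. ennreal (\<phi> (card (T (Suc k)))) * ennreal (b k)) = (\<Sum>k. ennreal (\<phi> (card (T (Suc k))) * b k))"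
  proof -
    have "ennreal (\<phi> (card (T (Suc k)))) * ennreal (b k) = ennreal (\<phi> (card (T (Suc k))) * b k)" for k
      by (rule ennreal_mult[symmetric]) (simp_all add: \<phi>(2) b_def)
    then show ?thesis by simp
  qed
  also have "\<dots> = ennreal (\<Sum>k. \<phi> (card (T (Suc k))) * b k)"
    using sum[of "inv g"] g unfolding b_def by (intro suminf_ennreal2) (simp_all add: \<phi>(2))
  finally show "(\<integral>\<^sup>+y\<in>?X. ennreal (?f y) \<partial>M) < \<infinity>"
    by (rule le_less_trans) (simp add: ennreal_add_less_top)
qed simp

end

section \<open>Foelner tiles in iterated wreath products\<close>

definition log_tiles :: "nat \<Rightarrow> ('g, 'c) monoid_scheme \<Rightarrow> (nat \<Rightarrow> 'g set) \<Rightarrow> (nat \<Rightarrow> 'g set) \<Rightarrow> bool" where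
  "log_tiles n G T D \<longleftrightarrow> (\<forall>k. finite (T k) \<and> T k \<subseteq> carrier G \<and> T k \<noteq> {}
      \<and> finite (D k) \<and> D k \<subseteq> carrier G \<and> card (D k) \<ge> 2
      \<and> bij_betw (\<lambda>(d, t). d \<otimes>\<^bsub>G\<^esub> t) (D k \<times> T k) (T (Suc k)))
    \<and> (\<exists>C>0. \<forall>k. iterlog n (card (T k)) \<le> C * 2 ^ k)
    \<and> (\<forall>g\<in>carrier G. \<exists>C\<ge>0. \<forall>k. card (right_exit G (T k) g) \<le> C / 2 ^ k * card (T k))"

text \<open>Doubling intervals fix the rate 2^k: it is their size, and a shift by \<open>j\<close>
  pushes out at most \<open>nat \<bar>j\<bar>\<close> points.\<close>

lemma log_tiles_Hgrp_0: "\<exists>T D. log_tiles 0 (Hgrp F 1 0) T D"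
  unfolding One_nat_def
proof -
  let ?G = "Hgrp F (Suc 0) 0"
  define z where "z i = (Zel [i] :: 'a wel)" for i
  define T where "T k = z ` {0..<2 ^ k}" for k
  define D where "D k = {z 0, z (2 ^ k)}" for k :: nat
  have inj: "inj z" by (auto simp: z_def inj_def)
  have car: "carrier ?G = range z" and mult: "z i \<otimes>\<^bsub>?G\<^esub> z j = z (i + j)" for i j
    by (auto simp: z_def Hgrp_0_simps)
  have zT: "z i \<in> T k \<longleftrightarrow> 0 \<le> i \<and> i < 2 ^ k" for i k
    by (simp add: T_def inj_image_mem_iff[OF inj])
  have cT: "card (T k) = 2 ^ k" for k
    unfolding T_def by (subst card_image) (auto intro: inj_on_subset[OF inj] simp: nat_power_eq)
  have tile: "bij_betw (\<lambda>(d, t). d \<otimes>\<^bsub>?G\<^esub> t) (D k \<times> T k) (T (Suc k))" for k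
  proof (rule bij_betw_imageI)
    show "inj_on (\<lambda>(d, t). d \<otimes>\<^bsub>?G\<^esub> t) (D k \<times> T k)"
    proof (rule inj_onI)
      fix x y assume xy: "x \<in> D k \<times> T k" "y \<in> D k \<times> T k"
        "(case x of (d, t) \<Rightarrow> d \<otimes>\<^bsub>?G\<^esub> t) = (case y of (d, t) \<Rightarrow> d \<otimes>\<^bsub>?G\<^esub> t)"
      then obtain a i b j where ab: "x = (z a, z i)" "y = (z b, z j)" "a \<in> {0, 2 ^ k}" "b \<in> {0, 2 ^ k}"
        "0 \<le> i" "i < 2 ^ k" "0 \<le> j" "j < 2 ^ k"
        unfolding D_def T_def by auto
      then have "a + i = b + j" using xy(3) inj by (simp add: mult inj_eq)
      then show "x = y" using ab by auto
    qed
    show "(\<lambda>(d, t). d \<otimes>\<^bsub>?G\<^esub> t) ` (D k \<times> T k) = T (Suc k)"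
    proof (intro equalityI subsetI)
      fix x assume "x \<in> (\<lambda>(d, t). d \<otimes>\<^bsub>?G\<^esub> t) ` (D k \<times> T k)"
      then obtain d t where dt: "d \<in> D k" "t \<in> T k" "x = d \<otimes>\<^bsub>?G\<^esub> t" by auto
      obtain a where a: "d = z a" "a \<in> {0, 2 ^ k}" using dt(1) by (auto simp: D_def)
      obtain i where i: "t = z i" "0 \<le> i" "i < 2 ^ k" using dt(2) by (auto simp: T_def)
      have "x = z (a + i)" using dt(3) a(1) i(1) by (simp add: mult)
      then show "x \<in> T (Suc k)" using a(2) i(2,3) by (auto simp: zT)
    next
      fix x assume "x \<in> T (Suc k)"
      then obtain i where i: "x = z i" "0 \<le> i" "i < 2 * 2 ^ k" by (auto simp: T_def)
      show "x \<in> (\<lambda>(d, t). d \<otimes>\<^bsub>?G\<^esub> t) ` (D k \<times> T k)"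
      proof (cases "i < 2 ^ k")
        case True
        then have "x = z 0 \<otimes>\<^bsub>?G\<^esub> z i" "z 0 \<in> D k" "z i \<in> T k" using i by (simp_all add: mult D_def zT)
        then show ?thesis by force
      next
        case False
        then have "x = z (2 ^ k) \<otimes>\<^bsub>?G\<^esub> z (i - 2 ^ k)" "z (2 ^ k) \<in> D k" "z (i - 2 ^ k) \<in> T k"
          using i by (simp_all add: mult D_def zT)
        then show ?thesis by force
      qed
    qed
  qed
  have bad: "\<exists>C\<ge>0. \<forall>k. card (right_exit ?G (T k) g) \<le> C / 2 ^ k * card (T k)" if "g \<in> carrier ?G" for g
  proof -
    obtain j where j: "g = z j" using \<open>g \<in> carrier ?G\<close> car by auto
    have le: "card (right_exit ?G (T k) g) \<le> nat \<bar>j\<bar>" for k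
    proof -
      have "right_exit ?G (T k) g \<subseteq> z ` (if j \<ge> 0 then {2 ^ k - j..<2 ^ k} else {0..<- j})"
      proof
        fix x assume "x \<in> right_exit ?G (T k) g"
        then obtain i where i: "x = z i" "0 \<le> i" "i < 2 ^ k" "z (i + j) \<notin> T k"
          unfolding j by (auto simp: T_def mult)
        then have "i \<in> (if j \<ge> 0 then {2 ^ k - j..<2 ^ k} else {0..<- j})" by (auto simp: zT)
        then show "x \<in> z ` (if j \<ge> 0 then {2 ^ k - j..<2 ^ k} else {0..<- j})" using i(1) by blast
      qed
      then have "card (right_exit ?G (T k) g) \<le> card (z ` (if j \<ge> 0 then {2 ^ k - j..<2 ^ k} else {0..<- j}))"
        by (rule card_mono[rotated]) auto
      also have "\<dots> \<le> card (if j \<ge> 0 then {2 ^ k - j..<2 ^ k} else {0..<- j})"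
        by (rule card_image_le) auto
      also have "\<dots> = nat \<bar>j\<bar>" by simp
      finally show ?thesis .
    qed
    have "real (card (right_exit ?G (T k) g)) \<le> \<bar>real_of_int j\<bar>" for k
      using le[of k] by linarith
    then show ?thesis by (intro exI[of _ "\<bar>real_of_int j\<bar>"]) (simp add: cT)
  qed
  have "z 0 \<noteq> z (2 ^ k)" for k :: nat using inj by (simp add: inj_eq)
  then have cD: "card (D k) = 2" for k by (simp add: D_def)
  have "log_tiles 0 ?G T D"
    unfolding log_tiles_def
  proof (intro conjI allI ballI bad tile)
    show "\<exists>C>0. \<forall>k. iterlog 0 (card (T k)) \<le> C * 2 ^ k" by (intro exI[of _ 1]) (simp add: cT)
    show "T k \<noteq> {}" for k using cT[of k] by auto
  qed (use cD in \<open>auto simp: T_def D_def car\<close>)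
  then show "\<exists>T D. log_tiles 0 ?G T D" by blast
qed

context wreath_groups
begin

definition lamps_on :: "'f wel set \<Rightarrow> ('f wel \<Rightarrow> 'f) set" where
  "lamps_on A = {u \<in> lamps F G. {g. u g \<noteq> \<one>\<^bsub>F\<^esub>} \<subseteq> A}"

lemma lamps_onD: "u \<in> lamps_on A \<Longrightarrow> u \<in> lamps F G" "u \<in> lamps_on A \<Longrightarrow> g \<notin> A \<Longrightarrow> u g = \<one>\<^bsub>F\<^esub>"
  by (auto simp: lamps_on_def)

lemma lamps_on_iff:
  assumes "finite A" "A \<subseteq> carrier G"
  shows "u \<in> lamps_on A \<longleftrightarrow> (\<forall>g\<in>A. u g \<in> carrier F) \<and> (\<forall>g. g \<notin> A \<longrightarrow> u g = \<one>\<^bsub>F\<^esub>)"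
proof
  assume "u \<in> lamps_on A"
  then show "(\<forall>g\<in>A. u g \<in> carrier F) \<and> (\<forall>g. g \<notin> A \<longrightarrow> u g = \<one>\<^bsub>F\<^esub>)"
    using lamps_onD lampsD(2) by blast
next
  assume u: "(\<forall>g\<in>A. u g \<in> carrier F) \<and> (\<forall>g. g \<notin> A \<longrightarrow> u g = \<one>\<^bsub>F\<^esub>)"
  then have supp: "{g. u g \<noteq> \<one>\<^bsub>F\<^esub>} \<subseteq> A" by blast
  have "u \<in> lamps F G"
  proof (rule lampsI)
    show "finite {g. u g \<noteq> \<one>\<^bsub>F\<^esub>}" using supp assms(1) finite_subset by blast
    show "u g \<in> carrier F" for g using u F.one_closed by metis
    show "u g = \<one>\<^bsub>F\<^esub>" if "g \<notin> carrier G" for g using u that assms(2) by blast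
  qed
  then show "u \<in> lamps_on A" using supp by (simp add: lamps_on_def)
qed

lemma card_lamps_on:
  assumes "finite (carrier F)" "finite A" "A \<subseteq> carrier G"
  shows "finite (lamps_on A)" "card (lamps_on A) = card (carrier F) ^ card A"
proof -
  have bij: "bij_betw (\<lambda>u. restrict u A) (lamps_on A) (A \<rightarrow>\<^sub>E carrier F)"
  proof (rule bij_betwI[of _ _ _ "\<lambda>v g. if g \<in> A then v g else \<one>\<^bsub>F\<^esub>"])
    show "(\<lambda>u. restrict u A) \<in> lamps_on A \<rightarrow> (A \<rightarrow>\<^sub>E carrier F)"
      using lamps_on_iff[OF assms(2,3)] by auto
    show "(\<lambda>v g. if g \<in> A then v g else \<one>\<^bsub>F\<^esub>) \<in> (A \<rightarrow>\<^sub>E carrier F) \<rightarrow> lamps_on A"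
      using lamps_on_iff[OF assms(2,3)] by (auto simp: PiE_mem)
    show "(\<lambda>g. if g \<in> A then restrict u A g else \<one>\<^bsub>F\<^esub>) = u" if "u \<in> lamps_on A" for u
      using lamps_onD(2)[OF that] by auto
    show "restrict (\<lambda>g. if g \<in> A then v g else \<one>\<^bsub>F\<^esub>) A = v" if "v \<in> A \<rightarrow>\<^sub>E carrier F" for v
      using PiE_arb[OF that] by auto
  qed
  have "finite (A \<rightarrow>\<^sub>E carrier F)" using assms by (intro finite_PiE) auto
  then show "finite (lamps_on A)" using bij_betw_finite[OF bij] by simp
  show "card (lamps_on A) = card (carrier F) ^ card A"
    using bij_betw_same_card[OF bij] assms(2) by (simp add: card_PiE)
qed

lemma one_lamps_on: "(\<lambda>_. \<one>\<^bsub>F\<^esub>) \<in> lamps_on A"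
  by (simp add: lamps_on_def one_lamps)

definition wtile :: "'f wel set \<Rightarrow> 'f wel set" where
  "wtile A = (\<lambda>(u, h). wmk F u h) ` (lamps_on A \<times> A)"

lemma card_wtile:
  assumes "finite (carrier F)" "finite A" "A \<subseteq> carrier G"
  shows "finite (wtile A)" "wtile A \<subseteq> carrier W" "card (wtile A) = card (carrier F) ^ card A * card A"
proof -
  note L = card_lamps_on[OF assms]
  show "finite (wtile A)" unfolding wtile_def using L(1) assms(2) by simp
  show "wtile A \<subseteq> carrier W"
    unfolding wtile_def using assms(3) by (auto intro!: wmk_in_carrier dest: lamps_onD)
  have "inj_on (\<lambda>(u, h). wmk F u h) (lamps_on A \<times> A)"
    by (rule inj_on_subset[OF inj_wmk]) (use assms(3) in \<open>auto dest: lamps_onD\<close>)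
  then show "card (wtile A) = card (carrier F) ^ card A * card A"
    unfolding wtile_def using L(2) by (simp add: card_image card_cartesian_product)
qed

text \<open>Left multiplication by \<open>(u, d)\<close> places a copy of the small tile at
  \<open>d\<close> and sets the lamps of \<open>B\<close> outside that copy, which elements of the
  small tile cannot change.\<close>

definition wshift :: "'f wel set \<Rightarrow> 'f wel set \<Rightarrow> 'f wel set \<Rightarrow> 'f wel set" where
  "wshift D A B = (\<lambda>(d, u). wmk F u d) ` Sigma D (\<lambda>d. lamps_on (B - (\<lambda>t. d \<otimes> t) ` A))"

text \<open>The cursor of an element of \<open>wtile B\<close> lies in exactly one translate of
  \<open>A\<close>, say by \<open>d\<close>. The lamps on that translate, moved back by
  \<open>inv d\<close>, form the factor in \<open>wtile A\<close>, and the other lamps form the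
  factor in \<open>wshift D A B\<close>.\<close>

lemma bij_wtile:
  assumes A: "finite A" "A \<subseteq> carrier G" and B: "finite B" "B \<subseteq> carrier G" and D: "D \<subseteq> carrier G"
    and tile: "bij_betw (\<lambda>(d, t). d \<otimes> t) (D \<times> A) B"
  shows "bij_betw (\<lambda>(x, y). x \<otimes>\<^bsub>W\<^esub> y) (wshift D A B \<times> wtile A) (wtile B)"
proof -
  let ?dA = "\<lambda>d. (\<lambda>t. d \<otimes> t) ` A"
  have dAB: "?dA d \<subseteq> B" if "d \<in> D" for d using bij_betwE[OF tile] that by auto
  have elim_shift: "\<exists>d u. x = wmk F u d \<and> d \<in> D \<and> u \<in> lamps_on (B - ?dA d)" if "x \<in> wshift D A B" for x
    using that by (auto simp: wshift_def)
  have elim_tile: "\<exists>v h. y = wmk F v h \<and> h \<in> A \<and> v \<in> lamps_on A" if "y \<in> wtile A" for y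
    using that by (auto simp: wtile_def)
  have lt_off: "ltrans F G d v g = \<one>\<^bsub>F\<^esub>" if "v \<in> lamps_on A" "d \<in> D" "g \<notin> ?dA d" for d v g
  proof (rule ccontr)
    assume "ltrans F G d v g \<noteq> \<one>\<^bsub>F\<^esub>"
    then have "g \<in> (\<lambda>t. d \<otimes> t) ` {t. v t \<noteq> \<one>\<^bsub>F\<^esub>}"
      using ltrans_supp[of v d] that(1,2) D lamps_onD(1) by blast
    then show False using that(1,3) by (auto simp: lamps_on_def)
  qed
  have prod_in: "(\<lambda>g. u g \<otimes>\<^bsub>F\<^esub> ltrans F G d v g) \<in> lamps_on B"
    if "u \<in> lamps_on (B - ?dA d)" "v \<in> lamps_on A" "d \<in> D" for u v d
  proof -
    have "u g \<otimes>\<^bsub>F\<^esub> ltrans F G d v g = \<one>\<^bsub>F\<^esub>" if g: "g \<notin> B" for g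
    proof -
      have "u g = \<one>\<^bsub>F\<^esub>" using g by (intro lamps_onD(2)[OF \<open>u \<in> lamps_on (B - ?dA d)\<close>]) blast
      moreover have "ltrans F G d v g = \<one>\<^bsub>F\<^esub>"
        using g dAB[OF \<open>d \<in> D\<close>] by (intro lt_off[OF \<open>v \<in> lamps_on A\<close> \<open>d \<in> D\<close>]) blast
      ultimately show ?thesis by simp
    qed
    moreover have "(\<lambda>g. u g \<otimes>\<^bsub>F\<^esub> ltrans F G d v g) \<in> lamps F G"
      using that D lamps_onD(1) by (intro mult_lamps ltrans_lamps) blast+
    ultimately show ?thesis by (auto simp: lamps_on_def)
  qed
  have inj_B: "d = d' \<and> h = h'"
    if "d \<in> D" "h \<in> A" "d' \<in> D" "h' \<in> A" "d \<otimes> h = d' \<otimes> h'" for d h d' h'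
    using inj_onD[OF bij_betw_imp_inj_on[OF tile], of "(d, h)" "(d', h')"] that by simp
  show ?thesis
  proof (rule bij_betw_imageI)
    show "inj_on (\<lambda>(x, y). x \<otimes>\<^bsub>W\<^esub> y) (wshift D A B \<times> wtile A)"
    proof (rule inj_onI)
      fix p p' assume p: "p \<in> wshift D A B \<times> wtile A" and p': "p' \<in> wshift D A B \<times> wtile A"
        and eq: "(case p of (x, y) \<Rightarrow> x \<otimes>\<^bsub>W\<^esub> y) = (case p' of (x, y) \<Rightarrow> x \<otimes>\<^bsub>W\<^esub> y)"
      obtain x y x' y' where xy: "p = (x, y)" "p' = (x', y')" by fastforce
      obtain d u where d: "x = wmk F u d" "d \<in> D" "u \<in> lamps_on (B - ?dA d)" using elim_shift p xy by blast
      obtain v h where v: "y = wmk F v h" "h \<in> A" "v \<in> lamps_on A" using elim_tile p xy by blast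
      obtain d' u' where d': "x' = wmk F u' d'" "d' \<in> D" "u' \<in> lamps_on (B - ?dA d')" using elim_shift p' xy by blast
      obtain v' h' where v': "y' = wmk F v' h'" "h' \<in> A" "v' \<in> lamps_on A" using elim_tile p' xy by blast
      have L: "u \<in> lamps F G" "v \<in> lamps F G" "u' \<in> lamps F G" "v' \<in> lamps F G" "d \<in> carrier G" "d' \<in> carrier G"
        using d v d' v' D lamps_onD(1) by blast+
      have "(\<lambda>g. u g \<otimes>\<^bsub>F\<^esub> ltrans F G d v g) = (\<lambda>g. u' g \<otimes>\<^bsub>F\<^esub> ltrans F G d' v' g) \<and> d \<otimes> h = d' \<otimes> h'"
        using eq L by (simp add: xy d(1) v(1) d'(1) v'(1) wmk_mult wmk_inject mult_lamps ltrans_lamps)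
      then have dh: "d' = d" "h' = h"
        and fe: "\<And>g. u g \<otimes>\<^bsub>F\<^esub> ltrans F G d v g = u' g \<otimes>\<^bsub>F\<^esub> ltrans F G d' v' g"
        using inj_B[of d h d' h'] d(2) v(2) d'(2) v'(2) by (metis, metis, metis)
      have carr: "u g \<in> carrier F" "u' g \<in> carrier F" "ltrans F G d v g \<in> carrier F" "ltrans F G d v' g \<in> carrier F" for g
        using L lampsD(2) ltrans_lamps by blast+
      have uv: "u g = u' g \<and> ltrans F G d v g = ltrans F G d v' g" for g
      proof (cases "g \<in> ?dA d")
        case True
        then have "u g = \<one>\<^bsub>F\<^esub>" "u' g = \<one>\<^bsub>F\<^esub>" using lamps_onD(2) d(3) d'(3) dh by blast+
        then show ?thesis using fe[of g] carr[of g] dh by simp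
      next
        case False
        then have "ltrans F G d v g = \<one>\<^bsub>F\<^esub>" "ltrans F G d v' g = \<one>\<^bsub>F\<^esub>"
          using lt_off v(3) v'(3) d(2) by blast+
        then show ?thesis using fe[of g] carr[of g] dh by simp
      qed
      then have "u = u'" "ltrans F G d v = ltrans F G d v'" by auto
      moreover from this have "v = v'" using ltrans_inverse(2)[of v d] ltrans_inverse(2)[of v' d] L by metis
      ultimately show "p = p'" using xy d(1) v(1) d'(1) v'(1) dh by simp
    qed
    show "(\<lambda>(x, y). x \<otimes>\<^bsub>W\<^esub> y) ` (wshift D A B \<times> wtile A) = wtile B"
    proof (intro equalityI subsetI)
      fix z assume "z \<in> (\<lambda>(x, y). x \<otimes>\<^bsub>W\<^esub> y) ` (wshift D A B \<times> wtile A)"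
      then obtain x y where xy: "x \<in> wshift D A B" "y \<in> wtile A" "z = x \<otimes>\<^bsub>W\<^esub> y" by auto
      obtain d u where d: "x = wmk F u d" "d \<in> D" "u \<in> lamps_on (B - ?dA d)" using elim_shift xy by blast
      obtain v h where v: "y = wmk F v h" "h \<in> A" "v \<in> lamps_on A" using elim_tile xy by blast
      have "z = wmk F (\<lambda>g. u g \<otimes>\<^bsub>F\<^esub> ltrans F G d v g) (d \<otimes> h)"
        using xy(3) d v D lamps_onD(1) by (simp add: wmk_mult subset_iff)
      moreover have "d \<otimes> h \<in> B" using dAB d(2) v(2) by blast
      ultimately show "z \<in> wtile B" using prod_in[OF d(3) v(3) d(2)] unfolding wtile_def by force
    next
      fix z assume "z \<in> wtile B"
      then obtain w m where w: "z = wmk F w m" "w \<in> lamps_on B" "m \<in> B" by (auto simp: wtile_def)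
      from w(3) have "m \<in> (\<lambda>(d, t). d \<otimes> t) ` (D \<times> A)"
        by (simp only: bij_betw_imp_surj_on[OF tile])
      then obtain d h where dh: "d \<in> D" "h \<in> A" "m = d \<otimes> h" by auto
      have dc: "d \<in> carrier G" using dh D by blast
      define u where "u g = (if g \<in> ?dA d then \<one>\<^bsub>F\<^esub> else w g)" for g
      define w1 where "w1 g = (if g \<in> ?dA d then w g else \<one>\<^bsub>F\<^esub>)" for g
      have wB: "(\<forall>g\<in>B. w g \<in> carrier F) \<and> (\<forall>g. g \<notin> B \<longrightarrow> w g = \<one>\<^bsub>F\<^esub>)"
        using w(2) lamps_on_iff[OF B] by simp
      have u: "u \<in> lamps_on (B - ?dA d)"
        using wB B by (subst lamps_on_iff) (auto simp: u_def)
      have w1: "w1 \<in> lamps_on (?dA d)"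
        using wB B dAB[OF dh(1)] A by (subst lamps_on_iff) (auto simp: w1_def)
      then have w1L: "w1 \<in> lamps F G" by (rule lamps_onD)
      define v where "v = ltrans F G (inv d) w1"
      have vL: "v \<in> lamps F G" unfolding v_def using w1L dc by (simp add: ltrans_lamps)
      have "{g. v g \<noteq> \<one>\<^bsub>F\<^esub>} \<subseteq> A"
      proof
        fix g assume "g \<in> {g. v g \<noteq> \<one>\<^bsub>F\<^esub>}"
        then obtain k where k: "g = inv d \<otimes> k" "w1 k \<noteq> \<one>\<^bsub>F\<^esub>"
          using ltrans_supp[OF w1L, of "inv d"] dc unfolding v_def by auto
        then obtain t where t: "t \<in> A" "k = d \<otimes> t" by (auto simp: w1_def split: if_splits)
        then have "t \<in> carrier G" using A by blast
        then have "g = t" using k t dc by (simp add: G.m_assoc[symmetric])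
        then show "g \<in> A" using t by simp
      qed
      then have v: "v \<in> lamps_on A" using vL by (simp add: lamps_on_def)
      have "ltrans F G d v = w1" unfolding v_def using w1L dc by (simp add: ltrans_inverse)
      moreover have "(\<lambda>g. u g \<otimes>\<^bsub>F\<^esub> w1 g) = w"
        using lampsD(2)[OF lamps_onD(1)[OF w(2)]] by (auto simp: u_def w1_def)
      ultimately have "wmk F u d \<otimes>\<^bsub>W\<^esub> wmk F v h = z"
        using lamps_onD(1)[OF u] vL dc w(1) dh(3) by (simp add: wmk_mult)
      moreover have "wmk F u d \<in> wshift D A B" using u dh(1) by (force simp: wshift_def)
      moreover have "wmk F v h \<in> wtile A" using v dh(2) by (force simp: wtile_def)
      ultimately show "z \<in> (\<lambda>(x, y). x \<otimes>\<^bsub>W\<^esub> y) ` (wshift D A B \<times> wtile A)" by force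
    qed
  qed
qed

lemma finite_wshift:
  assumes F: "finite (carrier F)" and B: "finite B" "B \<subseteq> carrier G" and D: "finite D" "D \<subseteq> carrier G"
  shows "finite (wshift D A B)" "wshift D A B \<subseteq> carrier W" "card D \<le> card (wshift D A B)"
proof -
  have "finite (lamps_on (B - (\<lambda>t. d \<otimes> t) ` A))" for d
    using B by (intro card_lamps_on(1)[OF F]) auto
  then show fin: "finite (wshift D A B)" unfolding wshift_def using D(1) by simp
  show "wshift D A B \<subseteq> carrier W"
    unfolding wshift_def using D(2) by (auto intro!: wmk_in_carrier dest: lamps_onD)
  have "(\<lambda>d. wmk F (\<lambda>_. \<one>\<^bsub>F\<^esub>) d) ` D \<subseteq> wshift D A B"
    unfolding wshift_def using one_lamps_on by force
  moreover have "inj_on (\<lambda>d. wmk F (\<lambda>_. \<one>\<^bsub>F\<^esub>) d) D" by (simp add: inj_on_def wmk_inject one_lamps)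
  ultimately show "card D \<le> card (wshift D A B)" using fin by (intro card_inj_on_le)
qed

text \<open>Multiplying \<open>(u, h)\<close> by \<open>(u0, h0)\<close> from the right moves the
  cursor to \<open>h \<otimes> h0\<close> and affects only lamps at \<open>h \<otimes> s\<close>
  with \<open>s\<close> in the support of \<open>u0\<close>. Leaving the tile thus forces
  \<open>h\<close> into one of the exit sets of \<open>A\<close>, while \<open>u\<close> is
  arbitrary, whence the power of \<open>card (carrier F)\<close>.\<close>

lemma wtile_boundary:
  assumes F: "finite (carrier F)" and A: "finite A" "A \<subseteq> carrier G"
    and u0: "u0 \<in> lamps F G" and h0: "h0 \<in> carrier G"
  shows "card {x \<in> wtile A. x \<otimes>\<^bsub>W\<^esub> wmk F u0 h0 \<notin> wtile A}
    \<le> card (carrier F) ^ card A * (\<Sum>g\<in>insert h0 {g. u0 g \<noteq> \<one>\<^bsub>F\<^esub>}. card (right_exit G A g))"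
proof -
  let ?S = "insert h0 {g. u0 g \<noteq> \<one>\<^bsub>F\<^esub>}"
  have S: "finite ?S" using lampsD(1)[OF u0] by simp
  let ?U = "\<Union>g\<in>?S. (right_exit G A g)"
  have U: "finite ?U" using S A(1) by simp
  have L: "finite (lamps_on A)" "card (lamps_on A) = card (carrier F) ^ card A"
    using card_lamps_on[OF F A] by auto
  have "{x \<in> wtile A. x \<otimes>\<^bsub>W\<^esub> wmk F u0 h0 \<notin> wtile A} \<subseteq> (\<lambda>(u, h). wmk F u h) ` (lamps_on A \<times> ?U)"
  proof
    fix x assume x: "x \<in> {x \<in> wtile A. x \<otimes>\<^bsub>W\<^esub> wmk F u0 h0 \<notin> wtile A}"
    then obtain u h where uh: "x = wmk F u h" "u \<in> lamps_on A" "h \<in> A" by (auto simp: wtile_def)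
    have hc: "h \<in> carrier G" and uL: "u \<in> lamps F G" using uh A lamps_onD(1) by auto
    have "h \<in> ?U"
    proof (rule ccontr)
      assume "h \<notin> ?U"
      then have S_in: "h \<otimes> g \<in> A" if "g \<in> ?S" for g using that uh(3) by blast
      have "ltrans F G h u0 g = \<one>\<^bsub>F\<^esub>" if "g \<notin> A" for g
      proof (rule ccontr)
        assume "ltrans F G h u0 g \<noteq> \<one>\<^bsub>F\<^esub>"
        then have "g \<in> {g. ltrans F G h u0 g \<noteq> \<one>\<^bsub>F\<^esub>}" by simp
        then obtain s where "g = h \<otimes> s" "u0 s \<noteq> \<one>\<^bsub>F\<^esub>"
          unfolding ltrans_supp[OF u0 hc] by auto
        then show False using S_in[of s] that by simp
      qed
      then have "u g \<otimes>\<^bsub>F\<^esub> ltrans F G h u0 g = \<one>\<^bsub>F\<^esub>" if "g \<notin> A" for g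
        using that lamps_onD(2)[OF uh(2)] by simp
      moreover have "(\<lambda>g. u g \<otimes>\<^bsub>F\<^esub> ltrans F G h u0 g) \<in> lamps F G"
        using uL u0 hc by (intro mult_lamps ltrans_lamps)
      ultimately have "(\<lambda>g. u g \<otimes>\<^bsub>F\<^esub> ltrans F G h u0 g) \<in> lamps_on A" by (auto simp: lamps_on_def)
      moreover have "h \<otimes> h0 \<in> A" using S_in by blast
      ultimately have "x \<otimes>\<^bsub>W\<^esub> wmk F u0 h0 \<in> wtile A"
        unfolding uh(1) wmk_mult[OF uL u0 hc] wtile_def by force
      then show False using x by simp
    qed
    then show "x \<in> (\<lambda>(u, h). wmk F u h) ` (lamps_on A \<times> ?U)" using uh by force
  qed
  then have "card {x \<in> wtile A. x \<otimes>\<^bsub>W\<^esub> wmk F u0 h0 \<notin> wtile A}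
      \<le> card ((\<lambda>(u, h). wmk F u h) ` (lamps_on A \<times> ?U))"
    using L U by (intro card_mono finite_imageI finite_cartesian_product)
  also have "\<dots> \<le> card (lamps_on A \<times> ?U)" using L U by (intro card_image_le finite_cartesian_product)
  also have "\<dots> = card (carrier F) ^ card A * card ?U" by (simp only: card_cartesian_product L)
  also have "\<dots> \<le> card (carrier F) ^ card A * (\<Sum>g\<in>?S. card (right_exit G A g))"
    by (intro mult_left_mono card_UN_le[OF S]) simp
  finally show ?thesis .
qed

text \<open>The 4 collects \<open>ln t \<le> t\<close> and \<open>ln 4 \<le> 3\<close>, the latter
  from absorbing \<open>exp 1 \<le> 3\<close> into a number that is at least 1.\<close>

lemma ln_wtile_card_le:
  assumes "(q :: nat) \<ge> 1" "(t :: nat) \<ge> 1"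
  shows "ln (real (q ^ t * t) + exp 1) \<le> (ln q + 4) * t"
proof -
  have 1: "real (q ^ t * t) \<ge> 1"
    using assms by (metis mult_le_mono nat_mult_1 of_nat_1 of_nat_mono one_le_power)
  then have "real (q ^ t * t) + exp 1 \<le> real (q ^ t * t) * 4"
    using exp_le by linarith
  then have "ln (real (q ^ t * t) + exp 1) \<le> ln (real (q ^ t * t) * 4)"
    using 1 by (subst ln_le_cancel_iff) (auto intro: add_nonneg_pos)
  also have "\<dots> = t * ln q + ln t + ln 4"
    using assms by (simp add: ln_mult ln_realpow)
  also have "ln (real t) \<le> real t" using assms ln_le_minus_one[of "real t"] by simp
  also have "ln (4 :: real) \<le> 3" using ln_le_minus_one[of "4 :: real"] by simp
  also have "t * ln q + t + 3 \<le> (ln q + 4) * t" using assms by (simp add: algebra_simps)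
  finally show ?thesis by simp
qed

text \<open>The logarithm of the new tile size is linear in the old one, which accounts for one more
  iteration in \<open>iterlog\<close>. In the relative boundary the number of lamp configurations
  cancels, so the rate 2^-k is inherited, with the constants summed over the support of the lamps
  and the cursor.\<close>

lemma log_tiles_wreath:
  assumes F: "finite (carrier F)" and TD: "log_tiles n G T D"
  shows "log_tiles (Suc n) W (\<lambda>k. wtile (T k)) (\<lambda>k. wshift (D k) (T k) (T (Suc k)))"
proof -
  have T: "finite (T k)" "T k \<subseteq> carrier G" "T k \<noteq> {}" and D: "finite (D k)" "D k \<subseteq> carrier G" "card (D k) \<ge> 2"
    and tile: "bij_betw (\<lambda>(d, t). d \<otimes> t) (D k \<times> T k) (T (Suc k))" for k
    using TD unfolding log_tiles_def by simp_all
  obtain C where C: "C > 0" "\<And>k. iterlog n (card (T k)) \<le> C * 2 ^ k" using TD unfolding log_tiles_def by auto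
  have bad: "\<exists>C\<ge>0. \<forall>k. card (right_exit G (T k) g) \<le> C / 2 ^ k * card (T k)" if "g \<in> carrier G" for g
    using TD that unfolding log_tiles_def by simp
  define q where "q = card (carrier F)"
  have q1: "q \<ge> 1" unfolding q_def using F F.one_closed by (metis One_nat_def Suc_leI card_gt_0_iff empty_iff)
  have t1: "card (T k) \<ge> 1" for k using T by (simp add: Suc_le_eq card_gt_0_iff)
  have cT: "card (wtile (T k)) = q ^ card (T k) * card (T k)" for k
    unfolding q_def by (rule card_wtile[OF F T(1,2)])
  show ?thesis
    unfolding log_tiles_def
  proof (intro conjI allI ballI)
    fix k
    show "finite (wtile (T k))" "wtile (T k) \<subseteq> carrier W" using card_wtile[OF F T(1,2)] by auto
    have "card (wtile (T k)) > 0" unfolding cT using q1 t1[of k] by simp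
    then show "wtile (T k) \<noteq> {}" by auto
    show "finite (wshift (D k) (T k) (T (Suc k)))" "wshift (D k) (T k) (T (Suc k)) \<subseteq> carrier W"
      "2 \<le> card (wshift (D k) (T k) (T (Suc k)))"
      using finite_wshift[OF F T(1,2)[of "Suc k"] D(1,2)[of k], of "T k"] D(3)[of k] by auto
    show "bij_betw (\<lambda>(d, t). d \<otimes>\<^bsub>W\<^esub> t) (wshift (D k) (T k) (T (Suc k)) \<times> wtile (T k)) (wtile (T (Suc k)))"
      by (rule bij_wtile[OF T(1,2) T(1,2) D(2) tile])
  next
    have "iterlog (Suc n) (card (wtile (T k))) \<le> ((ln q + 4) * C) * 2 ^ k" for k
    proof -
      have "iterlog (Suc n) (card (wtile (T k))) \<le> iterlog n ((ln q + 4) * card (T k))"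
        unfolding cT iterlog.simps using ln_wtile_card_le[OF q1 t1[of k]] ln_add_e_ge_1
        by (intro iterlog_mono) (auto intro: order_trans[OF zero_le_one])
      also have "\<dots> \<le> (ln q + 4) * iterlog n (card (T k))"
        using q1 by (intro iterlog_mult) (auto intro: add_increasing)
      also have "\<dots> \<le> (ln q + 4) * (C * 2 ^ k)"
        using q1 C(2)[of k] by (intro mult_left_mono) (auto intro: add_nonneg_nonneg)
      finally show ?thesis by (simp only: mult.assoc)
    qed
    then show "\<exists>C>0. \<forall>k. iterlog (Suc n) (card (wtile (T k))) \<le> C * 2 ^ k"
      using q1 C(1) by (intro exI[of _ "(ln q + 4) * C"]) (auto intro!: mult_pos_pos add_nonneg_pos)
  next
    fix x assume "x \<in> carrier W"
    then obtain u0 h0 where x: "u0 \<in> lamps F G" "h0 \<in> carrier G" "x = wmk F u0 h0" by (elim carrier_cases)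
    let ?S = "insert h0 {g. u0 g \<noteq> \<one>\<^bsub>F\<^esub>}"
    have "?S \<subseteq> carrier G" using x(1,2) by (auto simp: lamps_def)
    then have "\<forall>g\<in>?S. \<exists>C\<ge>0. \<forall>k. card (right_exit G (T k) g) \<le> C / 2 ^ k * card (T k)"
      using bad by blast
    from bchoice[OF this] obtain c where
      c_all: "\<forall>g\<in>?S. c g \<ge> 0 \<and> (\<forall>k. card (right_exit G (T k) g) \<le> c g / 2 ^ k * card (T k))" ..
    have c: "c g \<ge> 0" "card (right_exit G (T k) g) \<le> c g / 2 ^ k * card (T k)"
      if "g \<in> ?S" for g k using bspec[OF c_all that] by simp_all
    have "card (right_exit W (wtile (T k)) x) \<le> (\<Sum>g\<in>?S. c g) / 2 ^ k * card (wtile (T k))" for k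
    proof -
      have "real (card (right_exit W (wtile (T k)) x))
          \<le> real (q ^ card (T k) * (\<Sum>g\<in>?S. card (right_exit G (T k) g)))"
        unfolding q_def x(3) by (intro of_nat_mono wtile_boundary[OF F T(1,2) x(1,2)])
      also have "\<dots> = real (q ^ card (T k)) * (\<Sum>g\<in>?S. real (card (right_exit G (T k) g)))"
        by (simp only: of_nat_mult of_nat_sum)
      also have "\<dots> \<le> real (q ^ card (T k)) * (\<Sum>g\<in>?S. c g / 2 ^ k * card (T k))"
        by (intro mult_left_mono sum_mono c(2)) auto
      also have "\<dots> = (\<Sum>g\<in>?S. c g) / 2 ^ k * card (wtile (T k))"
        unfolding sum_distrib_right[symmetric] sum_divide_distrib[symmetric] cT of_nat_mult
        by (simp only: mult_ac)
      finally show ?thesis .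
    qed
    moreover have "(\<Sum>g\<in>?S. c g) \<ge> 0" by (rule sum_nonneg) (rule c(1))
    ultimately show "\<exists>C\<ge>0. \<forall>k. card (right_exit W (wtile (T k)) x) \<le> C / 2 ^ k * card (wtile (T k))"
      by blast
  qed
qed

end

lemma log_tiles_Hgrp:
  assumes "group F" "finite (carrier F)"
  shows "\<exists>T D. log_tiles n (Hgrp F 1 n) T D"
proof (induction n)
  case 0
  show ?case by (rule log_tiles_Hgrp_0)
next
  case (Suc n)
  interpret wreath_groups F "Hgrp F 1 n" using assms(1) group_Hgrp[OF assms(1)] by (simp add: wreath_groups_def)
  show ?case using Suc log_tiles_wreath[OF assms(2)] unfolding Hgrp_Suc by blast
qed

text \<open>Eventually \<open>\<phi>\<close> at the tile size of level \<open>Suc k\<close> is at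
  most a constant times 2^(p k), and the relative boundary at level \<open>k\<close> is at most a
  constant times 2^-k. The series in \<open>coupling_integrable\<close> is thus dominated by a
  geometric one of ratio \<open>2 powr p / 2\<close>, less than 1 exactly because
  \<open>p < 1\<close>.\<close>

theorem coupling_exists:
  fixes F :: "('f, 'b) monoid_scheme" and \<phi> :: "real \<Rightarrow> real"
  assumes F: "group F" "finite (carrier F)" and p: "0 < p" "p < 1"
    and \<phi>: "mono_on {0..} \<phi>" "\<forall>t\<ge>0. \<phi> t \<ge> 0" "\<exists>T. \<forall>t\<ge>T. \<phi> t = ((ln ^^ n) t) powr p"
  shows "\<exists>(M :: real measure) \<alpha> \<beta> Y X. phi_L0_coupling \<phi> (Hgrp F 1 n) integer_group {1} M \<alpha> \<beta> Y X"
proof -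
  define \<Gamma> where "\<Gamma> = Hgrp F 1 n"
  obtain T D where TD: "log_tiles n \<Gamma> T D" using log_tiles_Hgrp[OF F] unfolding \<Gamma>_def by blast
  have bad: "\<exists>C\<ge>0. \<forall>k. card (right_exit \<Gamma> (T k) g) \<le> C / 2 ^ k * card (T k)" if "g \<in> carrier \<Gamma>" for g
    using TD that unfolding log_tiles_def by simp
  have T: "finite (T k)" "T k \<noteq> {}" for k
    using TD unfolding log_tiles_def by simp_all
  have ratio: "\<exists>C\<ge>0. \<forall>k. card (right_exit \<Gamma> (T k) g) / card (T k) \<le> C / 2 ^ k" if "g \<in> carrier \<Gamma>" for g
  proof -
    have "real (card (T k)) > 0" for k using T by (simp add: card_gt_0_iff)
    then show ?thesis using bad[OF that] by (simp add: pos_divide_le_eq)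
  qed
  interpret \<Gamma>: group \<Gamma> unfolding \<Gamma>_def by (rule group_Hgrp[OF F(1)])
  interpret tiling \<Gamma> T D
  proof unfold_locales
    show "(\<lambda>k. card (right_exit \<Gamma> (T k) g) / card (T k)) \<longlonglongrightarrow> 0" if g: "g \<in> carrier \<Gamma>" for g
    proof -
      obtain C where C: "\<And>k. card (right_exit \<Gamma> (T k) g) / card (T k) \<le> C / 2 ^ k"
        using ratio[OF g] by auto
      have lim: "(\<lambda>k. C / 2 ^ k) \<longlonglongrightarrow> 0" by (intro LIMSEQ_divide_realpow_zero) simp
      show ?thesis by (rule tendsto_sandwich[OF _ _ tendsto_const lim]) (simp_all add: C)
    qed
  qed (use TD countable_Hgrp[OF F, of n] in \<open>simp_all add: log_tiles_def flip: \<Gamma>_def One_nat_def\<close>)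
  obtain C where C: "C > 0" "\<And>k. iterlog n (card (T k)) \<le> C * 2 ^ k" using TD unfolding log_tiles_def by auto
  have "\<forall>\<^sub>F t in at_top. (ln ^^ n) t \<ge> (1 :: real)"
    using filterlim_iterated_ln[of n] by (simp add: filterlim_at_top)
  moreover have "\<forall>\<^sub>F t in at_top. \<phi> t = ((ln ^^ n) t) powr p"
    using \<phi>(3) by (auto simp: eventually_at_top_linorder)
  ultimately have "\<forall>\<^sub>F t in at_top. \<phi> t \<le> iterlog n t powr p"
    using iterlog_ge_ln[of n]
  proof eventually_elim
    case (elim t)
    then show ?case using p by (simp add: powr_mono2)
  qed
  moreover have "filterlim (\<lambda>k. real (card (T (Suc k)))) at_top sequentially"
  proof (rule filterlim_at_top_mono)
    show "filterlim real at_top sequentially" by (rule filterlim_real_sequentially)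
    have "real k \<le> real (card (T (Suc k)))" for k
    proof -
      have "int k < 2 ^ Suc k" 
        using of_nat_less_two_power[of k, where 'a = int] zero_less_power[of "2 :: int" k]
        by (simp only: power_Suc)
      then have "int k < N (Suc k)" using N_ge[of "Suc k"] by linarith
      then show ?thesis by simp
    qed
    then show "\<forall>\<^sub>F k in sequentially. real k \<le> real (card (T (Suc k)))" by simp
  qed
  ultimately have ev: "\<forall>\<^sub>F k in sequentially. \<phi> (card (T (Suc k))) \<le> iterlog n (card (T (Suc k))) powr p"
    by (rule eventually_compose_filterlim)
  have \<phi>_le: "\<forall>\<^sub>F k in sequentially. \<phi> (card (T (Suc k))) \<le> (2 * C) powr p * (2 powr p) ^ k"
    using ev
  proof eventually_elim
    case (elim k)
    have "iterlog n (card (T (Suc k))) powr p \<le> ((2 * C) * 2 ^ k) powr p"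
      using C(2)[of "Suc k"] p by (intro powr_mono2) (auto simp: iterlog_nonneg)
    also have "\<dots> = (2 * C) powr p * (2 ^ k) powr p" using C(1) by (simp add: powr_mult)
    also have "((2 :: real) ^ k) powr p = (2 powr p) ^ k"
      by (simp add: powr_realpow[symmetric] powr_powr mult.commute)
    finally show ?case using elim by simp
  qed
  have "phi_integrable_cocycle \<phi> \<Gamma> integer_group {1} M \<alpha> (\<lambda>l y. y + of_int l) (\<Omega> \<inter> {0..<1})"
  proof (rule coupling_integrable)
    fix g assume "g \<in> carrier \<Gamma>"
    then obtain c where c: "c \<ge> 0" "\<And>k. card (right_exit \<Gamma> (T k) g) / card (T k) \<le> c / 2 ^ k"
      using ratio by blast
    have "2 powr p < 2 powr (1 :: real)" using p by (intro powr_less_mono) auto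
    then have "summable (\<lambda>k. (2 * C) powr p * c * (2 powr p / 2) ^ k)"
      by (intro summable_mult summable_geometric) simp
    moreover have "\<forall>\<^sub>F k in sequentially. norm (\<phi> (card (T (Suc k)))
        * (card (right_exit \<Gamma> (T k) g) / card (T k))) \<le> (2 * C) powr p * c * (2 powr p / 2) ^ k"
      using \<phi>_le
    proof eventually_elim
      case (elim k)
      have "\<phi> (card (T (Suc k))) * (card (right_exit \<Gamma> (T k) g) / card (T k))
          \<le> ((2 * C) powr p * (2 powr p) ^ k) * (c / 2 ^ k)"
        using elim c \<phi>(2) by (intro mult_mono) auto
      also have "\<dots> = (2 * C) powr p * c * (2 powr p / 2) ^ k" by (simp add: power_divide)
      finally show ?case using \<phi>(2) by (simp add: abs_mult)
    qed
    ultimately show "summable (\<lambda>k. \<phi> (card (T (Suc k))) * (card (right_exit \<Gamma> (T k) g) / card (T k)))"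
      by (rule summable_comparison_test_ev[rotated])
  qed (use \<phi> in auto)
  then show ?thesis using ME_coupling_M unfolding phi_L0_coupling_def \<Gamma>_def by blast
qed

theorem theorem4p11:
  fixes F :: "('f, 'b) monoid_scheme" and n :: nat and p :: real and \<phi> :: "real \<Rightarrow> real"
  assumes "group F" and "finite (carrier F)" and "card (carrier F) \<noteq> 1"
    and "n \<ge> 1" and "p > 0"
    and "mono_on {0..} \<phi>" and "\<forall>t\<ge>0. \<phi> t \<ge> 0"
    and "\<exists>T. \<forall>t\<ge>T. \<phi> t = ((ln ^^ n) t) powr p"
  shows "(p < 1 \<longrightarrow> (\<exists>(M :: real measure) \<alpha> \<beta> X\<Gamma> X\<Lambda>.
              phi_L0_coupling \<phi> (Hgrp F 1 n) integer_group {1} M \<alpha> \<beta> X\<Gamma> X\<Lambda>))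
       \<and> ((\<exists>(M :: 'o measure) \<alpha> \<beta> X\<Gamma> X\<Lambda>.
              phi_L0_coupling \<phi> (Hgrp F 1 n) integer_group {1} M \<alpha> \<beta> X\<Gamma> X\<Lambda>) \<longrightarrow> p < 1)"
  using coupling_exists[OF assms(1,2,5) _ assms(6-8)] coupling_exponent_less_1[OF assms(1-4,7,8)] by blast

end
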